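(* Let $E$ be a Euclidean space with $\dim E\ge 2$ and consider the Newtonian $N$-body problem in $E$ with masses $m_1,\dots,m_N>0$. For every $h>0$, every $p\in E^N$ and every $a\in\Omega$, there is a geodesic ray of the Jacobi-Maupertuis metric of level $h$ with asymptotic direction $a$ and starting at $p$.
   Context: $E$ is a finite-dimensional Euclidean space, $N\ge 2$, $m_1,\dots,m_N>0$. For $x=(r_1,\dots,r_N),\,y=(s_1,\dots,s_N)\in E^N$ the mass inner product is $\langle x,y\rangle=\sum_i m_i\langle r_i,s_i\rangle_E$, with norm $\|\cdot\|$. The Newtonian potential is $U(x)=\sum_{i<j}m_im_j\|r_i-r_j\|_E^{-1}\in(0,+\infty]$, and $\Omega=\{x\in E^N: U(x)<+\infty\}$ is the set of configurations without collisions. The Jacobi-Maupertuis metric of level $h$ is the Riemannian metric $j_h=2(h+U)\,g_m$ on $\Omega$, where $g_m$ is the Euclidean metric given by the mass inner product. Its Riemannian distance $d_h$ on $\Omega$ extends to a distance $\phi_h$ on $E^N$ (the Jacobi-Maupertuis distance), which is a metric completion of $(\Omega,d_h)$ and is given by the action potential $$\phi_h(x,y)=\inf_\gamma \int_a^b\Big(\tfrac12\|\dot\gamma\|^2+U(\gamma)+h\Big)\,dt,$$ the infimum being over all absolutely continuous curves $\gamma:[a,b]\to E^N$ (with $a<b$ arbitrary), $\gamma(a)=x$, $\gamma(b)=y$. A geodesic ray from $p$ is a curve $\gamma:[0,+\infty)\to E^N$ with $\gamma(0)=p$ and $\phi_h(\gamma(s),\gamma(t))=|t-s|$ for all $s,t\ge0$.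 It has asymptotic direction $a\in\Omega$ if $\gamma(s)=\lambda s\,a+o(s)$ as $s\to+\infty$ for some $\lambda>0$. *)

theory Defs
  imports "HOL-Analysis.Analysis" "HOL-Library.Landau_Symbols"
begin

text \<open>
  A configuration of \<open>N = CARD('n)\<close> bodies in the Euclidean space \<open>'e\<close> is an element of
  \<open>'e ^ 'n\<close>. The bodies are indexed by a finite linearly ordered type, so that a sum over
  \<open>i < j\<close> makes sense; \<open>m i\<close> is the mass of body \<open>i\<close>.
  Where the index type is ordered, \<open>'e ^ 'n\<close> is spelled \<open>('e, 'n) vec\<close>: the infix notation would
  constrain \<open>'n\<close> to the sort \<open>finite\<close> only.
\<close>

definition mass_inner ::
    "('n::finite \<Rightarrow> real) \<Rightarrow> 'e::euclidean_space ^ 'n \<Rightarrow> 'e ^ 'n \<Rightarrow> real" where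
  "mass_inner m x y = (\<Sum>i\<in>UNIV. m i * ((x $ i) \<bullet> (y $ i)))"

definition mass_norm :: "('n::finite \<Rightarrow> real) \<Rightarrow> 'e::euclidean_space ^ 'n \<Rightarrow> real" where
  "mass_norm m x = sqrt (mass_inner m x x)"

text \<open>
  The quotient is taken in \<^typ>\<open>ennreal\<close>, where \<open>c / 0 = \<infinity>\<close> for \<open>c > 0\<close>: the potential is
  infinite exactly at collisions.
\<close>

definition newton_potential ::
    "('n::{finite,linorder} \<Rightarrow> real) \<Rightarrow> ('e::euclidean_space, 'n) vec \<Rightarrow> ennreal" where
  "newton_potential m x =
     (\<Sum>(i, j) \<in> {(i, j). i < j}. ennreal (m i * m j) / ennreal (norm (x $ i - x $ j)))"

definition collision_free ::
    "('n::{finite,linorder} \<Rightarrow> real) \<Rightarrow> ('e::euclidean_space, 'n) vec set" where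
  "collision_free m = {x. newton_potential m x < \<infinity>}"

lemma newton_potential_eq_top_iff:
  assumes "\<And>i. m i > 0"
  shows "newton_potential m x = \<infinity> \<longleftrightarrow> (\<exists>i j. i < j \<and> x $ i = x $ j)"
proof -
  have "ennreal (m i * m j) \<noteq> 0" for i j
    using assms[of i] assms[of j] by simp
  then have "ennreal (m i * m j) / ennreal (norm (x $ i - x $ j)) = \<infinity> \<longleftrightarrow> x $ i = x $ j" for i j
    by (simp add: ennreal_divide_eq_top_iff)
  then show ?thesis
    unfolding newton_potential_def infinity_ennreal_def by (auto simp: case_prod_beta)
qed

text \<open>The usual \<open>\<epsilon>\<close>-\<open>\<delta>\<close> definition, over finite families of pairwise disjoint open intervals.\<close>

definition absolutely_continuous_on_interval ::
    "real \<Rightarrow> real \<Rightarrow> (real \<Rightarrow> 'v::real_normed_vector) \<Rightarrow> bool" where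
  "absolutely_continuous_on_interval a b \<gamma> \<longleftrightarrow>
     (\<forall>\<epsilon>>0. \<exists>\<delta>>0. \<forall>(n::nat) u v.
        (\<forall>k<n. a \<le> u k \<and> u k \<le> v k \<and> v k \<le> b) \<and>
        disjoint_family_on (\<lambda>k. {u k<..<v k}) {..<n} \<and>
        (\<Sum>k<n. v k - u k) < \<delta>
        \<longrightarrow> (\<Sum>k<n. norm (\<gamma> (v k) - \<gamma> (u k))) < \<epsilon>)"

text \<open>
  For an absolutely continuous curve the derivative exists almost everywhere, so the arbitrary
  value of \<^const>\<open>vector_derivative\<close> elsewhere does not affect the integral. The level \<open>h\<close> is
  meant to be nonnegative, since \<^const>\<open>ennreal\<close> truncates negative reals to \<open>0\<close>.
\<close>

definition lagrangian_action ::
    "('n::{finite,linorder} \<Rightarrow> real) \<Rightarrow> real \<Rightarrow> real \<Rightarrow> real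
      \<Rightarrow> (real \<Rightarrow> ('e::euclidean_space, 'n) vec) \<Rightarrow> ennreal" where
  "lagrangian_action m h a b \<gamma> =
     (\<integral>\<^sup>+ t \<in> {a..b}.
        (ennreal (1/2 * (mass_norm m (vector_derivative \<gamma> (at t within {a..b})))\<^sup>2)
          + newton_potential m (\<gamma> t) + ennreal h) \<partial>lebesgue)"

text \<open>
  The action potential, which for \<open>h > 0\<close> is the extension to all configurations of the
  Riemannian distance of the metric \<open>2 (h + U) g\<close>, with \<open>g\<close> the mass inner product, on the
  configurations without collisions.
\<close>

definition jacobi_maupertuis_dist ::
    "('n::{finite,linorder} \<Rightarrow> real) \<Rightarrow> real
      \<Rightarrow> ('e::euclidean_space, 'n) vec \<Rightarrow> ('e, 'n) vec \<Rightarrow> ennreal" where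
  "jacobi_maupertuis_dist m h x y =
     Inf {lagrangian_action m h a b \<gamma> | a b \<gamma>.
            a < b \<and> absolutely_continuous_on_interval a b \<gamma> \<and> \<gamma> a = x \<and> \<gamma> b = y}"

text \<open>Only the restriction of \<open>\<gamma>\<close> to \<open>{0..}\<close> matters in the next two definitions.\<close>

definition jm_geodesic_ray ::
    "('n::{finite,linorder} \<Rightarrow> real) \<Rightarrow> real
      \<Rightarrow> ('e::euclidean_space, 'n) vec \<Rightarrow> (real \<Rightarrow> ('e, 'n) vec) \<Rightarrow> bool" where
  "jm_geodesic_ray m h p \<gamma> \<longleftrightarrow>
     continuous_on {0..} \<gamma> \<and> \<gamma> 0 = p \<and>
     (\<forall>s\<ge>0. \<forall>t\<ge>0. jacobi_maupertuis_dist m h (\<gamma> s) (\<gamma> t) = ennreal \<bar>t - s\<bar>)"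

definition has_asymptotic_direction ::
    "('n::finite \<Rightarrow> real) \<Rightarrow> (real \<Rightarrow> 'e::euclidean_space ^ 'n) \<Rightarrow> 'e ^ 'n \<Rightarrow> bool" where
  "has_asymptotic_direction m \<gamma> a \<longleftrightarrow>
     (\<exists>l>0. (\<lambda>s. mass_norm m (\<gamma> s - (l * s) *\<^sub>R a)) \<in> o[at_top](\<lambda>s. s))"

end

theory Submission
  imports Defs
begin

text \<open>
  Write \<open>c = sqrt (2 * h)\<close>, let \<open>|x|\<close> be the mass norm and \<open>d\<close> the action potential. Two estimates
  compare \<open>d\<close> with the metric \<open>c * |x - y|\<close> of free motion. Since \<open>|u|\<^sup>2 / 2 + h \<ge> c * |u|\<close>, always
  \<open>d x y \<ge> c * |x - y|\<close>. Conversely, let \<open>v\<close> be the positive multiple of \<open>a\<close> with \<open>c * |v| = 1\<close>. If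
  \<open>y\<close> is about \<open>p + T * v\<close>, the straight line from \<open>v\<close> to \<open>y\<close> spreads the bodies linearly, so the
  potential integrates to much less than \<open>T\<close> along it, and \<open>d p y \<le> c * |y - p| + C * sqrt T\<close>
  (\<open>jm_real_dist_cone\<close>).
  
  Suppose now that \<open>z\<close> lies between \<open>p\<close> and such a \<open>y\<close>, in the sense that
  \<open>d p z + d z y = d p y\<close>, and put \<open>s = d p z\<close>, \<open>T = d p y\<close>. The two estimates make the Euclidean
  triangle \<open>p, z, y\<close> nearly degenerate, and for \<open>T \<le> 2 * s\<close> Stewart's identity shows that
  \<open>(z - p) / s\<close> and \<open>(y - p) / T\<close> differ by \<open>O (s powr (-1/4))\<close> (\<open>near_chord\<close>). For larger \<open>T\<close>,
  intermediate points at the scales \<open>2 * s, 4 * s, \<dots>\<close> turn this into a geometric series, so the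
  difference is still \<open>O (s powr (-1/4))\<close>, with a constant that depends neither on \<open>T\<close> nor on \<open>y\<close>
  (\<open>direction_error_between\<close>). Taking \<open>y = p + T * v\<close> with \<open>T \<rightarrow> \<infinity>\<close>, all points between \<open>p\<close> and
  \<open>y\<close> at distance \<open>s\<close> from \<open>p\<close> are \<open>s * v + O (s powr (3/4))\<close>, uniformly in \<open>T\<close>.
  
  It remains to pass to the limit. Closed \<open>d\<close>-balls are compact, so intermediate points exist exactly, and
  finitely many times can be realised by points which are isometrically placed. By Tychonoff's theorem
  the closed conditions "isometric at the times \<open>s\<close> and \<open>t\<close>" and "within \<open>O (s powr (3/4))\<close> of
  \<open>p + s * v\<close>" hold simultaneously for some curve, which is the desired ray
  (\<open>exists_ray_with_direction\<close>).
  
  What this needs from mechanics is that \<open>d\<close> is a finite metric inducing the Euclidean topology, also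
  at collisions. Its lower bound and its triangle inequality rest on the fundamental theorem of calculus
  for absolutely continuous curves, obtained from the almost everywhere differentiability of monotone
  functions. Its continuity (\<open>eventually_jm_dist_le\<close>) comes from pulling the bodies apart along one coordinate
  axis, in the order of their coordinates, at the rate \<open>t powr (2/3)\<close> at which both the kinetic energy and the
  potential are integrable.
\<close>

abbreviation "abs_continuous \<equiv> absolutely_continuous_on_interval"

abbreviation "jm_dist \<equiv> jacobi_maupertuis_dist"

section \<open>Almost everywhere differentiability of monotone functions\<close>

text \<open>
  The intervals contain \<open>x\<close> but need not be centred at it: these are the fine covers in the sense of
  Vitali, and intervals with \<open>x\<close> as an endpoint give the one-sided difference quotients.
\<close>

definition arbitrarily_short_at :: "real \<Rightarrow> (real \<Rightarrow> real \<Rightarrow> bool) \<Rightarrow> bool" where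
  "arbitrarily_short_at x P \<longleftrightarrow> (\<forall>d>0. \<exists>u v. u < v \<and> u \<le> x \<and> x \<le> v \<and> v - u < d \<and> P u v)"

lemma vitali_covering_intervals:
  fixes E :: "real set"
  assumes fine: "\<And>x. x \<in> E \<Longrightarrow> arbitrarily_short_at x P"
  obtains C where "countable C" "\<And>u v. (u, v) \<in> C \<Longrightarrow> u < v \<and> P u v"
    "disjoint_family_on (\<lambda>(u, v). {u..v}) C"
    "negligible (E - (\<Union>(u, v)\<in>C. {u..v}))"
proof -
  define K where "K = {(u, v). u < v \<and> P u v}"
  define c :: "real \<times> real \<Rightarrow> real" where "c = (\<lambda>(u, v). (u + v) / 2)"
  define r :: "real \<times> real \<Rightarrow> real" where "r = (\<lambda>(u, v). (v - u) / 2)"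
  have cball: "cball (c i) (r i) = (case i of (u, v) \<Rightarrow> {u..v})" for i
    by (cases i) (simp add: c_def r_def cball_eq_atLeastAtMost field_simps)
  have "\<exists>i. i \<in> K \<and> x \<in> cball (c i) (r i) \<and> r i < d" if x: "x \<in> E" and d: "0 < d" for x d
  proof -
    obtain u v where "u < v" "u \<le> x" "x \<le> v" "v - u < d" "P u v"
      using fine[OF x] d unfolding arbitrarily_short_at_def by blast
    then show ?thesis
      by (intro exI[of _ "(u, v)"]) (auto simp: K_def cball, simp add: r_def)
  qed
  note fine' = this
  have pos: "0 < r i" if "i \<in> K" for i
    using that by (auto simp: K_def r_def)
  obtain C where C: "countable C" "C \<subseteq> K"
     "pairwise (\<lambda>i j. disjnt (cball (c i) (r i)) (cball (c j) (r j))) C"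
     "negligible (E - (\<Union>i \<in> C. cball (c i) (r i)))"
    by (rule Vitali_covering_theorem_cballs[of K r E c, OF pos fine'])
  show thesis
  proof
    show "disjoint_family_on (\<lambda>(u, v). {u..v}) C"
      using C(3) unfolding disjoint_family_on_def pairwise_def disjnt_def cball by auto
    show "negligible (E - (\<Union>(u, v)\<in>C. {u..v}))"
      using C(4) unfolding cball .
  qed (use C in \<open>auto simp: K_def\<close>)
qed

text \<open>
  A monotone \<open>F\<close> maps disjoint intervals to intervals with disjoint interiors. The total increment of
  \<open>F\<close> over a countable family is therefore the measure of the union of the open image intervals, so
  that increments over nested families are compared by mere set inclusion.
\<close>

lemma emeasure_UN_image_intervals:
  fixes F :: "real \<Rightarrow> real"
  assumes F: "mono F" and C: "countable C" "\<And>u v. (u, v) \<in> C \<Longrightarrow> u < v"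
    "disjoint_family_on (\<lambda>(u, v). {u..v}) C"
  shows "emeasure lebesgue (\<Union>(u, v)\<in>C. {F u<..<F v})
      = (\<integral>\<^sup>+i. ennreal (F (snd i) - F (fst i)) \<partial>count_space C)"
proof -
  have disj: "disjoint_family_on (\<lambda>(u, v). {F u<..<F v}) C"
    unfolding disjoint_family_on_def
  proof (intro ballI impI equals0I)
    fix i j y assume ij: "i \<in> C" "j \<in> C" "i \<noteq> j"
      and yij: "y \<in> (case i of (u, v) \<Rightarrow> {F u<..<F v}) \<inter> (case j of (u, v) \<Rightarrow> {F u<..<F v})"
    obtain u v u' v' where eq: "i = (u, v)" "j = (u', v')" by fastforce
    have *: "(u, v) \<in> C" "(u', v') \<in> C" "(u, v) \<noteq> (u', v')" using ij eq by auto
    have y: "F u < y" "y < F v" "F u' < y" "y < F v'" using yij eq by auto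
    have "{u..v} \<inter> {u'..v'} = {}"
      using C(3) * unfolding disjoint_family_on_def by fastforce
    moreover have "u < v" "u' < v'" using C(2) * by auto
    ultimately have "v < u' \<or> v' < u" 
      by (auto simp: Int_atLeastAtMost)
    then have "F v \<le> F u' \<or> F v' \<le> F u"
      using monoD[OF F] by auto
    with y show False by linarith
  qed
  have "F (fst i) \<le> F (snd i)" if "i \<in> C" for i
    using C(2)[of "fst i" "snd i"] that by (intro monoD[OF F]) simp
  then show ?thesis
    using emeasure_UN_countable[OF _ C(1) disj, of lebesgue]
    by (auto intro!: nn_integral_cong simp: split_beta)
qed

lemma emeasure_UN_intervals:
  fixes C :: "(real \<times> real) set"
  assumes C: "countable C" "\<And>u v. (u, v) \<in> C \<Longrightarrow> u < v" "disjoint_family_on (\<lambda>(u, v). {u..v}) C"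
  shows "emeasure lebesgue (\<Union>(u, v)\<in>C. {u..v}) = (\<integral>\<^sup>+i. ennreal (snd i - fst i) \<partial>count_space C)"
  using emeasure_UN_countable[OF _ C(1) C(3), of lebesgue] C(2)
  by (auto intro!: nn_integral_cong simp: split_beta less_imp_le)

lemma emeasure_UN_image_intervals_le:
  fixes F :: "real \<Rightarrow> real"
  assumes F: "mono F" and C: "countable C" "\<And>u v. (u, v) \<in> C \<Longrightarrow> u < v"
      "disjoint_family_on (\<lambda>(u, v). {u..v}) C"
    and "0 \<le> r" and slope: "\<And>u v. (u, v) \<in> C \<Longrightarrow> F v - F u \<le> r * (v - u)"
  shows "emeasure lebesgue (\<Union>(u, v)\<in>C. {F u<..<F v}) \<le> ennreal r * emeasure lebesgue (\<Union>(u, v)\<in>C. {u..v})"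
proof -
  have "ennreal (F (snd i) - F (fst i)) \<le> ennreal r * ennreal (snd i - fst i)" if "i \<in> C" for i
    using slope[of "fst i" "snd i"] C(2)[of "fst i" "snd i"] that \<open>0 \<le> r\<close>
    by (simp add: ennreal_mult[symmetric] ennreal_leI)
  then have "(\<integral>\<^sup>+i. ennreal (F (snd i) - F (fst i)) \<partial>count_space C)
      \<le> ennreal r * (\<integral>\<^sup>+i. ennreal (snd i - fst i) \<partial>count_space C)"
    by (subst nn_integral_cmult[symmetric]) (auto intro!: nn_integral_mono)
  moreover have "emeasure lebesgue (\<Union>(u, v)\<in>C. {u..v}) = (\<integral>\<^sup>+i. ennreal (snd i - fst i) \<partial>count_space C)"
    by (rule emeasure_UN_intervals) (use C in auto)
  moreover have "emeasure lebesgue (\<Union>(u, v)\<in>C. {F u<..<F v})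
      = (\<integral>\<^sup>+i. ennreal (F (snd i) - F (fst i)) \<partial>count_space C)"
    by (rule emeasure_UN_image_intervals) (use F C in auto)
  ultimately show ?thesis by simp
qed

lemma emeasure_UN_image_intervals_ge:
  fixes F :: "real \<Rightarrow> real"
  assumes F: "mono F" and C: "countable C" "\<And>u v. (u, v) \<in> C \<Longrightarrow> u < v"
      "disjoint_family_on (\<lambda>(u, v). {u..v}) C"
    and "0 \<le> s" and slope: "\<And>u v. (u, v) \<in> C \<Longrightarrow> s * (v - u) \<le> F v - F u"
  shows "ennreal s * emeasure lebesgue (\<Union>(u, v)\<in>C. {u..v}) \<le> emeasure lebesgue (\<Union>(u, v)\<in>C. {F u<..<F v})"
proof -
  have "ennreal s * ennreal (snd i - fst i) \<le> ennreal (F (snd i) - F (fst i))" if "i \<in> C" for i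
    using slope[of "fst i" "snd i"] C(2)[of "fst i" "snd i"] that \<open>0 \<le> s\<close>
    by (simp add: ennreal_mult[symmetric] ennreal_leI)
  then have "ennreal s * (\<integral>\<^sup>+i. ennreal (snd i - fst i) \<partial>count_space C)
      \<le> (\<integral>\<^sup>+i. ennreal (F (snd i) - F (fst i)) \<partial>count_space C)"
    by (subst nn_integral_cmult[symmetric]) (auto intro!: nn_integral_mono)
  moreover have "emeasure lebesgue (\<Union>(u, v)\<in>C. {u..v}) = (\<integral>\<^sup>+i. ennreal (snd i - fst i) \<partial>count_space C)"
    by (rule emeasure_UN_intervals) (use C in auto)
  moreover have "emeasure lebesgue (\<Union>(u, v)\<in>C. {F u<..<F v})
      = (\<integral>\<^sup>+i. ennreal (F (snd i) - F (fst i)) \<partial>count_space C)"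
    by (rule emeasure_UN_image_intervals) (use F C in auto)
  ultimately show ?thesis by simp
qed

lemma arbitrarily_short_at_mono:
  "arbitrarily_short_at x P \<Longrightarrow> (\<And>u v. u < v \<Longrightarrow> P u v \<Longrightarrow> Q u v) \<Longrightarrow> arbitrarily_short_at x Q"
  unfolding arbitrarily_short_at_def by meson

lemma arbitrarily_short_at_open:
  assumes "arbitrarily_short_at x P" "open U" "x \<in> U"
  shows "arbitrarily_short_at x (\<lambda>u v. {u..v} \<subseteq> U \<and> P u v)"
  unfolding arbitrarily_short_at_def
proof (intro allI impI)
  fix d :: real assume "d > 0"
  obtain e where e: "e > 0" "ball x e \<subseteq> U" using assms(2,3) open_contains_ball by blast
  then obtain u v where uv: "u < v" "u \<le> x" "x \<le> v" "v - u < min d e" "P u v"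
    using assms(1) \<open>d > 0\<close> unfolding arbitrarily_short_at_def by (metis min_less_iff_conj)
  have "{u..v} \<subseteq> ball x e" using uv by (auto simp: dist_real_def)
  with e uv show "\<exists>u v. u < v \<and> u \<le> x \<and> x \<le> v \<and> v - u < d \<and> {u..v} \<subseteq> U \<and> P u v"
    by (metis dual_order.trans min_less_iff_conj)
qed

text \<open>
  Lebesgue's argument. Cover \<open>E\<close>, inside an open set of almost the same outer measure \<open>e\<close>, by disjoint
  intervals of slope at most \<open>r\<close>; the increments of \<open>F\<close> over them add up to at most about
  \<open>r * e\<close>. Cover \<open>E\<close> again, inside these intervals, by disjoint intervals of slope at least \<open>s\<close>; their
  increments add up to at least \<open>s * e\<close>. As the second family is nested in the first,
  \<open>s * e \<le> r * e\<close>.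
\<close>

lemma negligible_oscillating_slopes:
  fixes F :: "real \<Rightarrow> real"
  assumes F: "mono F" and rs: "0 \<le> r" "r < s" and E: "E \<subseteq> {\<alpha><..<\<beta>}"
    and low: "\<And>x. x \<in> E \<Longrightarrow> arbitrarily_short_at x (\<lambda>u v. F v - F u \<le> r * (v - u))"
    and high: "\<And>x. x \<in> E \<Longrightarrow> arbitrarily_short_at x (\<lambda>u v. s * (v - u) \<le> F v - F u)"
  shows "negligible E"
proof -
  \<comment> \<open>As \<open>E\<close> need not be measurable, its outer measure is represented by a measurable hull.\<close>
  obtain M where M: "M \<in> sets lebesgue" "E \<subseteq> M" "outer_measure_of lebesgue E = emeasure lebesgue M"
    using outer_measure_of_attain[of E lebesgue] by auto
  have hull: "emeasure lebesgue M \<le> emeasure lebesgue A" if "A \<in> sets lebesgue" "E \<subseteq> A" for A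
    using that M(3) unfolding outer_measure_of_def by (metis (mono_tags, lifting) INF_lower mem_Collect_eq)
  have "emeasure lebesgue M \<le> emeasure lebesgue {\<alpha><..<\<beta>}"
    using E by (intro hull) auto
  also have "\<dots> < \<infinity>"
    by (cases "\<alpha> \<le> \<beta>") auto
  finally have fin: "emeasure lebesgue M < \<infinity>" .
  have "ennreal s * emeasure lebesgue M \<le> ennreal r * (emeasure lebesgue M + ennreal \<epsilon>)" if "\<epsilon> > 0" for \<epsilon>
  proof -
    obtain U where U: "open U" "M \<subseteq> U" "(U - M) \<in> lmeasurable" "emeasure lebesgue (U - M) < ennreal \<epsilon>"
      using sets_lebesgue_outer_open[OF M(1) \<open>\<epsilon> > 0\<close>] by metis
    obtain C where C: "countable C" "\<And>u v. (u, v) \<in> C \<Longrightarrow> u < v \<and> {u..v} \<subseteq> U \<and> F v - F u \<le> r * (v - u)"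
      "disjoint_family_on (\<lambda>(u, v). {u..v}) C" "negligible (E - (\<Union>(u, v)\<in>C. {u..v}))"
      by (rule vitali_covering_intervals[of E "\<lambda>u v. {u..v} \<subseteq> U \<and> F v - F u \<le> r * (v - u)"])
        (use arbitrarily_short_at_open[OF low \<open>open U\<close>] M(2) U(2) in blast)+
    define W where "W = (\<Union>(u, v)\<in>C. {u<..<v})"
    obtain J where J: "countable J" "\<And>u v. (u, v) \<in> J \<Longrightarrow> u < v \<and> 
          (\<exists>(u', v')\<in>C. u' < u \<and> v < v') \<and> s * (v - u) \<le> F v - F u"
      "disjoint_family_on (\<lambda>(u, v). {u..v}) J" "negligible ((E \<inter> W) - (\<Union>(u, v)\<in>J. {u..v}))"
    proof (rule vitali_covering_intervals[of "E \<inter> W" 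
            "\<lambda>u v. (\<exists>(u', v')\<in>C. u' < u \<and> v < v') \<and> s * (v - u) \<le> F v - F u"])
      fix x assume x: "x \<in> E \<inter> W"
      then obtain u' v' where uv': "(u', v') \<in> C" "x \<in> {u'<..<v'}" by (auto simp: W_def)
      have "arbitrarily_short_at x (\<lambda>u v. {u..v} \<subseteq> {u'<..<v'} \<and> s * (v - u) \<le> F v - F u)"
        using x uv' by (intro arbitrarily_short_at_open high) auto
      then show "arbitrarily_short_at x (\<lambda>u v. (\<exists>(u', v')\<in>C. u' < u \<and> v < v') \<and> s * (v - u) \<le> F v - F u)"
        by (rule arbitrarily_short_at_mono) (use uv'(1) in \<open>force simp: subset_eq\<close>)
    qed blast
    \<comment> \<open>The part of \<open>E\<close> missed by the second cover: not covered by the first one, an endpoint of it, or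
      not covered inside it.\<close>
    define N where "N = (E - (\<Union>(u, v)\<in>C. {u..v})) \<union> (fst ` C \<union> snd ` C) \<union> ((E \<inter> W) - (\<Union>(u, v)\<in>J. {u..v}))"
    have "negligible (fst ` C \<union> snd ` C)"
      using C(1) by (simp add: negligible_iff_null_sets countable_imp_null_set_lborel null_sets_completionI)
    then have "negligible N"
      unfolding N_def using C(4) J(4) by (intro negligible_Un) auto
    then have N: "N \<in> null_sets lebesgue"
      by (simp add: negligible_iff_null_sets)
    have sets: "(\<Union>(u, v)\<in>J. {u..v}) \<in> sets lebesgue" "(\<Union>(u, v)\<in>C. {u..v}) \<in> sets lebesgue"
      using C(1) J(1) by (auto intro!: sets.countable_UN' simp: split_beta)
    have "E \<subseteq> (\<Union>(u, v)\<in>J. {u..v}) \<union> N"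
    proof
      fix x assume x: "x \<in> E"
      show "x \<in> (\<Union>(u, v)\<in>J. {u..v}) \<union> N"
      proof (rule ccontr)
        assume nx: "x \<notin> (\<Union>(u, v)\<in>J. {u..v}) \<union> N"
        then have "x \<in> (\<Union>(u, v)\<in>C. {u..v})" using x unfolding N_def by blast
        then obtain u v where uv: "(u, v) \<in> C" "u \<le> x" "x \<le> v" by auto
        have "x \<noteq> u" "x \<noteq> v" using nx uv(1) unfolding N_def by (auto simp: image_iff Bex_def)
        then have "x \<in> W" using uv unfolding W_def by fastforce
        then show False using nx x unfolding N_def by blast
      qed
    qed
    then have "emeasure lebesgue M \<le> emeasure lebesgue ((\<Union>(u, v)\<in>J. {u..v}) \<union> N)"
      using sets N by (intro hull) auto
    also have "\<dots> = emeasure lebesgue (\<Union>(u, v)\<in>J. {u..v})"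
      by (rule emeasure_Un_null_set[OF sets(1) N])
    finally have "ennreal s * emeasure lebesgue M \<le> ennreal s * emeasure lebesgue (\<Union>(u, v)\<in>J. {u..v})"
      by (rule mult_left_mono) auto
    also have "\<dots> \<le> emeasure lebesgue (\<Union>(u, v)\<in>J. {F u<..<F v})"
      using rs J by (intro emeasure_UN_image_intervals_ge[OF F]) auto
    also have "\<dots> \<le> emeasure lebesgue (\<Union>(u, v)\<in>C. {F u<..<F v})"
    proof (rule emeasure_mono)
      show "(\<Union>(u, v)\<in>J. {F u<..<F v}) \<subseteq> (\<Union>(u, v)\<in>C. {F u<..<F v})"
      proof clarify
        fix u v y assume uv: "(u, v) \<in> J" and y: "y \<in> {F u<..<F v}"
        obtain u' v' where *: "(u', v') \<in> C" "u' < u" "v < v'" using J(2)[OF uv] by blast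
        then have "F u' \<le> F u" "F v \<le> F v'" using monoD[OF F] by auto
        with y * show "y \<in> (\<Union>(u, v)\<in>C. {F u<..<F v})" by fastforce
      qed
      show "(\<Union>(u, v)\<in>C. {F u<..<F v}) \<in> sets lebesgue"
        using C(1) by (auto intro!: sets.countable_UN' simp: split_beta)
    qed
    also have "\<dots> \<le> ennreal r * emeasure lebesgue (\<Union>(u, v)\<in>C. {u..v})"
      using rs C by (intro emeasure_UN_image_intervals_le[OF F]) auto
    also have "emeasure lebesgue (\<Union>(u, v)\<in>C. {u..v}) \<le> emeasure lebesgue U"
      using C(2) U(1) by (intro emeasure_mono) fastforce+
    also have "emeasure lebesgue U = emeasure lebesgue M + emeasure lebesgue (U - M)"
      using U M(1) by (subst plus_emeasure) (auto simp: Un_absorb1 fmeasurableD)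
    also have "\<dots> \<le> emeasure lebesgue M + ennreal \<epsilon>"
      using U(4) by (intro add_left_mono) auto
    finally show ?thesis by (simp add: mult_left_mono)
  qed
  moreover obtain e where e: "emeasure lebesgue M = ennreal e" "e \<ge> 0"
    using fin by (cases "emeasure lebesgue M") auto
  ultimately have *: "s * e \<le> r * (e + \<epsilon>)" if "\<epsilon> > 0" for \<epsilon>
    using that rs by (simp add: ennreal_mult[symmetric] ennreal_plus[symmetric] del: ennreal_plus)
  have "e = 0"
  proof (rule ccontr)
    assume "e \<noteq> 0"
    then have "e > 0" using e by simp
    \<comment> \<open>With this \<open>\<epsilon>\<close> the surplus \<open>r * \<epsilon>\<close> is at most half of \<open>(s - r) * e\<close>.\<close>
    have "s * e \<le> r * (e + (s - r) * e / (2 * (r + 1)))"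
      using \<open>e > 0\<close> rs by (intro *) (auto intro!: divide_pos_pos)
    also have "\<dots> \<le> r * e + (s - r) * e / 2"
      using \<open>e > 0\<close> rs by (auto simp: field_simps)
    finally show False using \<open>e > 0\<close> rs by (simp add: field_simps)
  qed
  then have "M \<in> null_sets lebesgue" using e M(1) by auto
  then show ?thesis using M(2) negligible_iff_null_sets negligible_subset by blast
qed

text \<open>
  Intervals of slope at least \<open>n\<close> inside a bounded interval have total length at most the increment of
  \<open>F\<close> divided by \<open>n\<close>.
\<close>

lemma negligible_unbounded_slopes:
  fixes F :: "real \<Rightarrow> real"
  assumes F: "mono F" and E: "E \<subseteq> {\<alpha><..<\<beta>}"
    and high: "\<And>x (n::nat). x \<in> E \<Longrightarrow> arbitrarily_short_at x (\<lambda>u v. real n * (v - u) \<le> F v - F u)"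
  shows "negligible E"
proof -
  have ex: "\<exists>T. E \<subseteq> T \<and> T \<in> lmeasurable \<and> measure lebesgue T < \<epsilon>" if "\<epsilon> > 0" for \<epsilon>
  proof -
    obtain n :: nat where n': "\<bar>F \<beta> - F \<alpha>\<bar> / \<epsilon> < n"
      using reals_Archimedean2[of "\<bar>F \<beta> - F \<alpha>\<bar> / \<epsilon>"] by blast
    moreover have "0 \<le> \<bar>F \<beta> - F \<alpha>\<bar> / \<epsilon>" using that by simp
    ultimately have "0 < real n" by linarith
    with n' have n: "n > 0" "\<bar>F \<beta> - F \<alpha>\<bar> / \<epsilon> < n" by auto
    obtain J where J: "countable J" "\<And>u v. (u, v) \<in> J \<Longrightarrow> u < v \<and> {u..v} \<subseteq> {\<alpha><..<\<beta>} \<and> real n * (v - u) \<le> F v - F u"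
      "disjoint_family_on (\<lambda>(u, v). {u..v}) J" "negligible (E - (\<Union>(u, v)\<in>J. {u..v}))"
    proof (rule vitali_covering_intervals[of E "\<lambda>u v. {u..v} \<subseteq> {\<alpha><..<\<beta>} \<and> real n * (v - u) \<le> F v - F u"])
      show "arbitrarily_short_at x (\<lambda>u v. {u..v} \<subseteq> {\<alpha><..<\<beta>} \<and> real n * (v - u) \<le> F v - F u)"
        if "x \<in> E" for x
        by (rule arbitrarily_short_at_open) (use that E high in auto)
    qed blast
    let ?U = "\<Union>(u, v)\<in>J. {u..v}"
    have sets: "?U \<in> sets lebesgue"
      using J(1) by (auto intro!: sets.countable_UN' simp: split_beta)
    have "ennreal n * emeasure lebesgue ?U \<le> emeasure lebesgue (\<Union>(u, v)\<in>J. {F u<..<F v})"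
      using J by (intro emeasure_UN_image_intervals_ge[OF F]) auto
    also have "\<dots> \<le> emeasure lebesgue {F \<alpha>..F \<beta>}"
    proof (rule emeasure_mono)
      show "(\<Union>(u, v)\<in>J. {F u<..<F v}) \<subseteq> {F \<alpha>..F \<beta>}"
      proof clarify
        fix u v y assume uv: "(u, v) \<in> J" and y: "y \<in> {F u<..<F v}"
        have "\<alpha> \<le> u" "v \<le> \<beta>" using J(2)[OF uv] by (auto simp: subset_eq less_imp_le)
        then have "F \<alpha> \<le> F u" "F v \<le> F \<beta>" using monoD[OF F] by auto
        with y show "y \<in> {F \<alpha>..F \<beta>}" by auto
      qed
    qed auto
    also have "\<dots> \<le> ennreal \<bar>F \<beta> - F \<alpha>\<bar>" by (cases "F \<alpha> \<le> F \<beta>") auto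
    finally have le: "ennreal n * emeasure lebesgue ?U \<le> ennreal \<bar>F \<beta> - F \<alpha>\<bar>" .
    have "emeasure lebesgue ?U \<le> emeasure lebesgue {\<alpha><..<\<beta>}"
      using J(2) by (intro emeasure_mono) auto
    also have "\<dots> < \<infinity>" by (cases "\<alpha> \<le> \<beta>") auto
    finally have lm: "?U \<in> lmeasurable" using sets by (simp add: fmeasurable_def)
    have "n * measure lebesgue ?U \<le> \<bar>F \<beta> - F \<alpha>\<bar>"
      using le n by (simp add: emeasure_eq_measure2[OF lm] ennreal_mult[symmetric])
    then have m: "measure lebesgue ?U < \<epsilon>"
      using n that by (simp add: field_simps) (smt (verit, best) mult_less_cancel_left_pos of_nat_0_less_iff mult.commute)
    have N: "E - ?U \<in> null_sets lebesgue" using J(4) by (simp add: negligible_iff_null_sets)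
    have "measure lebesgue (?U \<union> (E - ?U)) = measure lebesgue ?U"
      using sets N by (intro measure_Un_null_set) auto
    moreover have "?U \<union> (E - ?U) \<in> lmeasurable"
      using lm N by (intro fmeasurable.Un) (auto simp: fmeasurableI_null_sets)
    ultimately show ?thesis using m by (intro exI[of _ "?U \<union> (E - ?U)"]) auto
  qed
  show ?thesis
    unfolding negligible_outer using ex by blast
qed

lemma not_arbitrarily_short_atE:
  assumes "\<not> arbitrarily_short_at x P"
  obtains d where "d > 0" "\<And>u v. u < v \<Longrightarrow> u \<le> x \<Longrightarrow> x \<le> v \<Longrightarrow> v - u < d \<Longrightarrow> \<not> P u v"
  using assms unfolding arbitrarily_short_at_def by blast

lemma differentiable_if_slopes_converge:
  fixes F :: "real \<Rightarrow> real"
  assumes F: "mono F"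
    and bdd: "\<not> arbitrarily_short_at x (\<lambda>u v. real n * (v - u) \<le> F v - F u)"
    and conv: "\<And>r s. r \<in> \<rat> \<Longrightarrow> s \<in> \<rat> \<Longrightarrow> 0 \<le> r \<Longrightarrow> r < s \<Longrightarrow>
      \<not> (arbitrarily_short_at x (\<lambda>u v. F v - F u \<le> r * (v - u)) \<and>
         arbitrarily_short_at x (\<lambda>u v. s * (v - u) \<le> F v - F u))"
  shows "F differentiable (at x)"
proof -
  \<comment> \<open>The derivative is the largest slope that all short intervals around \<open>x\<close> eventually exceed, up to
    arbitrarily small errors.\<close>
  define S where "S = {r. 0 \<le> r \<and> \<not> arbitrarily_short_at x (\<lambda>u v. F v - F u < r * (v - u))}"
  have "0 \<in> S"
    using monoD[OF F] unfolding S_def arbitrarily_short_at_def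
    by (auto simp: not_less intro!: exI[of _ 1])
  have S_le: "r \<le> real n" if "r \<in> S" for r
  proof (rule ccontr)
    assume r: "\<not> r \<le> real n"
    have "\<not> arbitrarily_short_at x (\<lambda>u v. F v - F u < r * (v - u))"
      using that by (simp add: S_def)
    from not_arbitrarily_short_atE[OF this, unfolded not_less] 
    obtain d where d: "d > 0" "\<And>u v. u < v \<Longrightarrow> u \<le> x \<Longrightarrow> x \<le> v \<Longrightarrow> v - u < d \<Longrightarrow> r * (v - u) \<le> F v - F u"
      by blast
    have "arbitrarily_short_at x (\<lambda>u v. real n * (v - u) \<le> F v - F u)"
      unfolding arbitrarily_short_at_def
    proof (intro allI impI)
      fix e :: real assume "e > 0"
      define w where "w = x + min d e / 2"
      have w: "x < w" "w - x < e" "w - x < d"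
        using d(1) \<open>e > 0\<close> by (auto simp: w_def min_def)
      moreover have "r * (w - x) \<le> F w - F x" using w by (intro d) auto
      moreover have "real n * (w - x) \<le> r * (w - x)"
        using r w by (intro mult_right_mono) auto
      ultimately have "real n * (w - x) \<le> F w - F x" by linarith
      with w show "\<exists>u v. u < v \<and> u \<le> x \<and> x \<le> v \<and> v - u < e \<and> real n * (v - u) \<le> F v - F u"
        by (intro exI[of _ x] exI[of _ w]) auto
    qed
    with bdd show False by simp
  qed
  define D where "D = Sup S"
  have bddS: "bdd_above S" using S_le by (intro bdd_aboveI[where M = "real n"])
  have "0 \<le> D" unfolding D_def using \<open>0 \<in> S\<close> bddS by (rule cSup_upper)
  have low: "\<not> arbitrarily_short_at x (\<lambda>u v. F v - F u < (D - e) * (v - u))" if "e > 0" for e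
  proof
    assume a: "arbitrarily_short_at x (\<lambda>u v. F v - F u < (D - e) * (v - u))"
    obtain r where "r \<in> S" "D - e < r"
      using less_cSup_iff[of S "D - e"] \<open>0 \<in> S\<close> bddS \<open>e > 0\<close> unfolding D_def by auto
    have "arbitrarily_short_at x (\<lambda>u v. F v - F u < r * (v - u))"
    proof (rule arbitrarily_short_at_mono[OF a])
      fix u v :: real assume "u < v" "F v - F u < (D - e) * (v - u)"
      moreover have "(D - e) * (v - u) \<le> r * (v - u)"
        using \<open>u < v\<close> \<open>D - e < r\<close> by (intro mult_right_mono) auto
      ultimately show "F v - F u < r * (v - u)" by linarith
    qed
    with \<open>r \<in> S\<close> show False by (simp add: S_def)
  qed
  have high: "\<not> arbitrarily_short_at x (\<lambda>u v. (D + e) * (v - u) < F v - F u)" if "e > 0" for e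
  proof
    assume a: "arbitrarily_short_at x (\<lambda>u v. (D + e) * (v - u) < F v - F u)"
    obtain r where r: "r \<in> \<rat>" "D < r" "r < D + e" 
      using Rats_dense_in_real[of D "D + e"] \<open>e > 0\<close> by auto
    obtain s where s: "s \<in> \<rat>" "r < s" "s < D + e"
      using Rats_dense_in_real[OF r(3)] by auto
    have "r \<notin> S" using cSup_upper[OF _ bddS, of r] r(2) unfolding D_def by auto
    then have "arbitrarily_short_at x (\<lambda>u v. F v - F u < r * (v - u))"
      using r(2) \<open>0 \<le> D\<close> by (simp add: S_def)
    then have 1: "arbitrarily_short_at x (\<lambda>u v. F v - F u \<le> r * (v - u))"
      by (rule arbitrarily_short_at_mono) simp
    have 2: "arbitrarily_short_at x (\<lambda>u v. s * (v - u) \<le> F v - F u)"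
    proof (rule arbitrarily_short_at_mono[OF a])
      fix u v :: real assume "u < v" "(D + e) * (v - u) < F v - F u"
      moreover have "s * (v - u) \<le> (D + e) * (v - u)"
        using \<open>u < v\<close> s(3) by (intro mult_right_mono) auto
      ultimately show "s * (v - u) \<le> F v - F u" by linarith
    qed
    show False using conv[OF r(1) s(1) _ s(2)] 1 2 r(2) \<open>0 \<le> D\<close> by simp
  qed
  have "((\<lambda>y. (F y - F x) / (y - x)) \<longlongrightarrow> D) (at x)"
    unfolding tendsto_iff
  proof (intro allI impI)
    fix e :: real assume "e > 0"
    then have e2: "e / 2 > 0" by simp
    obtain d1 where d1: "d1 > 0" "\<And>u v. u < v \<Longrightarrow> u \<le> x \<Longrightarrow> x \<le> v \<Longrightarrow> v - u < d1 \<Longrightarrow> (D - e/2) * (v - u) \<le> F v - F u"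
      by (rule not_arbitrarily_short_atE[OF low[OF e2], unfolded not_less]) blast
    obtain d2 where d2: "d2 > 0" "\<And>u v. u < v \<Longrightarrow> u \<le> x \<Longrightarrow> x \<le> v \<Longrightarrow> v - u < d2 \<Longrightarrow> F v - F u \<le> (D + e/2) * (v - u)"
      by (rule not_arbitrarily_short_atE[OF high[OF e2], unfolded not_less]) blast
    have "dist ((F y - F x) / (y - x)) D < e" if y: "y \<noteq> x" "dist y x < min d1 d2" for y
    proof -
      have "(D - e/2) \<le> (F y - F x) / (y - x) \<and> (F y - F x) / (y - x) \<le> D + e/2"
      proof (cases "x < y")
        case True
        with d1(2)[of x y] d2(2)[of x y] y(2) show ?thesis
          by (auto simp: field_simps dist_real_def)
      next
        case False
        then have "y < x" using y by simp
        moreover have "(F y - F x) / (y - x) = (F x - F y) / (x - y)"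
          by (metis minus_diff_eq minus_divide_divide)
        ultimately show ?thesis using d1(2)[of y x] d2(2)[of y x] y(2)
          by (auto simp: pos_le_divide_eq pos_divide_le_eq dist_real_def)
      qed
      then show ?thesis using \<open>e > 0\<close> by (auto simp: dist_real_def abs_le_iff)
    qed
    then show "\<forall>\<^sub>F y in at x. dist ((F y - F x) / (y - x)) D < e"
      using d1(1) d2(1) unfolding eventually_at by (intro exI[of _ "min d1 d2"]) auto
  qed
  then have "(F has_field_derivative D) (at x)"
    by (simp add: has_field_derivative_iff)
  then show ?thesis
    using real_differentiable_def by blast
qed

lemma mono_differentiable_ae:
  fixes F :: "real \<Rightarrow> real"
  assumes F: "mono F"
  shows "negligible {x. \<not> F differentiable (at x)}"
proof -
  define E0 where "E0 = {x. \<forall>n::nat. arbitrarily_short_at x (\<lambda>u v. real n * (v - u) \<le> F v - F u)}"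
  define E where "E = (\<lambda>(r, s). {x. arbitrarily_short_at x (\<lambda>u v. F v - F u \<le> r * (v - u)) \<and>
         arbitrarily_short_at x (\<lambda>u v. s * (v - u) \<le> F v - F u)})"
  define R where "R = {(r, s). r \<in> \<rat> \<and> s \<in> \<rat> \<and> 0 \<le> r \<and> r < (s::real)}"
  have loc: "negligible A" if "\<And>n::nat. negligible (A \<inter> {- real n<..<real n})" for A
  proof -
    have "negligible (\<Union>n::nat. A \<inter> {- real n<..<real n})"
      using that by (intro negligible_Union_nat) auto
    also have "(\<Union>n::nat. A \<inter> {- real n<..<real n}) = A"
    proof (intro equalityI subsetI)
      fix x assume "x \<in> A"
      obtain n :: nat where "\<bar>x\<bar> < n" using reals_Archimedean2[of "\<bar>x\<bar>"] by blast
      then show "x \<in> (\<Union>n::nat. A \<inter> {- real n<..<real n})"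
        using \<open>x \<in> A\<close> by (auto intro!: exI[of _ n])
    qed auto
    finally show ?thesis .
  qed
  have "negligible E0"
    by (rule loc, rule negligible_unbounded_slopes[OF F]) (auto simp: E0_def)
  moreover have "negligible (\<Union>(E ` R))"
  proof (rule negligible_countable_Union)
    have "R \<subseteq> \<rat> \<times> \<rat>" by (auto simp: R_def)
    then show "countable (E ` R)"
      by (metis countable_SIGMA countable_image countable_rat countable_subset)
    fix A assume "A \<in> E ` R"
    then obtain r s where *: "A = E (r, s)" "0 \<le> r" "r < s" by (auto simp: R_def)
    show "negligible A"
      by (rule loc, rule negligible_oscillating_slopes[OF F *(2,3)]) (auto simp: * E_def)
  qed
  ultimately have "negligible (E0 \<union> \<Union>(E ` R))" by (rule negligible_Un)
  moreover have "{x. \<not> F differentiable (at x)} \<subseteq> E0 \<union> \<Union>(E ` R)"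
  proof
    fix x assume "x \<in> {x. \<not> F differentiable (at x)}"
    show "x \<in> E0 \<union> \<Union>(E ` R)"
    proof (rule ccontr)
      assume nx: "x \<notin> E0 \<union> \<Union>(E ` R)"
      then obtain n where "\<not> arbitrarily_short_at x (\<lambda>u v. real n * (v - u) \<le> F v - F u)"
        by (auto simp: E0_def)
      then have "F differentiable (at x)"
        using nx by (intro differentiable_if_slopes_converge[OF F]) (auto simp: E_def R_def)
      with \<open>x \<in> {x. \<not> F differentiable (at x)}\<close> show False by simp
    qed
  qed
  ultimately show ?thesis by (rule negligible_subset)
qed



section \<open>Absolutely continuous curves\<close>

text \<open>
  The families of the definition of absolute continuity, kept as a predicate so that they can be
  restricted, moved and counted independently of the curve.
\<close>

definition interval_family :: "real \<Rightarrow> real \<Rightarrow> nat \<Rightarrow> (nat \<Rightarrow> real) \<Rightarrow> (nat \<Rightarrow> real) \<Rightarrow> bool" where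
  "interval_family a b n u v \<longleftrightarrow> (\<forall>k<n. a \<le> u k \<and> u k \<le> v k \<and> v k \<le> b) \<and>
     disjoint_family_on (\<lambda>k. {u k<..<v k}) {..<n}"

definition family_variation :: "(real \<Rightarrow> 'v::real_normed_vector) \<Rightarrow> nat \<Rightarrow> (nat \<Rightarrow> real) \<Rightarrow> (nat \<Rightarrow> real) \<Rightarrow> real" where
  "family_variation \<gamma> n u v = (\<Sum>k<n. norm (\<gamma> (v k) - \<gamma> (u k)))"

lemma abs_continuous_iff:
  "abs_continuous a b \<gamma> \<longleftrightarrow>
    (\<forall>\<epsilon>>0. \<exists>\<delta>>0. \<forall>n u v. interval_family a b n u v \<longrightarrow> (\<Sum>k<n. v k - u k) < \<delta>
      \<longrightarrow> family_variation \<gamma> n u v < \<epsilon>)"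
  unfolding absolutely_continuous_on_interval_def interval_family_def family_variation_def
  by (simp only: conj_assoc imp_conjL)

lemma interval_family_subintervals:
  assumes "interval_family a b n u v"
    and "\<And>k. k < n \<Longrightarrow> a' \<le> u' k \<and> u' k \<le> v' k \<and> v' k \<le> b'"
    and "\<And>k. {u' k<..<v' k} \<subseteq> {u k<..<v k}"
  shows "interval_family a' b' n u' v'"
proof -
  have "{u' k<..<v' k} \<inter> {u' l<..<v' l} = {}" if "k < n" "l < n" "k \<noteq> l" for k l
  proof -
    have "{u k<..<v k} \<inter> {u l<..<v l} = {}"
      using assms(1) that by (auto simp: interval_family_def disjoint_family_on_def)
    then show ?thesis using assms(3)[of k] assms(3)[of l] by blast
  qed
  then show ?thesis
    using assms(2) by (simp add: interval_family_def disjoint_family_on_def)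
qed

lemma interval_family_bounds:
  assumes "interval_family a b n u v" "k < n"
  shows "a \<le> u k" "u k \<le> v k" "v k \<le> b"
  using assms by (auto simp: interval_family_def)

lemma interval_family_min:
  assumes f: "interval_family a b n u v" and "a \<le> c"
  shows "interval_family a (min b c) n (\<lambda>k. min (u k) c) (\<lambda>k. min (v k) c)"
proof (rule interval_family_subintervals[OF f])
  fix k
  show "{min (u k) c<..<min (v k) c} \<subseteq> {u k<..<v k}"
    by (auto simp: min_less_iff_disj)
  assume "k < n"
  with interval_family_bounds[OF f this] \<open>a \<le> c\<close>
  show "a \<le> min (u k) c \<and> min (u k) c \<le> min (v k) c \<and> min (v k) c \<le> min b c"
    by (auto simp: min_def)
qed

lemma interval_family_max:
  assumes f: "interval_family a b n u v" and "c \<le> b"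
  shows "interval_family (max a c) b n (\<lambda>k. max (u k) c) (\<lambda>k. max (v k) c)"
proof (rule interval_family_subintervals[OF f])
  fix k
  show "{max (u k) c<..<max (v k) c} \<subseteq> {u k<..<v k}"
    by (auto simp: less_max_iff_disj)
  assume "k < n"
  with interval_family_bounds[OF f this] \<open>c \<le> b\<close>
  show "max a c \<le> max (u k) c \<and> max (u k) c \<le> max (v k) c \<and> max (v k) c \<le> b"
    by (auto simp: max_def)
qed

lemma interval_family_singleton:
  assumes "a \<le> s" "s \<le> t" "t \<le> b"
  shows "interval_family a b (Suc 0) (\<lambda>_. s) (\<lambda>_. t)"
  using assms by (auto simp: interval_family_def disjoint_family_on_def)

lemma interval_family_mono:
  assumes f: "interval_family a b n u v" and "a' \<le> a" "b \<le> b'"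
  shows "interval_family a' b' n u v"
proof (rule interval_family_subintervals[OF f])
  fix k assume "k < n"
  with interval_family_bounds[OF f this] assms(2,3)
  show "a' \<le> u k \<and> u k \<le> v k \<and> v k \<le> b'" by auto
qed simp

lemma interval_family_length:
  assumes "interval_family a b n u v" "a \<le> b"
  shows "(\<Sum>k<n. v k - u k) \<le> b - a"
proof -
  have uv: "u k \<le> v k" "{u k<..<v k} \<subseteq> {a..b}" if "k < n" for k
    using interval_family_bounds[OF assms(1) that] by auto
  have "(\<Sum>k<n. v k - u k) = (\<Sum>k<n. measure lborel {u k<..<v k})"
    using uv by (intro sum.cong) auto
  also have "\<dots> = measure lborel (\<Union>k<n. {u k<..<v k})"
    using assms(1) uv by (intro measure_finite_Union[symmetric]) (auto simp: interval_family_def)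
  also have "\<dots> \<le> measure lborel {a..b}"
    using uv assms(2) by (intro measure_mono_fmeasurable) (auto simp: fmeasurable_def)
  finally show ?thesis using assms(2) by simp
qed

text \<open>
  Cutting every interval of a family at \<open>c\<close> loses no variation; \<open>min\<close> and \<open>max\<close> cut all intervals
  uniformly, with degenerate intervals where \<open>c\<close> lies outside.
\<close>

lemma family_variation_split:
  "family_variation \<gamma> n u v \<le> family_variation \<gamma> n (\<lambda>k. min (u k) c) (\<lambda>k. min (v k) c)
    + family_variation \<gamma> n (\<lambda>k. max (u k) c) (\<lambda>k. max (v k) c)"
  unfolding family_variation_def sum.distrib[symmetric]
proof (rule sum_mono)
  fix k
  consider "u k \<le> c" "v k \<le> c" | "c \<le> u k" "c \<le> v k" | "u k \<le> c" "c \<le> v k" | "c \<le> u k" "v k \<le> c"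
    by linarith
  then show "norm (\<gamma> (v k) - \<gamma> (u k)) \<le> norm (\<gamma> (min (v k) c) - \<gamma> (min (u k) c))
      + norm (\<gamma> (max (v k) c) - \<gamma> (max (u k) c))"
  proof cases
    case 3
    have "norm ((\<gamma> c - \<gamma> (u k)) + (\<gamma> (v k) - \<gamma> c)) \<le> norm (\<gamma> c - \<gamma> (u k)) + norm (\<gamma> (v k) - \<gamma> c)"
      by (rule norm_triangle_ineq)
    with 3 show ?thesis by (simp add: min_absorb1 min_absorb2 max_absorb1 max_absorb2)
  next
    case 4
    have "norm ((\<gamma> c - \<gamma> (u k)) + (\<gamma> (v k) - \<gamma> c)) \<le> norm (\<gamma> c - \<gamma> (u k)) + norm (\<gamma> (v k) - \<gamma> c)"
      by (rule norm_triangle_ineq)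
    with 4 show ?thesis by (simp add: min_absorb1 min_absorb2 max_absorb1 max_absorb2)
  qed (simp_all add: min_absorb1 min_absorb2 max_absorb1 max_absorb2)
qed

text \<open>
  On an interval shorter than the \<open>\<delta>\<close> that belongs to \<open>\<epsilon> = 1\<close> the variation is at most \<open>1\<close>, and
  finitely many such intervals cover \<open>[a, b]\<close>. The induction uses half that length per step, so that the
  inequality stays strict.
\<close>

lemma absolutely_continuous_imp_bounded_variation:
  fixes \<gamma> :: "real \<Rightarrow> 'v::real_normed_vector"
  assumes "abs_continuous a b \<gamma>" "a \<le> b"
  obtains B where "\<And>n u v. interval_family a b n u v \<Longrightarrow> family_variation \<gamma> n u v \<le> B"
proof -
  obtain d where d: "d > 0" "\<And>n u v. interval_family a b n u v \<Longrightarrow> (\<Sum>k<n. v k - u k) < d \<Longrightarrow>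
      family_variation \<gamma> n u v < 1"
    using assms(1) unfolding abs_continuous_iff by (metis zero_less_one)
  have step: "family_variation \<gamma> n u v \<le> real j"
    if "interval_family a (min b (a + j * (d / 2))) n u v" for n u v and j :: nat
    using that
  proof (induction j arbitrary: n u v)
    case 0
    then have "u k = v k" if "k < n" for k
      using interval_family_bounds[OF _ that] \<open>a \<le> b\<close> by fastforce
    then show ?case by (simp add: family_variation_def)
  next
    case (Suc j)
    define c where "c = min b (a + j * (d / 2))"
    have c: "a \<le> c" "c \<le> b" "c \<le> min b (a + Suc j * (d / 2))" "min b (a + Suc j * (d / 2)) - c \<le> d / 2"
      using \<open>d > 0\<close> \<open>a \<le> b\<close> by (auto simp: c_def min_def field_simps)
    have "interval_family a c n (\<lambda>k. min (u k) c) (\<lambda>k. min (v k) c)"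
      using interval_family_min[OF Suc.prems c(1)] c by (simp add: min_absorb2)
    then have 1: "family_variation \<gamma> n (\<lambda>k. min (u k) c) (\<lambda>k. min (v k) c) \<le> j"
      by (intro Suc.IH) (simp add: c_def)
    have max: "interval_family c (min b (a + Suc j * (d / 2))) n (\<lambda>k. max (u k) c) (\<lambda>k. max (v k) c)"
      using interval_family_max[OF Suc.prems c(3)] c by (simp add: max_absorb2)
    have "(\<Sum>k<n. max (v k) c - max (u k) c) \<le> d / 2"
      using interval_family_length[OF max c(3)] c by simp
    then have "family_variation \<gamma> n (\<lambda>k. max (u k) c) (\<lambda>k. max (v k) c) < 1"
      using interval_family_mono[OF max, of a b] c \<open>d > 0\<close> by (intro d(2)) auto
    with 1 family_variation_split[of \<gamma> n u v c] show ?case by simp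
  qed
  obtain j :: nat where "(b - a) / (d / 2) < j" using reals_Archimedean2 by blast
  then have "b \<le> a + j * (d / 2)" using \<open>d > 0\<close> by (simp add: field_simps)
  then have "family_variation \<gamma> n u v \<le> j" if "interval_family a b n u v" for n u v
    using step[of j n u v] that by (simp add: min_absorb1)
  then show thesis using that by blast
qed

definition variation_to :: "(real \<Rightarrow> 'v::real_normed_vector) \<Rightarrow> real \<Rightarrow> real \<Rightarrow> real" where
  "variation_to \<gamma> a t = Sup {family_variation \<gamma> n u v | n u v. interval_family a t n u v}"

lemma variation_to_increment:
  fixes \<gamma> :: "real \<Rightarrow> 'v::real_normed_vector"
  assumes bdd: "\<And>n u v. interval_family a b n u v \<Longrightarrow> family_variation \<gamma> n u v \<le> B"
    and "a \<le> s" "s \<le> t" "t \<le> b"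
  shows "norm (\<gamma> t - \<gamma> s) \<le> variation_to \<gamma> a t - variation_to \<gamma> a s"
proof -
  let ?S = "\<lambda>t. {family_variation \<gamma> n u v | n u v. interval_family a t n u v}"
  have "variation_to \<gamma> a s \<le> variation_to \<gamma> a t - norm (\<gamma> t - \<gamma> s)"
    unfolding variation_to_def[of \<gamma> a s]
  proof (rule cSup_least)
    show "?S s \<noteq> {}"
      using interval_family_singleton[of a a a s] \<open>a \<le> s\<close> by auto
    fix x assume "x \<in> ?S s"
    then obtain n u v where x: "x = family_variation \<gamma> n u v" and f: "interval_family a s n u v" by auto
    have "interval_family a t (Suc n) (u(n := s)) (v(n := t))"
      unfolding interval_family_def disjoint_family_on_def
    proof (intro conjI ballI impI allI)
      have *: "a \<le> u k" "u k \<le> v k" "v k \<le> s" if "k < n" for k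
        using f that by (auto simp: interval_family_def)
      have disj: "{u k<..<v k} \<inter> {u l<..<v l} = {}" if "k < n" "l < n" "k \<noteq> l" for k l
        using f that by (auto simp: interval_family_def disjoint_family_on_def)
      fix k
      { assume "k < Suc n"
        then have "k < n \<or> k = n" by auto
        then show "a \<le> (u(n := s)) k" "(u(n := s)) k \<le> (v(n := t)) k" "(v(n := t)) k \<le> t"
          using *[of k] \<open>a \<le> s\<close> \<open>s \<le> t\<close> by auto }
      fix l assume kl: "k \<in> {..<Suc n}" "l \<in> {..<Suc n}" "k \<noteq> l"
      consider "k < n" "l < n" | "k < n" "l = n" | "k = n" "l < n"
        using kl by (auto simp: less_Suc_eq)
      then show "{(u(n := s)) k<..<(v(n := t)) k} \<inter> {(u(n := s)) l<..<(v(n := t)) l} = {}"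
        by cases (use disj[of k l] *(3)[of k] *(3)[of l] kl in auto)
    qed
    then have "family_variation \<gamma> (Suc n) (u(n := s)) (v(n := t)) \<in> ?S t" by blast
    moreover have "bdd_above (?S t)"
    proof (rule bdd_aboveI[of _ B])
      fix y assume "y \<in> ?S t"
      then obtain n u v where "y = family_variation \<gamma> n u v" "interval_family a t n u v" by blast
      moreover from this(2) have "interval_family a b n u v"
        by (rule interval_family_mono[OF _ order_refl \<open>t \<le> b\<close>])
      ultimately show "y \<le> B" using bdd[of n u v] by simp
    qed
    ultimately have "family_variation \<gamma> (Suc n) (u(n := s)) (v(n := t)) \<le> variation_to \<gamma> a t"
      unfolding variation_to_def by (rule cSup_upper)
    moreover have "family_variation \<gamma> (Suc n) (u(n := s)) (v(n := t)) = x + norm (\<gamma> t - \<gamma> s)"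
      by (simp add: family_variation_def x)
    ultimately show "x \<le> variation_to \<gamma> a t - norm (\<gamma> t - \<gamma> s)" by simp
  qed
  then show ?thesis by simp
qed

text \<open>
  Jordan's decomposition: the variation function and its sums with the coordinates of the curve are
  monotone, and each coordinate is a difference of two of these functions.
\<close>

lemma absolutely_continuous_differentiable_ae:
  fixes \<gamma> :: "real \<Rightarrow> 'v::euclidean_space"
  assumes ac: "abs_continuous a b \<gamma>"
  obtains N where "negligible N" "\<And>t. a < t \<Longrightarrow> t < b \<Longrightarrow> t \<notin> N \<Longrightarrow> \<gamma> differentiable (at t)"
proof (cases "a < b")
  case False
  then show thesis by (intro that[of "{}"]) auto
next
  case True
  \<comment> \<open>Clamping the time extends the monotone functions to the whole line.\<close>
  define q where "q t = max a (min b t)" for t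
  have q: "a \<le> q t" "q t \<le> b" for t using True by (auto simp: q_def)
  have q_mono: "q s \<le> q t" if "s \<le> t" for s t using that by (auto simp: q_def)
  obtain B where B: "\<And>n u v. interval_family a b n u v \<Longrightarrow> family_variation \<gamma> n u v \<le> B"
    using absolutely_continuous_imp_bounded_variation[OF ac] True by auto
  have inc: "norm (\<gamma> (q t) - \<gamma> (q s)) \<le> variation_to \<gamma> a (q t) - variation_to \<gamma> a (q s)" if "s \<le> t" for s t
    using variation_to_increment[of a b \<gamma> B "q s" "q t"] B q q_mono[OF that] by blast
  define V where "V t = variation_to \<gamma> a (q t)" for t
  define W where "W e t = V t + \<gamma> (q t) \<bullet> e" for e t
  have "mono V" 
  proof (rule monoI)
    fix s t :: real assume "s \<le> t"
    with inc[of s t] norm_ge_zero[of "\<gamma> (q t) - \<gamma> (q s)"] show "V s \<le> V t" unfolding V_def by linarith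
  qed
  have "mono (W e)" if "e \<in> Basis" for e
  proof (rule monoI)
    fix s t :: real assume "s \<le> t"
    have "\<bar>(\<gamma> (q t) - \<gamma> (q s)) \<bullet> e\<bar> \<le> norm (\<gamma> (q t) - \<gamma> (q s))"
      using Basis_le_norm[OF that] .
    with inc[OF \<open>s \<le> t\<close>] show "W e s \<le> W e t" unfolding W_def V_def inner_diff_left by linarith
  qed
  define N where "N = {t. \<not> V differentiable (at t)} \<union> (\<Union>e\<in>Basis. {t. \<not> W e differentiable (at t)})"
  have "negligible N"
    unfolding N_def using \<open>mono V\<close> \<open>\<And>e. e \<in> Basis \<Longrightarrow> mono (W e)\<close>
    by (intro negligible_Un negligible_Union) (auto intro: mono_differentiable_ae)
  moreover have "\<gamma> differentiable (at t)" if "a < t" "t < b" "t \<notin> N" for t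
  proof -
    have comp: "(\<lambda>t. \<gamma> t \<bullet> e) differentiable (at t)" if "e \<in> Basis" for e
    proof -
      have "(\<lambda>t. W e t - V t) differentiable (at t)"
        using \<open>t \<notin> N\<close> \<open>e \<in> Basis\<close> by (intro differentiable_diff) (auto simp: N_def)
      then obtain D where "((\<lambda>t. \<gamma> (q t) \<bullet> e) has_derivative D) (at t)"
        unfolding differentiable_def W_def by auto
      then have "((\<lambda>t. \<gamma> t \<bullet> e) has_derivative D) (at t)"
        by (rule has_derivative_transform_within_open[of _ _ _ _ "{a<..<b}"])
          (use \<open>a < t\<close> \<open>t < b\<close> in \<open>auto simp: q_def\<close>)
      then show ?thesis by (auto simp: differentiable_def)
    qed
    show ?thesis
      using comp differentiable_componentwise_within[of \<gamma> t UNIV] by auto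
  qed
  ultimately show thesis by (rule that)
qed


lemma absolutely_continuous_imp_continuous_on:
  fixes \<gamma> :: "real \<Rightarrow> 'v::real_normed_vector"
  assumes ac: "abs_continuous a b \<gamma>"
  shows "continuous_on {a..b} \<gamma>"
  unfolding continuous_on_iff
proof (intro ballI allI impI)
  fix s e :: real assume s: "s \<in> {a..b}" and "e > 0"
  then obtain d where d: "d > 0" "\<And>n u v. interval_family a b n u v \<Longrightarrow> (\<Sum>k<n. v k - u k) < d \<Longrightarrow>
      family_variation \<gamma> n u v < e"
    using ac unfolding abs_continuous_iff by meson
  have near: "norm (\<gamma> v - \<gamma> u) < e" if "a \<le> u" "u \<le> v" "v \<le> b" "v - u < d" for u v
    using d(2)[OF interval_family_singleton[OF that(1-3)]] that by (simp add: family_variation_def)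
  have "dist (\<gamma> t) (\<gamma> s) < e" if t: "t \<in> {a..b}" "dist t s < d" for t
    using near[of s t] near[of t s] s t by (cases "s \<le> t") (auto simp: dist_norm norm_minus_commute)
  then show "\<exists>d>0. \<forall>t\<in>{a..b}. dist t s < d \<longrightarrow> dist (\<gamma> t) (\<gamma> s) < e"
    using d(1) by blast
qed

text \<open>
  The straddle lemma: the increment over an interval around the point of differentiability is controlled,
  although neither endpoint is that point.
\<close>

lemma vector_derivative_straddle:
  fixes \<gamma> :: "real \<Rightarrow> 'v::real_normed_vector"
  assumes "(\<gamma> has_vector_derivative D) (at t)" "e > 0"
  obtains d where "d > 0" "\<And>u v. u \<le> t \<Longrightarrow> t \<le> v \<Longrightarrow> {u..v} \<subseteq> ball t d \<Longrightarrow>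
    norm (\<gamma> v - \<gamma> u - (v - u) *\<^sub>R D) \<le> e * (v - u)"
proof -
  obtain d where d: "d > 0" "\<And>y. norm (y - t) < d \<Longrightarrow>
      norm (\<gamma> y - \<gamma> t - (y - t) *\<^sub>R D) \<le> e * norm (y - t)"
    using assms unfolding has_vector_derivative_def has_derivative_within_alt by auto
  have "norm (\<gamma> v - \<gamma> u - (v - u) *\<^sub>R D) \<le> e * (v - u)"
    if "u \<le> t" "t \<le> v" "{u..v} \<subseteq> ball t d" for u v
  proof -
    have "u \<in> ball t d" "v \<in> ball t d" using that by (auto simp: subset_eq simp del: mem_ball)
    then have 1: "norm (\<gamma> v - \<gamma> t - (v - t) *\<^sub>R D) \<le> e * (v - t)"
      and 2: "norm (\<gamma> u - \<gamma> t - (u - t) *\<^sub>R D) \<le> e * (t - u)"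
      using d(2)[of v] d(2)[of u] that by (auto simp: dist_real_def)
    have "\<gamma> v - \<gamma> u - (v - u) *\<^sub>R D = (\<gamma> v - \<gamma> t - (v - t) *\<^sub>R D) - (\<gamma> u - \<gamma> t - (u - t) *\<^sub>R D)"
      by (simp add: algebra_simps)
    also have "norm \<dots> \<le> e * (v - t) + e * (t - u)"
      using 1 2 norm_triangle_ineq4 by (meson add_mono order_trans)
    also have "\<dots> = e * (v - u)" by (simp add: algebra_simps)
    finally show ?thesis .
  qed
  with d(1) show thesis by (rule that)
qed

text \<open>
  The definition of absolute continuity in the language of tagged divisions: the total increment over the
  pieces that lie in an open set of small measure is small.
\<close>

lemma absolutely_continuous_sum_le:
  fixes \<gamma> :: "real \<Rightarrow> 'v::real_normed_vector"
  assumes small: "\<And>n u v. interval_family a b n u v \<Longrightarrow> (\<Sum>k<n. v k - u k) < d \<Longrightarrow>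
      family_variation \<gamma> n u v < e"
    and p: "finite p" "\<And>x K. (x, K) \<in> p \<Longrightarrow> \<exists>u v. u \<le> v \<and> K = {u..v} \<and> K \<subseteq> {a..b}"
    and disj: "\<And>x K x' K'. (x, K) \<in> p \<Longrightarrow> (x', K') \<in> p \<Longrightarrow> (x, K) \<noteq> (x', K') \<Longrightarrow> interior K \<inter> interior K' = {}"
    and G: "G \<in> lmeasurable" "measure lebesgue G < d" "\<And>x K. (x, K) \<in> p \<Longrightarrow> K \<subseteq> G"
  shows "(\<Sum>(x, K)\<in>p. norm (\<gamma> (Sup K) - \<gamma> (Inf K))) < e"
proof -
  obtain f where f: "bij_betw f {..<card p} p"
    using ex_bij_betw_nat_finite[OF p(1)] by (metis atLeast0LessThan)
  define n where "n = card p"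
  define u where "u k = Inf (snd (f k))" for k
  define v where "v k = Sup (snd (f k))" for k
  have fin: "f k \<in> p" if "k < n" for k using f that by (auto simp: bij_betw_def n_def)
  have K: "u k \<le> v k \<and> snd (f k) = {u k..v k} \<and> {u k..v k} \<subseteq> {a..b} \<and> {u k..v k} \<subseteq> G" if k: "k < n" for k
  proof -
    obtain x' y' where "x' \<le> y'" "snd (f k) = {x'..y'}" "snd (f k) \<subseteq> {a..b}"
      using p(2)[of "fst (f k)" "snd (f k)"] fin[OF k] by auto
    moreover have "snd (f k) \<subseteq> G" using G(3)[of "fst (f k)" "snd (f k)"] fin[OF k] by auto
    ultimately show ?thesis by (auto simp: u_def v_def)
  qed
  have disj': "disjoint_family_on (\<lambda>k. {u k<..<v k}) {..<n}"
    unfolding disjoint_family_on_def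
  proof (intro ballI impI)
    fix k l assume kl: "k \<in> {..<n}" "l \<in> {..<n}" "k \<noteq> l"
    then have "f k \<noteq> f l" using f by (auto simp: bij_betw_def n_def inj_on_def)
    then have "interior (snd (f k)) \<inter> interior (snd (f l)) = {}"
      using disj[of "fst (f k)" "snd (f k)" "fst (f l)" "snd (f l)"] fin kl by (simp add: prod_eq_iff)
    then show "{u k<..<v k} \<inter> {u l<..<v l} = {}"
      using K[of k] K[of l] kl by simp
  qed
  have fam: "interval_family a b n u v"
    using K disj' unfolding interval_family_def by auto
  have "(\<Sum>k<n. v k - u k) = (\<Sum>k<n. measure lebesgue {u k<..<v k})"
    using K by (intro sum.cong) auto
  also have "\<dots> = measure lebesgue (\<Union>k<n. {u k<..<v k})"
    using disj' K by (intro measure_finite_Union[symmetric]) auto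
  also have "\<dots> \<le> measure lebesgue G"
    using K G(1) by (intro measure_mono_fmeasurable) (auto, fastforce)
  finally have "family_variation \<gamma> n u v < e" using G(2) by (intro small[OF fam]) simp
  also have "family_variation \<gamma> n u v = (\<Sum>(x, K)\<in>p. norm (\<gamma> (Sup K) - \<gamma> (Inf K)))"
    unfolding family_variation_def u_def v_def n_def split_beta
    by (rule sum.reindex_bij_betw[OF f])
  finally show ?thesis .
qed

text \<open>
  In a fine enough tagged division, pieces with tag off \<open>N\<close> are handled by the derivative, through the
  straddle lemma. Pieces with tag in \<open>N\<close>, where \<open>g\<close> contributes nothing, are confined to an open set of
  tiny measure, where the curve has tiny variation.
\<close>

theorem absolutely_continuous_fundamental_theorem:
  fixes \<gamma> :: "real \<Rightarrow> 'v::euclidean_space"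
  assumes ac: "abs_continuous a b \<gamma>" and "a \<le> b" and N: "negligible N"
    and der: "\<And>t. t \<in> {a..b} - N \<Longrightarrow> (\<gamma> has_vector_derivative g t) (at t)"
    and g0: "\<And>t. t \<in> N \<Longrightarrow> g t = 0"
  shows "(g has_integral (\<gamma> b - \<gamma> a)) {a..b}"
proof -
  have "\<exists>\<Gamma>. gauge \<Gamma> \<and> (\<forall>p. p tagged_division_of {a..b} \<and> \<Gamma> fine p \<longrightarrow>
          norm ((\<Sum>(x, K)\<in>p. measure lborel K *\<^sub>R g x) - (\<gamma> b - \<gamma> a)) < e)" if "e > 0" for e
  proof -
    define e1 where "e1 = e / (2 * (b - a + 1))"
    have e1: "e1 > 0" "e1 * (b - a) < e / 2"
      using \<open>e > 0\<close> \<open>a \<le> b\<close> by (auto simp: e1_def field_simps)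
    obtain d where d: "d > 0" "\<And>n u v. interval_family a b n u v \<Longrightarrow> (\<Sum>k<n. v k - u k) < d \<Longrightarrow>
        family_variation \<gamma> n u v < e / 2"
      using ac \<open>e > 0\<close> unfolding abs_continuous_iff by (meson half_gt_zero)
    have N0: "N \<in> null_sets lebesgue"
      using N by (simp add: negligible_iff_null_sets)
    then obtain G where G: "open G" "N \<subseteq> G" "(G - N) \<in> lmeasurable" "emeasure lebesgue (G - N) < ennreal d"
      using sets_lebesgue_outer_open[of N d] d(1) by (metis null_setsD2)
    have "G = (G - N) \<union> N" using G(2) by blast
    then have "emeasure lebesgue G = emeasure lebesgue (G - N)"
      using emeasure_Un_null_set[OF fmeasurableD[OF G(3)] N0] by simp
    with G(4) have "emeasure lebesgue G < ennreal d" by simp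
    moreover from this have G_lm: "G \<in> lmeasurable"
      using G(1) by (intro fmeasurableI) (auto intro: less_trans)
    ultimately have G_d: "measure lebesgue G < d"
      by (simp add: emeasure_eq_measure2 ennreal_less_iff)
    have "\<exists>r>0. ball x r \<subseteq> G" if "x \<in> N" for x
      using G that open_contains_ball by blast
    then obtain rG where rG: "\<And>x. x \<in> N \<Longrightarrow> rG x > 0 \<and> ball x (rG x) \<subseteq> G" by metis
    have "\<exists>r>0. \<forall>u v. u \<le> x \<longrightarrow> x \<le> v \<longrightarrow> {u..v} \<subseteq> ball x r \<longrightarrow>
      norm (\<gamma> v - \<gamma> u - (v - u) *\<^sub>R g x) \<le> e1 * (v - u)" if "x \<in> {a..b} - N" for x
      by (rule vector_derivative_straddle[OF der[OF that] e1(1)]) blast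
    then obtain rD where rD: "\<And>x. x \<in> {a..b} - N \<Longrightarrow> rD x > 0 \<and> (\<forall>u v. u \<le> x \<longrightarrow> x \<le> v \<longrightarrow> {u..v} \<subseteq> ball x (rD x) \<longrightarrow>
      norm (\<gamma> v - \<gamma> u - (v - u) *\<^sub>R g x) \<le> e1 * (v - u))" by metis
    define r where "r x = (if x \<in> N then rG x else if x \<in> {a..b} then rD x else 1)" for x
    have "gauge (\<lambda>x. ball x (r x))"
      by (rule gauge_ball_dependent) (use rG rD in \<open>auto simp: r_def\<close>)
    moreover have "norm ((\<Sum>(x, K)\<in>p. measure lborel K *\<^sub>R g x) - (\<gamma> b - \<gamma> a)) < e"
      if p: "p tagged_division_of {a..b}" and fine: "(\<lambda>x. ball x (r x)) fine p" for p
    proof -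
      have finp: "finite p" using p by blast
      have K: "\<exists>u v. u \<le> v \<and> K = {u..v} \<and> {u..v} \<subseteq> {a..b} \<and> x \<in> {u..v} \<and> {u..v} \<subseteq> ball x (r x)" if xK: "(x, K) \<in> p" for x K
      proof -
        obtain u v where "K = cbox u v" using tagged_division_ofD(4)[OF p xK] by blast
        moreover have "x \<in> K" "K \<subseteq> {a..b}" using tagged_division_ofD(2,3)[OF p xK] by auto
        moreover have "K \<subseteq> ball x (r x)" using fineD[OF fine xK] .
        ultimately show ?thesis by (intro exI[of _ u] exI[of _ v]) auto
      qed
      define p1 where "p1 = {(x, K) \<in> p. x \<in> N}"
      define p2 where "p2 = {(x, K) \<in> p. x \<notin> N}"
      have p12: "p = p1 \<union> p2" "p1 \<inter> p2 = {}"
        unfolding p1_def p2_def by auto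
      then have "finite p1" "finite p2" using finp by auto
      note p12 = p12 this
      have tel: "(\<Sum>(x, K)\<in>p. \<gamma> (Sup K) - \<gamma> (Inf K)) = \<gamma> b - \<gamma> a"
        by (rule additive_tagged_division_1[OF \<open>a \<le> b\<close> p])
      have len: "(\<Sum>(x, K)\<in>p. measure lborel K) = b - a"
        using additive_content_tagged_division[of p a b] p \<open>a \<le> b\<close> by simp
      have "norm ((\<Sum>(x, K)\<in>p. measure lborel K *\<^sub>R g x) - (\<gamma> b - \<gamma> a))
          = norm (\<Sum>(x, K)\<in>p. measure lborel K *\<^sub>R g x - (\<gamma> (Sup K) - \<gamma> (Inf K)))"
        unfolding tel[symmetric] by (simp add: sum_subtractf split_beta)
      also have "\<dots> \<le> (\<Sum>(x, K)\<in>p. norm (measure lborel K *\<^sub>R g x - (\<gamma> (Sup K) - \<gamma> (Inf K))))"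
        unfolding split_beta by (rule norm_sum)
      also have "\<dots> = (\<Sum>(x, K)\<in>p1. norm (measure lborel K *\<^sub>R g x - (\<gamma> (Sup K) - \<gamma> (Inf K))))
          + (\<Sum>(x, K)\<in>p2. norm (measure lborel K *\<^sub>R g x - (\<gamma> (Sup K) - \<gamma> (Inf K))))"
        unfolding p12(1) by (rule sum.union_disjoint) (use p12 in auto)
      also have "(\<Sum>(x, K)\<in>p1. norm (measure lborel K *\<^sub>R g x - (\<gamma> (Sup K) - \<gamma> (Inf K))))
          = (\<Sum>(x, K)\<in>p1. norm (\<gamma> (Sup K) - \<gamma> (Inf K)))"
        by (intro sum.cong) (auto simp: p1_def g0 norm_minus_commute)
      also have "\<dots> < e / 2"
      proof (rule absolutely_continuous_sum_le[OF d(2)])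
        fix x K assume xK: "(x, K) \<in> p1"
        then have xK': "(x, K) \<in> p" "x \<in> N" by (auto simp: p1_def)
        show "\<exists>u v. u \<le> v \<and> K = {u..v} \<and> K \<subseteq> {a..b}" using K[OF xK'(1)] by blast
        show "K \<subseteq> G" using K[OF xK'(1)] rG[OF xK'(2)] xK'(2) by (auto simp: r_def)
        fix x' K' assume "(x', K') \<in> p1" "(x, K) \<noteq> (x', K')"
        then show "interior K \<inter> interior K' = {}"
          using tagged_division_ofD(5)[OF p xK'(1), of x' K'] by (auto simp: p1_def)
      qed (use p12 G_lm G_d in auto)
      also have "(\<Sum>(x, K)\<in>p2. norm (measure lborel K *\<^sub>R g x - (\<gamma> (Sup K) - \<gamma> (Inf K)))) \<le> (\<Sum>(x, K)\<in>p2. e1 * measure lborel K)"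
      proof (rule sum_mono, clarify)
        fix x K assume "(x, K) \<in> p2"
        then have xK: "(x, K) \<in> p" "x \<notin> N" by (auto simp: p2_def)
        obtain u v where uv: "u \<le> v" "K = {u..v}" "{u..v} \<subseteq> {a..b}" "x \<in> {u..v}" "{u..v} \<subseteq> ball x (r x)"
          using K[OF xK(1)] by blast
        then have x: "x \<in> {a..b} - N" using xK by blast
        then have "r x = rD x" by (auto simp: r_def)
        then have "norm (\<gamma> v - \<gamma> u - (v - u) *\<^sub>R g x) \<le> e1 * (v - u)"
          using rD[OF x] uv by auto
        then show "norm (measure lborel K *\<^sub>R g x - (\<gamma> (Sup K) - \<gamma> (Inf K))) \<le> e1 * measure lborel K"
          using uv(1,2) by (simp add: norm_minus_commute)
      qed
      also have "\<dots> \<le> (\<Sum>(x, K)\<in>p. e1 * measure lborel K)"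
        using finp e1(1) unfolding p12(1) by (intro sum_mono2) (auto simp: p12)
      also have "\<dots> = e1 * (b - a)"
        unfolding len[symmetric] by (simp add: sum_distrib_left split_beta)
      also have "\<dots> < e / 2" by (rule e1)
      finally show ?thesis by simp
    qed
    ultimately show ?thesis
      by (intro exI[of _ "\<lambda>x. ball x (r x)"] conjI allI impI) simp_all
  qed
  then show ?thesis
    unfolding has_integral_real by simp
qed

section \<open>Geodesic rays in metrics dominating a Euclidean norm\<close>

text \<open>
  Stewart's theorem for the cevian from \<open>z\<close> to the point \<open>\<theta> * y\<close> of the side from \<open>0\<close> to \<open>y\<close>.
\<close>

lemma stewart:
  fixes y z :: "'a::real_inner"
  shows "(norm (z - \<theta> *\<^sub>R y))\<^sup>2
      = (1 - \<theta>) * (norm z)\<^sup>2 + \<theta> * (norm (z - y))\<^sup>2 - \<theta> * (1 - \<theta>) * (norm y)\<^sup>2"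
  unfolding power2_norm_eq_inner
  by (simp add: inner_diff_left inner_diff_right inner_commute[of y z] algebra_simps)

text \<open>
  The linear injection \<open>L\<close> transports the norm of the type to an arbitrary Euclidean norm, here the mass
  norm. That \<open>d x y\<close> vanishes only for \<open>x = y\<close> follows from the lower bound.
\<close>

locale norm_dominated_metric =
  fixes d :: "'v::euclidean_space \<Rightarrow> 'v \<Rightarrow> real" and L :: "'v \<Rightarrow> 'v" and c :: real
  assumes lin: "linear L" and inj: "inj L" and c_pos: "c > 0"
    and norm_le: "c * norm (L (x - y)) \<le> d x y"
    and sym: "d x y = d y x"
    and tri: "d x z \<le> d x y + d y z"
    and tendsto_0: "((\<lambda>y. d x y) \<longlongrightarrow> 0) (nhds x)"
begin

lemma nonneg: "0 \<le> d x y"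
  using norm_le[of x y] c_pos by (meson mult_nonneg_nonneg norm_ge_zero less_imp_le order_trans)

lemma self: "d x x = 0"
  using tendsto_0[of x] by (metis tendsto_imp_filterlim_at_right tendsto_nhds_iff)

lemma reverse_tri: "\<bar>d x y - d x' y'\<bar> \<le> d x x' + d y y'"
  using tri[of x y x'] tri[of x' y y'] tri[of x' y' x] tri[of x y' y] sym[of x' x] sym[of y' y] by linarith

lemma continuous_on_d:
  fixes f g :: "'a::topological_space \<Rightarrow> 'v"
  assumes "continuous_on S f" "continuous_on S g"
  shows "continuous_on S (\<lambda>t. d (f t) (g t))"
  unfolding continuous_on_def
proof
  fix t assume "t \<in> S"
  have "((\<lambda>t'. d (f t) (f t') + d (g t) (g t')) \<longlongrightarrow> 0 + 0) (at t within S)"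
    using assms \<open>t \<in> S\<close> unfolding continuous_on_def
    by (intro tendsto_add filterlim_compose[OF tendsto_0]) auto
  then have "((\<lambda>t'. d (f t) (f t') + d (g t) (g t')) \<longlongrightarrow> 0) (at t within S)" by simp
  then have "((\<lambda>t'. d (f t') (g t') - d (f t) (g t)) \<longlongrightarrow> 0) (at t within S)"
    by (rule Lim_null_comparison[rotated]) (use reverse_tri sym in \<open>auto intro!: always_eventually\<close>)
  then show "((\<lambda>t. d (f t) (g t)) \<longlongrightarrow> d (f t) (g t)) (at t within S)"
    by (rule LIM_zero_cancel)
qed

lemma L_bounded_below: obtains B where "B > 0" "\<And>x. norm x \<le> B * norm (L x)"
proof -
  obtain B where "B > 0" "\<And>x. B * norm x \<le> norm (L x)"
    using linear_inj_bounded_below_pos[OF lin inj] by metis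
  then show thesis
    by (intro that[of "1 / B"]) (auto simp: field_simps)
qed

lemma compact_ball: "compact {y. d x y \<le> r}"
proof -
  obtain B where B: "B > 0" "\<And>x. norm x \<le> B * norm (L x)" using L_bounded_below by metis
  have "dist x y \<le> B * (r / c)" if "d x y \<le> r" for y
  proof -
    have "c * norm (L (x - y)) \<le> r" using norm_le[of x y] that by linarith
    then have "norm (L (x - y)) \<le> r / c" using c_pos by (simp add: field_simps)
    then have "B * norm (L (x - y)) \<le> B * (r / c)" using B(1) by (intro mult_left_mono) auto
    with B(2)[of "x - y"] show ?thesis by (simp add: dist_norm)
  qed
  then have "{y. d x y \<le> r} \<subseteq> cball x (B * (r / c))" by auto
  then have "bounded {y. d x y \<le> r}" by (rule bounded_subset[OF bounded_cball])
  moreover have "closed {y. d x y \<le> r}"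
    by (intro closed_Collect_le continuous_on_d continuous_intros)
  ultimately show ?thesis by (simp add: compact_eq_bounded_closed)
qed

end

locale norm_dominated_length_metric = norm_dominated_metric d L c
  for d :: "'v::euclidean_space \<Rightarrow> 'v \<Rightarrow> real" and L :: "'v \<Rightarrow> 'v" and c :: real +
  assumes almost_between: "0 < s \<Longrightarrow> s < d x y \<Longrightarrow> 0 < e \<Longrightarrow> \<exists>z. d x z = s \<and> d z y \<le> d x y - s + e"
begin

text \<open>
  Almost intermediate points accumulate at an exact one because balls are compact and \<open>d\<close> is continuous.
\<close>

lemma exists_between:
  assumes "0 \<le> s" "s \<le> d x y"
  shows "\<exists>z. d x z = s \<and> d z y = d x y - s"
proof -
  consider "s = 0" | "s = d x y" | "0 < s" "s < d x y" using assms by linarith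
  then show ?thesis
  proof cases
    case 3
    have "\<exists>z. d x z = s \<and> d z y \<le> d x y - s + 1 / Suc n" for n
      by (rule almost_between[OF 3]) simp
    then obtain z where z: "\<And>n. d x (z n) = s" "\<And>n. d (z n) y \<le> d x y - s + 1 / Suc n" by metis
    have "\<And>n. z n \<in> {y. d x y \<le> s}" using z(1) by simp
    then obtain l r where lr: "strict_mono r" "(z \<circ> r) \<longlonglongrightarrow> l"
      using compact_ball[of x s] unfolding compact_def by metis
    have cont: "(\<lambda>n. d u ((z \<circ> r) n)) \<longlonglongrightarrow> d u l" for u
    proof -
      have "continuous_on UNIV (d u)" by (intro continuous_on_d continuous_intros)
      then show ?thesis by (rule continuous_on_tendsto_compose[OF _ lr(2)]) auto
    qed
    have "d x l = s"
      using cont[of x] z(1) by (simp add: LIMSEQ_const_iff)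
    moreover have "d l y \<le> d x y - s"
    proof -
      have "(\<lambda>n. d x y - s + 1 / real (Suc n)) \<longlonglongrightarrow> d x y - s + 0"
        by (intro tendsto_add tendsto_const LIMSEQ_Suc[OF lim_const_over_n])
      then have "(\<lambda>n. d x y - s + 1 / real (Suc (r n))) \<longlonglongrightarrow> d x y - s"
        using LIMSEQ_subseq_LIMSEQ[OF _ lr(1)] by (force simp: o_def)
      then have "d y l \<le> d x y - s"
        by (rule LIMSEQ_le[OF cont[of y]]) (use z(2) sym in auto)
      then show ?thesis by (simp add: sym)
    qed
    ultimately show ?thesis using tri[of x y l] by (intro exI[of _ l]) auto
  next
    case 1
    then show ?thesis by (intro exI[of _ x]) (simp add: self)
  next
    case 2
    then show ?thesis by (intro exI[of _ y]) (simp add: self)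
  qed
qed

text \<open>
  If \<open>d p y\<close> exceeds \<open>c * norm (L (y - p))\<close> by at most \<open>E\<close>, then a point between \<open>p\<close> and \<open>y\<close> is close
  to the point dividing the segment in the same ratio: with \<open>s = d p z = \<theta> * T\<close> and \<open>T = d p y\<close>, the sides of
  the triangle \<open>p, z, y\<close>, multiplied by \<open>c\<close>, are at most \<open>\<theta> * T\<close>, at most \<open>(1 - \<theta>) * T\<close> and at least
  \<open>T - E\<close>, and Stewart's identity leaves only a multiple of \<open>T * E\<close>.
\<close>

lemma near_chord:
  assumes z: "d p z + d z y = d p y" and "0 < d p z" and E: "d p y \<le> c * norm (L (y - p)) + E" "0 \<le> E"
  shows "c\<^sup>2 * (norm (L ((1 / d p z) *\<^sub>R (z - p) - (1 / d p y) *\<^sub>R (y - p))))\<^sup>2 \<le> 2 * E / d p z"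
proof -
  define s where "s = d p z"
  define T where "T = d p y"
  define \<theta> where "\<theta> = s / T"
  have sT: "0 < s" "s \<le> T" using assms(2) z nonneg[of z y] by (auto simp: s_def T_def)
  then have \<theta>: "0 < \<theta>" "\<theta> \<le> 1" "s = \<theta> * T" "0 < T" by (auto simp: \<theta>_def)
  let ?Z = "L (z - p)" and ?Y = "L (y - p)"
  have 1: "c * norm ?Z \<le> \<theta> * T" using norm_le[of z p] sym[of p z] \<theta>(3) by (simp add: s_def)
  have 2: "c * norm (?Z - ?Y) \<le> (1 - \<theta>) * T"
  proof -
    have "?Z - ?Y = L (z - y)" by (simp add: linear_diff[OF lin, symmetric])
    moreover have "d z y = T - \<theta> * T" using z \<theta>(3) by (simp add: s_def T_def)
    ultimately show ?thesis using norm_le[of z y] by (simp add: algebra_simps)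
  qed
  have 3: "T\<^sup>2 - 2 * T * E \<le> (c * norm ?Y)\<^sup>2"
  proof (cases "E \<le> T")
    case True
    have "(T - E)\<^sup>2 \<le> (c * norm ?Y)\<^sup>2"
      using True E(1) by (intro power_mono) (auto simp: T_def)
    moreover have "T\<^sup>2 - 2 * T * E \<le> (T - E)\<^sup>2" by (simp add: power2_diff)
    ultimately show ?thesis by linarith
  next
    case False
    then have "T * T \<le> T * E" using \<theta>(4) by (intro mult_left_mono) auto
    moreover have "0 \<le> T * E" using \<theta>(4) E by simp
    ultimately have "T\<^sup>2 - 2 * T * E \<le> 0" by (simp add: power2_eq_square)
    then show ?thesis by (meson order_trans zero_le_power2)
  qed
  have "c\<^sup>2 * (norm (?Z - \<theta> *\<^sub>R ?Y))\<^sup>2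
      = (1 - \<theta>) * (c * norm ?Z)\<^sup>2 + \<theta> * (c * norm (?Z - ?Y))\<^sup>2 - \<theta> * (1 - \<theta>) * (c * norm ?Y)\<^sup>2"
    unfolding stewart[of ?Z \<theta> ?Y] by (simp add: power_mult_distrib algebra_simps)
  also have "\<dots> \<le> (1 - \<theta>) * (\<theta> * T)\<^sup>2 + \<theta> * ((1 - \<theta>) * T)\<^sup>2 - \<theta> * (1 - \<theta>) * (T\<^sup>2 - 2 * T * E)"
    using 1 2 3 \<theta> c_pos by (intro diff_mono add_mono mult_left_mono power_mono) auto
  also have "\<dots> = 2 * (1 - \<theta>) * \<theta> * T * E"
    by (simp add: power2_eq_square algebra_simps)
  also have "\<dots> \<le> 2 * 1 * \<theta> * T * E"
    using \<theta> E by (intro mult_right_mono mult_left_mono) auto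
  finally have 4: "c\<^sup>2 * (norm (?Z - \<theta> *\<^sub>R ?Y))\<^sup>2 \<le> 2 * s * E" using \<theta>(3) by (simp add: mult.assoc)
  have "L ((1 / s) *\<^sub>R (z - p) - (1 / T) *\<^sub>R (y - p)) = (1 / s) *\<^sub>R (?Z - \<theta> *\<^sub>R ?Y)"
    using sT by (simp add: linear_diff[OF lin] linear_scale[OF lin] \<theta>_def scaleR_right_diff_distrib)
  then have "c\<^sup>2 * (norm (L ((1 / s) *\<^sub>R (z - p) - (1 / T) *\<^sub>R (y - p))))\<^sup>2
      = (c\<^sup>2 * (norm (?Z - \<theta> *\<^sub>R ?Y))\<^sup>2) / s\<^sup>2"
    using sT by (simp add: power_divide)
  also have "\<dots> \<le> (2 * s * E) / s\<^sup>2" using 4 by (intro divide_right_mono) auto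
  also have "\<dots> = 2 * E / s" using sT by (simp add: power2_eq_square)
  finally show ?thesis by (simp add: s_def T_def)
qed

text \<open>
  How far \<open>x\<close> is, on the scale of its own distance from \<open>p\<close>, from lying on the ray \<open>p + s * v\<close> at the time
  \<open>s = d p x\<close>.
\<close>

definition direction_error :: "'v \<Rightarrow> 'v \<Rightarrow> 'v \<Rightarrow> real" where
  "direction_error p v x = norm (L ((1 / d p x) *\<^sub>R (x - p) - v))"

lemma direction_error_scaled:
  assumes "0 < d p x"
  shows "norm (L (x - p - d p x *\<^sub>R v)) = d p x * direction_error p v x"
proof -
  have "x - p - d p x *\<^sub>R v = d p x *\<^sub>R ((1 / d p x) *\<^sub>R (x - p) - v)"
    using assms by (simp add: scaleR_right_diff_distrib)
  then show ?thesis using assms by (simp add: direction_error_def linear_scale[OF lin])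
qed

lemma direction_error_dyadic_step:
  assumes z: "d p z + d z y = d p y" and s: "0 < d p z" "d p y \<le> 2 * d p z"
    and E: "d p y \<le> c * norm (L (y - p)) + C * sqrt (d p y)" and "0 \<le> C"
  shows "direction_error p v z \<le> direction_error p v y + sqrt (2 * C * sqrt 2) / c * (1 / sqrt (sqrt (d p z)))"
proof -
  define s where "s = d p z"
  define D where "D = norm (L ((1 / d p z) *\<^sub>R (z - p) - (1 / d p y) *\<^sub>R (y - p)))"
  have "s > 0" using s by (simp add: s_def)
  have "c\<^sup>2 * D\<^sup>2 \<le> 2 * (C * sqrt (d p y)) / s"
    unfolding D_def s_def using assms by (intro near_chord) (auto intro!: mult_nonneg_nonneg nonneg)
  also have "\<dots> \<le> 2 * (C * sqrt (2 * s)) / s"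
    using s \<open>0 \<le> C\<close> \<open>s > 0\<close> by (intro divide_right_mono mult_left_mono) (auto simp: s_def)
  also have "\<dots> = 2 * C * sqrt 2 * (sqrt s / s)"
    by (simp add: real_sqrt_mult)
  also have "sqrt s / s = 1 / sqrt s" using \<open>s > 0\<close> by (simp add: field_simps)
  finally have "sqrt ((c * D)\<^sup>2) \<le> sqrt (2 * C * sqrt 2 * (1 / sqrt s))"
    by (intro real_sqrt_le_mono) (simp add: power_mult_distrib)
  then have cD: "c * D \<le> sqrt (2 * C * sqrt 2) * (1 / sqrt (sqrt s))"
    using c_pos by (simp add: D_def real_sqrt_mult real_sqrt_divide abs_mult)
  have "D \<le> X / c * Y" if "c * D \<le> X * Y" for X Y
    using that c_pos by (simp add: field_simps)
  from this[OF cD] have D: "D \<le> sqrt (2 * C * sqrt 2) / c * (1 / sqrt (sqrt s))" .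
  have "L ((1 / d p z) *\<^sub>R (z - p) - v)
      = L ((1 / d p z) *\<^sub>R (z - p) - (1 / d p y) *\<^sub>R (y - p)) + L ((1 / d p y) *\<^sub>R (y - p) - v)"
    by (simp add: linear_add[OF lin, symmetric])
  then have "direction_error p v z \<le> D + direction_error p v y"
    unfolding direction_error_def D_def by (metis norm_triangle_ineq)
  with D show ?thesis by (simp add: s_def)
qed

text \<open>
  The errors of the steps from distance \<open>2 * s\<close> to \<open>s\<close>, from \<open>4 * s\<close> to \<open>2 * s\<close>, and so on, form a
  geometric series with ratio \<open>\<rho> = 2 powr (-1/4)\<close>; \<open>K\<close> is its sum. The induction runs outwards from \<open>z\<close>: the
  claim for the intermediate point \<open>w\<close> at distance \<open>2 * s\<close> also keeps \<open>w\<close> in the cone where the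
  hypothesis \<open>cone\<close> applies, which is what the next step towards \<open>z\<close> requires.
\<close>

lemma direction_error_between:
  assumes C: "0 \<le> C" "0 < \<epsilon>"
    and cone: "\<And>y. s0 \<le> d p y \<Longrightarrow> direction_error p v y \<le> \<epsilon> \<Longrightarrow> d p y \<le> c * norm (L (y - p)) + C * sqrt (d p y)"
  obtains K s1 where "0 \<le> K" "0 < s1"
    "\<And>y z. d p z + d z y = d p y \<Longrightarrow> s1 \<le> d p z \<Longrightarrow> direction_error p v y \<le> \<epsilon> / 2 \<Longrightarrow>
      direction_error p v z \<le> direction_error p v y + K * (1 / sqrt (sqrt (d p z)))"
proof -
  define K0 where "K0 = sqrt (2 * C * sqrt 2) / c"
  define \<rho> where "\<rho> = 1 / sqrt (sqrt 2)"
  define K where "K = K0 / (1 - \<rho>)"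
  have "1 < sqrt (sqrt 2)" by simp
  then have \<rho>: "0 < \<rho>" "\<rho> < 1" unfolding \<rho>_def by (auto simp: field_simps)
  have "0 \<le> K0" using C c_pos by (simp add: K0_def)
  then have K: "0 \<le> K" "K * \<rho> + K0 = K" using \<rho> by (auto simp: K_def field_simps)
  then have "K0 \<le> K" using \<rho> mult_nonneg_nonneg[of K \<rho>] by linarith
  note K = K this
  \<comment> \<open>From the distance \<open>s1\<close> on, the whole series is below \<open>\<epsilon> / 2\<close>.\<close>
  define s1 where "s1 = max (max s0 1) ((2 * K / \<epsilon>) ^ 4)"
  have s1: "s1 \<ge> s0" "s1 \<ge> 1" "s1 \<ge> (2 * K / \<epsilon>) ^ 4" by (auto simp: s1_def)
  have small: "K * (1 / sqrt (sqrt s)) \<le> \<epsilon> / 2" if "s1 \<le> s" for s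
  proof -
    have le: "sqrt (sqrt ((2 * K / \<epsilon>) ^ 4)) \<le> sqrt (sqrt s)"
      using that s1 by (intro real_sqrt_le_mono) auto
    have "(2 * K / \<epsilon>) ^ 4 = ((2 * K / \<epsilon>)\<^sup>2)\<^sup>2" by simp
    then have "sqrt (sqrt ((2 * K / \<epsilon>) ^ 4)) = \<bar>2 * K / \<epsilon>\<bar>"
      by (simp only: real_sqrt_abs abs_power2)
    then have "2 * K / \<epsilon> \<le> sqrt (sqrt s)" using le by linarith
    moreover have "0 < sqrt (sqrt s)" using that s1 by simp
    ultimately show ?thesis using C by (simp add: field_simps)
  qed
  have single: "direction_error p v z \<le> direction_error p v y + K * (1 / sqrt (sqrt (d p z)))"
    if "d p z + d z y = d p y" "s1 \<le> d p z" "direction_error p v y \<le> \<epsilon> / 2" "d p y \<le> 2 * d p z" for y z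
  proof -
    have "direction_error p v z \<le> direction_error p v y + K0 * (1 / sqrt (sqrt (d p z)))"
      unfolding K0_def using that s1 C nonneg[of z y]
      by (intro direction_error_dyadic_step cone) auto
    also have "K0 * (1 / sqrt (sqrt (d p z))) \<le> K * (1 / sqrt (sqrt (d p z)))"
      using K that s1 by (intro mult_right_mono) auto
    finally show ?thesis by simp
  qed
  have main: "direction_error p v z \<le> direction_error p v y + K * (1 / sqrt (sqrt (d p z)))"
    if "d p z + d z y = d p y" "s1 \<le> d p z" "direction_error p v y \<le> \<epsilon> / 2" "d p y \<le> 2 ^ k * d p z" for y z k
    using that
  proof (induction k arbitrary: z)
    case 0
    then have "d p z > 0" using s1 by simp
    with 0 show ?case by (intro single) auto
  next
    case (Suc k)
    let ?s = "d p z"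
    have "?s > 0" using Suc.prems s1 by simp
    show ?case
    proof (cases "d p y \<le> 2 * ?s")
      case True
      with Suc.prems show ?thesis by (intro single)
    next
      case False
      then have "0 \<le> ?s" "?s \<le> d z y" using Suc.prems(1) nonneg by auto
      then obtain w where w: "d z w = ?s" "d w y = d z y - ?s" using exists_between by blast
      have dpw: "d p w = 2 * ?s"
        using tri[of p w z] tri[of p y w] w Suc.prems(1) by linarith
      have 1: "direction_error p v w \<le> direction_error p v y + K * (1 / sqrt (sqrt (d p w)))"
        using w dpw Suc.prems \<open>?s > 0\<close> by (intro Suc.IH) auto
      also have "\<dots> \<le> \<epsilon> / 2 + \<epsilon> / 2"
        using Suc.prems small[of "d p w"] dpw \<open>?s > 0\<close> by (intro add_mono) auto
      finally have "direction_error p v w \<le> \<epsilon>" by simp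
      then have 2: "direction_error p v z \<le> direction_error p v w + K0 * (1 / sqrt (sqrt ?s))"
        unfolding K0_def using w dpw Suc.prems s1 C \<open>?s > 0\<close>
        by (intro direction_error_dyadic_step cone) auto
      have "K * (1 / sqrt (sqrt (d p w))) = K * \<rho> * (1 / sqrt (sqrt ?s))"
        by (simp add: dpw \<rho>_def real_sqrt_mult)
      with 1 2 have "direction_error p v z \<le> direction_error p v y + (K * \<rho> + K0) * (1 / sqrt (sqrt ?s))"
        by (simp add: algebra_simps add_divide_distrib)
      then show ?thesis using K(2) by simp
    qed
  qed
  show thesis
  proof
    show "0 \<le> K" by (rule K)
    show "0 < s1" using s1 by simp
    fix y z assume *: "d p z + d z y = d p y" "s1 \<le> d p z" "direction_error p v y \<le> \<epsilon> / 2"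
    obtain k where "d p y / d p z < 2 ^ k" using real_arch_pow[of 2 "d p y / d p z"] by auto
    then have "d p y \<le> 2 ^ k * d p z" using * s1 by (simp add: field_simps)
    with * show "direction_error p v z \<le> direction_error p v y + K * (1 / sqrt (sqrt (d p z)))" by (rule main)
  qed
qed

text \<open>
  The times are inserted in decreasing order, each new point being chosen between \<open>p\<close> and the previously
  nearest one.
\<close>

lemma finite_geodesic:
  assumes "finite F" "\<And>s. s \<in> F \<Longrightarrow> 0 \<le> s \<and> s \<le> d p y"
  shows "\<exists>g. \<forall>s\<in>F. d p (g s) = s \<and> d (g s) y = d p y - s \<and> (\<forall>t\<in>F. d (g s) (g t) = \<bar>s - t\<bar>)"
  using assms
proof (induction F rule: finite_linorder_min_induct)
  case empty
  then show ?case by simp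
next
  case (insert b A)
  then obtain g where g: "\<And>s. s \<in> A \<Longrightarrow> d p (g s) = s \<and> d (g s) y = d p y - s" 
    "\<And>s t. s \<in> A \<Longrightarrow> t \<in> A \<Longrightarrow> d (g s) (g t) = \<bar>s - t\<bar>" by (metis insertCI)
  have b: "0 \<le> b" "b \<le> d p y" using insert.prems by auto
  obtain z where z: "d p z = b" "d z y = d p y - b" "\<And>t. t \<in> A \<Longrightarrow> d z (g t) = t - b"
  proof (cases "A = {}")
    case True
    then show thesis using exists_between[OF b] that by auto
  next
    case False
    define t0 where "t0 = Min A"
    have t0: "t0 \<in> A" "\<And>t. t \<in> A \<Longrightarrow> t0 \<le> t" using False insert.hyps by (auto simp: t0_def)
    have "b \<le> d p (g t0)" using g(1)[OF t0(1)] insert.hyps(2) t0(1) by (auto simp: less_imp_le)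
    then obtain z where z: "d p z = b" "d z (g t0) = t0 - b"
      using exists_between[OF b(1), of p "g t0"] g(1)[OF t0(1)] by auto
    show thesis
    proof
      show "d p z = b" by (rule z)
      show "d z y = d p y - b"
        using tri[of z y "g t0"] tri[of p y z] z g(1)[OF t0(1)] by linarith
      fix t assume t: "t \<in> A"
      show "d z (g t) = t - b"
        using tri[of z "g t" "g t0"] tri[of p "g t" z] z g(1)[OF t] g(2)[OF t0(1) t] t0(2)[OF t] by linarith
    qed
  qed
  define g' where "g' = g(b := z)"
  have "b \<notin> A" using insert.hyps(2) by auto
  then have g': "g' b = z" "\<And>t. t \<in> A \<Longrightarrow> g' t = g t" by (auto simp: g'_def)
  have lt: "b < t" if "t \<in> A" for t using insert.hyps(2) that by auto
  have "d p (g' s) = s \<and> d (g' s) y = d p y - s \<and> (\<forall>t\<in>insert b A. d (g' s) (g' t) = \<bar>s - t\<bar>)"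
    if "s \<in> insert b A" for s
    using that
  proof
    assume "s = b"
    then show ?thesis using z g' lt self by (auto simp: abs_if dest: lt)
  next
    assume s: "s \<in> A"
    have "d (g s) z = s - b" using z(3)[OF s] sym by simp
    then show ?thesis using s g g' lt[OF s] by auto
  qed
  then show ?case by blast
qed

text \<open>
  Tychonoff's theorem replaces a diagonal subsequence: every condition involves at most two times, finitely
  many conditions are met by points between \<open>p\<close> and a sufficiently far \<open>y\<close>, and the balls in which the
  values must lie are compact.
\<close>

theorem exists_ray_with_direction:
  assumes C: "0 \<le> C" "0 < \<epsilon>"
    and cone: "\<And>y. s0 \<le> d p y \<Longrightarrow> direction_error p v y \<le> \<epsilon> \<Longrightarrow> d p y \<le> c * norm (L (y - p)) + C * sqrt (d p y)"
    and far: "\<And>S \<eta>. 0 < \<eta> \<Longrightarrow> \<exists>y. S \<le> d p y \<and> direction_error p v y \<le> \<eta>"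
  obtains \<gamma> K s1 where "\<gamma> 0 = p" "\<And>s t. 0 \<le> s \<Longrightarrow> 0 \<le> t \<Longrightarrow> d (\<gamma> s) (\<gamma> t) = \<bar>s - t\<bar>"
    "0 < s1" "\<And>s. s1 \<le> s \<Longrightarrow> norm (L (\<gamma> s - p - s *\<^sub>R v)) \<le> s * (K * (1 / sqrt (sqrt s)))"
proof -
  obtain K s1 where K: "0 \<le> K" "0 < s1"
    "\<And>y z. d p z + d z y = d p y \<Longrightarrow> s1 \<le> d p z \<Longrightarrow> direction_error p v y \<le> \<epsilon> / 2 \<Longrightarrow>
      direction_error p v z \<le> direction_error p v y + K * (1 / sqrt (sqrt (d p z)))"
    using direction_error_between[OF C cone] by metis
  define A where "A = (\<lambda>(s, t). {\<gamma>. d p (\<gamma> s) = s} \<inter> {\<gamma>. d (\<gamma> s) (\<gamma> t) = \<bar>s - t\<bar>} \<inter>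
      (if s1 \<le> s then {\<gamma>. norm (L (\<gamma> s - p - s *\<^sub>R v)) \<le> s * ((K + 1) * (1 / sqrt (sqrt s)))} else UNIV))"
  define I :: "(real \<times> real) set" where "I = {0..} \<times> {0..}"
  define B :: "(real \<Rightarrow> 'v) set" where "B = (\<Pi>\<^sub>E t\<in>UNIV. {y. d p y \<le> \<bar>t\<bar>})"
  have "compactin (product_topology (\<lambda>_. euclidean) UNIV) B"
    unfolding B_def compactin_PiE by (simp add: compact_ball)
  then have "compact B" by (simp add: euclidean_product_topology)
  have eval: "continuous_on UNIV (\<lambda>\<gamma>::real \<Rightarrow> 'v. \<gamma> t)" for t
    by (rule continuous_on_product_coordinates)
  have contL: "continuous_on UNIV (\<lambda>x. L (f x))" if "continuous_on UNIV f" for f :: "(real \<Rightarrow> 'v) \<Rightarrow> 'v"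
    by (rule continuous_on_compose2[OF linear_continuous_on that])
      (use lin in \<open>auto simp: linear_conv_bounded_linear\<close>)
  have closed: "closed (A i)" for i
    unfolding A_def split_beta
    by (intro closed_Int closed_Collect_eq continuous_on_d eval continuous_on_const)
       (auto intro!: closed_Collect_le continuous_intros contL eval)
  have fip: "B \<inter> (\<Inter>i\<in>J. A i) \<noteq> {}" if J: "finite J" "J \<subseteq> I" for J
  proof -
    define F where "F = fst ` J \<union> snd ` J"
    have F: "finite F" "\<And>s. s \<in> F \<Longrightarrow> 0 \<le> s" using J by (auto simp: F_def I_def)
    define M where "M = Max (insert 1 F)"
    have M: "1 \<le> M" "\<And>s. s \<in> F \<Longrightarrow> s \<le> M" using F by (auto simp: M_def)
    \<comment> \<open>The error of \<open>y\<close> itself is absorbed by passing from \<open>K\<close> to \<open>K + 1\<close> at all times up to \<open>M\<close>.\<close>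
    define \<eta> where "\<eta> = min (\<epsilon> / 2) (1 / sqrt (sqrt M))"
    have "\<eta> > 0" using C M by (simp add: \<eta>_def)
    then obtain y where y: "M \<le> d p y" "direction_error p v y \<le> \<eta>" using far by blast
    obtain g where g: "\<And>s. s \<in> F \<Longrightarrow> d p (g s) = s \<and> d (g s) y = d p y - s \<and> (\<forall>t\<in>F. d (g s) (g t) = \<bar>s - t\<bar>)"
      using finite_geodesic[OF F(1), of p y] F(2) M(2) y(1) by fastforce
    define \<gamma> where "\<gamma> s = (if s \<in> F then g s else p)" for s
    have "\<gamma> \<in> B" using g F by (auto simp: B_def \<gamma>_def self)
    moreover have "\<gamma> \<in> A i" if "i \<in> J" for i
    proof -
      obtain s t where i: "i = (s, t)" by (cases i)
      then have st: "s \<in> F" "t \<in> F" using that by (auto simp: F_def image_iff) force+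
      have gs: "d p (g s) = s" "d (g s) y = d p y - s" "d (g s) (g t) = \<bar>s - t\<bar>" using g st by auto
      have "norm (L (g s - p - s *\<^sub>R v)) \<le> s * ((K + 1) * (1 / sqrt (sqrt s)))" if "s1 \<le> s"
      proof -
        have "s > 0" using that K by simp
        have "direction_error p v (g s) \<le> direction_error p v y + K * (1 / sqrt (sqrt (d p (g s))))"
          using gs that y by (intro K) (auto simp: \<eta>_def)
        also have "direction_error p v y \<le> 1 / sqrt (sqrt M)" using y by (simp add: \<eta>_def)
        also have "\<dots> \<le> 1 / sqrt (sqrt s)" using M(2)[OF st(1)] \<open>s > 0\<close>
          by (intro divide_left_mono) (auto intro!: mult_pos_pos)
        finally have "direction_error p v (g s) \<le> (K + 1) * (1 / sqrt (sqrt s))"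
          using gs by (simp add: algebra_simps add_divide_distrib)
        then have "s * direction_error p v (g s) \<le> s * ((K + 1) * (1 / sqrt (sqrt s)))"
          using \<open>s > 0\<close> by (intro mult_left_mono) auto
        then show ?thesis
          using direction_error_scaled[of p "g s" v] gs \<open>s > 0\<close> by simp
      qed
      then show ?thesis using st gs by (simp add: A_def i \<gamma>_def)
    qed
    ultimately have "\<gamma> \<in> B \<inter> (\<Inter>i\<in>J. A i)" by simp
    then show ?thesis by (metis empty_iff)
  qed
  have "B \<inter> (\<Inter>i\<in>I. A i) \<noteq> {}"
    by (rule compact_imp_fip_image[OF \<open>compact B\<close> closed fip])
  then obtain \<gamma> where "\<And>i. i \<in> I \<Longrightarrow> \<gamma> \<in> A i" by blast
  then have \<gamma>: "\<gamma> \<in> A (s, t)" if "0 \<le> s" "0 \<le> t" for s t using that by (auto simp: I_def)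
  show thesis
  proof
    have "d p (\<gamma> 0) = 0" using \<gamma>[of 0 0] by (simp add: A_def)
    then have "norm (L (p - \<gamma> 0)) \<le> 0" using norm_le[of p "\<gamma> 0"] c_pos by (simp add: mult_le_0_iff)
    then have "L (p - \<gamma> 0) = L 0" by (simp add: linear_0[OF lin])
    then show "\<gamma> 0 = p" using injD[OF inj, of "p - \<gamma> 0" 0] by simp
    show "d (\<gamma> s) (\<gamma> t) = \<bar>s - t\<bar>" if "0 \<le> s" "0 \<le> t" for s t
      using \<gamma>[OF that] by (simp add: A_def)
    show "0 < s1" by (rule K)
    show "norm (L (\<gamma> s - p - s *\<^sub>R v)) \<le> s * ((K + 1) * (1 / sqrt (sqrt s)))" if "s1 \<le> s" for s
      using \<gamma>[of s 0] K that by (simp add: A_def)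
  qed
qed

end

section \<open>The action of a curve\<close>

text \<open>
  The linear map carrying the mass norm to the norm of the type.
\<close>

definition mass_scaling :: "('n::finite \<Rightarrow> real) \<Rightarrow> 'e::euclidean_space ^ 'n \<Rightarrow> 'e ^ 'n" where
  "mass_scaling m x = (\<chi> i. sqrt (m i) *\<^sub>R x $ i)"

lemma linear_mass_scaling: "linear (mass_scaling m)"
  by (rule linearI) (auto simp: mass_scaling_def vec_eq_iff algebra_simps)

lemma inj_mass_scaling:
  assumes "\<And>i. m i > 0"
  shows "inj (mass_scaling m)"
proof (rule injI)
  fix x y assume "mass_scaling m x = mass_scaling m y"
  then have "sqrt (m i) *\<^sub>R x $ i = sqrt (m i) *\<^sub>R y $ i" for i by (simp add: mass_scaling_def vec_eq_iff)
  moreover have "sqrt (m i) \<noteq> 0" for i using assms[of i] by simp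
  ultimately show "x = y" by (simp add: vec_eq_iff)
qed

lemma mass_norm_eq:
  assumes "\<And>i. m i > 0"
  shows "mass_norm m x = norm (mass_scaling m x)"
proof -
  have "(\<Sum>i\<in>UNIV. (norm (mass_scaling m x $ i))\<^sup>2) = (\<Sum>i\<in>UNIV. m i * ((x $ i) \<bullet> (x $ i)))"
    using assms by (intro sum.cong)
      (auto simp: mass_scaling_def power_mult_distrib power2_norm_eq_inner less_imp_le)
  then show ?thesis
    by (simp add: mass_norm_def mass_inner_def norm_vec_def L2_set_def)
qed

lemma mass_norm_scaleR: "mass_norm m (r *\<^sub>R x) = \<bar>r\<bar> * mass_norm m x"
proof -
  have "mass_inner m (r *\<^sub>R x) (r *\<^sub>R x) = r\<^sup>2 * mass_inner m x x"
    by (simp add: mass_inner_def sum_distrib_left power2_eq_square algebra_simps)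
  then show ?thesis by (simp add: mass_norm_def real_sqrt_mult)
qed

lemma continuous_on_mass_norm: "continuous_on UNIV (mass_norm m)"
  unfolding mass_norm_def mass_inner_def by (intro continuous_intros)


lemma borel_measurable_newton_potential:
  fixes m :: "'n::{finite,linorder} \<Rightarrow> real"
  shows "newton_potential m \<in> borel_measurable (borel :: ('e::euclidean_space, 'n) vec measure)"
proof -
  have [measurable]: "(\<lambda>x :: ('e, 'n) vec. norm (x $ i - x $ j)) \<in> borel_measurable borel" for i j
    by (intro borel_measurable_continuous_onI continuous_intros)
  show ?thesis
    unfolding newton_potential_def split_beta by measurable
qed

text \<open>
  Assigning velocity zero to the times without derivative makes the density a function of the germ of the
  curve that is exactly invariant under translation and reversal of time; the arbitrary value of the derivative
  at such times would not be. Almost everywhere on an absolutely continuous curve it is the Lagrangian.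
\<close>

definition action_density ::
    "('n::{finite,linorder} \<Rightarrow> real) \<Rightarrow> real \<Rightarrow> (real \<Rightarrow> ('e::euclidean_space, 'n) vec) \<Rightarrow> real \<Rightarrow> ennreal" where
  "action_density m h \<gamma> t =
     ennreal (if \<gamma> differentiable (at t) then 1/2 * (mass_norm m (vector_derivative \<gamma> (at t)))\<^sup>2 else 0)
     + newton_potential m (\<gamma> t) + ennreal h"

definition action_on ::
    "('n::{finite,linorder} \<Rightarrow> real) \<Rightarrow> real \<Rightarrow> (real \<Rightarrow> ('e::euclidean_space, 'n) vec) \<Rightarrow> real set \<Rightarrow> ennreal" where
  "action_on m h \<gamma> S = (\<integral>\<^sup>+ t. action_density m h \<gamma> t * indicator S t \<partial>lebesgue)"

lemma AE_lebesgue_not_in_negligible: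
  assumes "negligible N"
  shows "AE t in lebesgue. t \<notin> N"
  using assms by (auto intro: AE_not_in simp: negligible_iff_null_sets)

lemma lagrangian_action_eq:
  fixes \<gamma> :: "real \<Rightarrow> ('e::euclidean_space, 'n::{finite,linorder}) vec"
  assumes "abs_continuous a b \<gamma>"
  shows "lagrangian_action m h a b \<gamma> = action_on m h \<gamma> {a<..<b}"
proof -
  obtain N where N: "negligible N" "\<And>t. a < t \<Longrightarrow> t < b \<Longrightarrow> t \<notin> N \<Longrightarrow> \<gamma> differentiable (at t)"
    using absolutely_continuous_differentiable_ae[OF assms] by blast
  have "negligible (N \<union> {a, b})" using N(1) by (intro negligible_Un) auto
  then have "AE t in lebesgue. t \<notin> N \<union> {a, b}" by (rule AE_lebesgue_not_in_negligible)
  then have "AE t in lebesgue. (ennreal (1/2 * (mass_norm m (vector_derivative \<gamma> (at t within {a..b})))\<^sup>2)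
          + newton_potential m (\<gamma> t) + ennreal h) * indicator {a..b} t
      = action_density m h \<gamma> t * indicator {a<..<b} t"
  proof eventually_elim
    case (elim t)
    show ?case
    proof (cases "t \<in> {a..b}")
      case True
      then have "a < t" "t < b" "t \<notin> N" using elim by auto
      then show ?thesis using N(2)[of t] by (simp add: action_density_def at_within_Icc_at)
    qed auto
  qed
  then show ?thesis
    unfolding lagrangian_action_def action_on_def by (rule nn_integral_cong_AE)
qed

text \<open>
  Extended by zero, the velocity is integrable on the whole line with the increment of the curve as its
  integral; in particular it is measurable.
\<close>

lemma absolutely_continuous_velocity:
  fixes \<gamma> :: "real \<Rightarrow> 'v::euclidean_space"
  assumes ac: "abs_continuous a b \<gamma>" and "a \<le> b"
  defines "g \<equiv> \<lambda>t. if a < t \<and> t < b \<and> \<gamma> differentiable (at t) then vector_derivative \<gamma> (at t) else 0"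
  shows "(g has_integral (\<gamma> b - \<gamma> a)) UNIV" "g \<in> borel_measurable lebesgue"
proof -
  obtain N0 where N0: "negligible N0" "\<And>t. a < t \<Longrightarrow> t < b \<Longrightarrow> t \<notin> N0 \<Longrightarrow> \<gamma> differentiable (at t)"
    using absolutely_continuous_differentiable_ae[OF ac] by blast
  define N where "N = {a, b} \<union> {t \<in> {a<..<b}. \<not> \<gamma> differentiable (at t)}"
  have "negligible (N0 \<union> {a, b})" using N0(1) by (intro negligible_Un) auto
  then have N: "negligible N" 
    by (rule negligible_subset) (use N0(2) in \<open>auto simp: N_def\<close>)
  have "(g has_integral (\<gamma> b - \<gamma> a)) {a..b}"
  proof (rule absolutely_continuous_fundamental_theorem[OF ac \<open>a \<le> b\<close> N])
    fix t assume "t \<in> {a..b} - N"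
    then have "a < t" "t < b" "\<gamma> differentiable (at t)" by (auto simp: N_def less_le)
    then show "(\<gamma> has_vector_derivative g t) (at t)"
      by (simp add: g_def vector_derivative_works)
  next
    fix t assume "t \<in> N"
    then show "g t = 0" by (auto simp: g_def N_def)
  qed
  then show int: "(g has_integral (\<gamma> b - \<gamma> a)) UNIV"
    by (rule has_integral_on_superset) (auto simp: g_def)
  show "g \<in> borel_measurable lebesgue"
    using has_integral_implies_lebesgue_measurable[OF int] by simp
qed

lemma action_density_eq_velocity:
  assumes "a < t" "t < b"
  shows "action_density m h \<gamma> t = ennreal (1/2 * (mass_norm m (if a < t \<and> t < b \<and> \<gamma> differentiable (at t) then vector_derivative \<gamma> (at t) else 0))\<^sup>2)
     + newton_potential m (\<gamma> t) + ennreal h"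
  using assms by (auto simp: action_density_def mass_norm_def mass_inner_def)

lemma borel_measurable_action_density:
  fixes \<gamma> :: "real \<Rightarrow> ('e::euclidean_space, 'n::{finite,linorder}) vec"
  assumes ac: "abs_continuous a b \<gamma>"
  shows "(\<lambda>t. action_density m h \<gamma> t * indicator {a<..<b} t) \<in> borel_measurable lebesgue"
proof (cases "a \<le> b")
  case False
  then show ?thesis by simp
next
  case True
  define g where "g t = (if a < t \<and> t < b \<and> \<gamma> differentiable (at t) then vector_derivative \<gamma> (at t) else 0)" for t
  define \<gamma>' where "\<gamma>' t = \<gamma> (max a (min b t))" for t
  have "g \<in> borel_measurable lebesgue"
    using absolutely_continuous_velocity(2)[OF ac True] by (simp add: g_def[abs_def])
  then have 1 [measurable]: "(\<lambda>t. mass_norm m (g t)) \<in> borel_measurable lebesgue"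
    by (rule measurable_compose[OF _ borel_measurable_continuous_onI[OF continuous_on_mass_norm]])
  have "continuous_on UNIV \<gamma>'"
    unfolding \<gamma>'_def using True
    by (intro continuous_on_compose2[OF absolutely_continuous_imp_continuous_on[OF ac]] continuous_intros) auto
  then have "\<gamma>' \<in> borel_measurable borel" by (rule borel_measurable_continuous_onI)
  then have "\<gamma>' \<in> borel_measurable lebesgue"
    by (intro measurable_completion) simp
  then have 2 [measurable]: "(\<lambda>t. newton_potential m (\<gamma>' t)) \<in> borel_measurable lebesgue"
    by (rule measurable_compose[OF _ borel_measurable_newton_potential])
  have eq: "(\<lambda>t. action_density m h \<gamma> t * indicator {a<..<b} t)
     = (\<lambda>t. (ennreal (1/2 * (mass_norm m (g t))\<^sup>2) + newton_potential m (\<gamma>' t) + ennreal h) * indicator {a<..<b} t)"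
    by (rule ext) (auto simp: action_density_eq_velocity[of a _ b] g_def \<gamma>'_def split: split_indicator)
  have [measurable]: "(indicator {a<..<b} :: real \<Rightarrow> ennreal) \<in> borel_measurable lebesgue"
    by (intro borel_measurable_indicator) simp
  show ?thesis unfolding eq by measurable
qed

text \<open>
  Pointwise \<open>u\<^sup>2 / 2 + h \<ge> sqrt (2 * h) * u\<close>, as \<open>(u - sqrt (2 * h))\<^sup>2 \<ge> 0\<close>; the integral of the speed bounds
  the norm of the increment.
\<close>

lemma action_on_lower_bound:
  fixes \<gamma> :: "real \<Rightarrow> ('e::euclidean_space, 'n::{finite,linorder}) vec"
  assumes ac: "abs_continuous a b \<gamma>" and "a \<le> b" and m: "\<And>i. m i > 0" and "h > 0"
  shows "ennreal (sqrt (2 * h) * norm (mass_scaling m (\<gamma> b - \<gamma> a))) \<le> action_on m h \<gamma> {a<..<b}"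
proof (cases "action_on m h \<gamma> {a<..<b} = \<infinity>")
  case True
  then show ?thesis by simp
next
  case False
  let ?L = "mass_scaling m"
  define g where "g t = (if a < t \<and> t < b \<and> \<gamma> differentiable (at t) then vector_derivative \<gamma> (at t) else 0)" for t
  have g: "(g has_integral (\<gamma> b - \<gamma> a)) UNIV" "g \<in> borel_measurable lebesgue"
    using absolutely_continuous_velocity[OF ac \<open>a \<le> b\<close>] by (simp_all add: g_def[abs_def])
  have bl: "bounded_linear ?L" using linear_mass_scaling by (simp add: linear_conv_bounded_linear)
  have Lg: "((?L \<circ> g) has_integral ?L (\<gamma> b - \<gamma> a)) UNIV"
    using has_integral_linear[OF g(1) bl] .
  have "?L \<in> borel_measurable borel"
    by (intro borel_measurable_continuous_onI linear_continuous_on bl)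
  then have meas: "(\<lambda>t. ?L (g t)) \<in> borel_measurable lebesgue"
    using g(2) by (rule measurable_compose[rotated])
  have "ennreal (sqrt (2 * h) * norm (?L (g t))) \<le> action_density m h \<gamma> t * indicator {a<..<b} t" for t
  proof (cases "a < t \<and> t < b")
    case False
    then show ?thesis by (auto simp: g_def linear_0[OF linear_mass_scaling])
  next
    case True
    have "0 \<le> (norm (?L (g t)) - sqrt (2 * h))\<^sup>2" by simp
    then have "2 * (sqrt (2 * h) * norm (?L (g t))) \<le> (norm (?L (g t)))\<^sup>2 + 2 * h"
      using \<open>h > 0\<close> by (simp add: power2_diff algebra_simps)
    then have "sqrt (2 * h) * norm (?L (g t)) \<le> 1/2 * (mass_norm m (g t))\<^sup>2 + h"
      unfolding mass_norm_eq[OF m] by linarith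
    then have "ennreal (sqrt (2 * h) * norm (?L (g t))) \<le> ennreal (1/2 * (mass_norm m (g t))\<^sup>2 + h)"
      by (rule ennreal_leI)
    also have "\<dots> = ennreal (1/2 * (mass_norm m (g t))\<^sup>2) + ennreal h"
      using \<open>h > 0\<close> by (intro ennreal_plus) auto
    also have "\<dots> \<le> ennreal (1/2 * (mass_norm m (g t))\<^sup>2) + newton_potential m (\<gamma> t) + ennreal h"
      by (intro add_right_mono) simp
    also have "\<dots> = action_density m h \<gamma> t"
      using True by (simp add: action_density_eq_velocity[of a t b] g_def)
    finally show ?thesis using True by simp
  qed
  then have le: "(\<integral>\<^sup>+ t. ennreal (sqrt (2 * h) * norm (?L (g t))) \<partial>lebesgue) \<le> action_on m h \<gamma> {a<..<b}"
    unfolding action_on_def by (intro nn_integral_mono)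
  have int: "integrable lebesgue (\<lambda>t. sqrt (2 * h) * norm (?L (g t)))"
  proof (rule integrableI_bounded)
    show "(\<lambda>t. sqrt (2 * h) * norm (?L (g t))) \<in> borel_measurable lebesgue" using meas by simp
    have "(\<integral>\<^sup>+ t. ennreal (norm (sqrt (2 * h) * norm (?L (g t)))) \<partial>lebesgue)
        = (\<integral>\<^sup>+ t. ennreal (sqrt (2 * h) * norm (?L (g t))) \<partial>lebesgue)"
      using \<open>h > 0\<close> by (simp add: abs_mult)
    also have "\<dots> < \<infinity>" using le False by (metis infinity_ennreal_def order.strict_trans1 top.not_eq_extremum)
    finally show "(\<integral>\<^sup>+ t. ennreal (norm (sqrt (2 * h) * norm (?L (g t)))) \<partial>lebesgue) < \<infinity>" .
  qed
  then have "integrable lebesgue (\<lambda>t. norm (?L (g t)))" using \<open>h > 0\<close> by simp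
  then have "integrable lebesgue (\<lambda>t. ?L (g t))" using meas by (simp add: integrable_norm_iff)
  then have "((\<lambda>t. ?L (g t)) has_integral (\<integral>t. ?L (g t) \<partial>lebesgue)) UNIV"
    by (rule has_integral_integral_lebesgue)
  then have "?L (\<gamma> b - \<gamma> a) = (\<integral>t. ?L (g t) \<partial>lebesgue)"
    using has_integral_unique[OF Lg[unfolded o_def]] by blast
  then have "sqrt (2 * h) * norm (?L (\<gamma> b - \<gamma> a)) \<le> sqrt (2 * h) * (\<integral>t. norm (?L (g t)) \<partial>lebesgue)"
    using \<open>h > 0\<close> integral_norm_bound[of lebesgue "\<lambda>t. ?L (g t)"] by (intro mult_left_mono) auto
  also have "\<dots> = (\<integral>t. sqrt (2 * h) * norm (?L (g t)) \<partial>lebesgue)" by simp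
  finally have "ennreal (sqrt (2 * h) * norm (?L (\<gamma> b - \<gamma> a)))
      \<le> ennreal (\<integral>t. sqrt (2 * h) * norm (?L (g t)) \<partial>lebesgue)"
    by (rule ennreal_leI)
  also have "\<dots> = (\<integral>\<^sup>+ t. ennreal (sqrt (2 * h) * norm (?L (g t))) \<partial>lebesgue)"
    using int \<open>h > 0\<close> by (intro nn_integral_eq_integral[symmetric]) auto
  also note le
  finally show ?thesis .
qed

lemma action_density_cong:
  assumes "eventually (\<lambda>s. \<gamma> s = \<gamma>' s) (nhds t)"
  shows "action_density m h \<gamma> t = action_density m h \<gamma>' t"
proof -
  have eq: "\<gamma> t = \<gamma>' t" using assms by (rule eventually_nhds_x_imp_x)
  have hv: "(\<gamma> has_vector_derivative D) (at t) \<longleftrightarrow> (\<gamma>' has_vector_derivative D) (at t)" for D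
    using assms eq by (intro has_vector_derivative_cong_ev) simp_all
  have "\<gamma> differentiable (at t) \<longleftrightarrow> \<gamma>' differentiable (at t)"
    using hv by (metis vector_derivative_works differentiableI_vector)
  moreover have "vector_derivative \<gamma> (at t) = vector_derivative \<gamma>' (at t)"
    using assms by (intro vector_derivative_cong_eq) auto
  ultimately show ?thesis by (simp add: action_density_def eq)
qed

lemma action_on_cong:
  assumes "open S" "\<And>t. t \<in> S \<Longrightarrow> \<gamma> t = \<gamma>' t"
  shows "action_on m h \<gamma> S = action_on m h \<gamma>' S"
  unfolding action_on_def
proof (rule nn_integral_cong)
  fix t
  show "action_density m h \<gamma> t * indicator S t = action_density m h \<gamma>' t * indicator S t"
  proof (cases "t \<in> S")
    case True
    then have "eventually (\<lambda>s. \<gamma> s = \<gamma>' s) (nhds t)"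
      using assms eventually_nhds by blast
    from action_density_cong[OF this] show ?thesis by simp
  qed simp
qed

text \<open>
  The factors \<open>\<sigma> = 1\<close> and \<open>\<sigma> = -1\<close> are the only ones that preserve speeds: translation gives the
  concatenation of curves, reversal the symmetry of the action potential.
\<close>

lemma action_density_affine:
  fixes \<gamma> :: "real \<Rightarrow> ('e::euclidean_space, 'n::{finite,linorder}) vec"
  assumes "\<sigma> = 1 \<or> \<sigma> = -1"
  shows "action_density m h (\<lambda>t. \<gamma> (r + \<sigma> * t)) t = action_density m h \<gamma> (r + \<sigma> * t)"
proof -
  have vd: "((\<lambda>t. f (r' + \<sigma> * t)) has_vector_derivative \<sigma> *\<^sub>R D) (at s)"
    if "(f has_vector_derivative D) (at (r' + \<sigma> * s))" for f :: "real \<Rightarrow> ('e, 'n) vec" and r' s D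
  proof -
    have "((\<lambda>t. r' + \<sigma> * t) has_vector_derivative \<sigma>) (at s)"
      by (auto intro!: derivative_eq_intros)
    from vector_diff_chain_at[OF this that] show ?thesis by (simp add: o_def)
  qed
  have sq: "\<sigma> * \<sigma> = 1" using assms by auto
  let ?f = "\<lambda>t. \<gamma> (r + \<sigma> * t)"
  have inv: "\<gamma> = (\<lambda>t. ?f (- (\<sigma> * r) + \<sigma> * t))"
    using sq by (simp add: algebra_simps mult.assoc[symmetric])
  have t: "- (\<sigma> * r) + \<sigma> * (r + \<sigma> * t) = t" using sq by (simp add: algebra_simps mult.assoc[symmetric])
  have "?f differentiable (at t) \<longleftrightarrow> \<gamma> differentiable (at (r + \<sigma> * t))"
  proof
    assume "?f differentiable (at t)"
    then obtain D where "(?f has_vector_derivative D) (at t)" by (auto simp: vector_derivative_works)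
    then have "((\<lambda>t. ?f (- (\<sigma> * r) + \<sigma> * t)) has_vector_derivative \<sigma> *\<^sub>R D) (at (r + \<sigma> * t))"
      by (intro vd) (simp only: t)
    then show "\<gamma> differentiable (at (r + \<sigma> * t))"
      unfolding inv[symmetric] by (rule differentiableI_vector)
  next
    assume "\<gamma> differentiable (at (r + \<sigma> * t))"
    from vd[OF this[unfolded vector_derivative_works]] show "?f differentiable (at t)"
      by (rule differentiableI_vector)
  qed
  moreover have "mass_norm m (vector_derivative ?f (at t)) = mass_norm m (vector_derivative \<gamma> (at (r + \<sigma> * t)))"
    if "\<gamma> differentiable (at (r + \<sigma> * t))"
  proof -
    have "vector_derivative ?f (at t) = \<sigma> *\<^sub>R vector_derivative \<gamma> (at (r + \<sigma> * t))"
      using vector_derivative_at[OF vd[OF that[unfolded vector_derivative_works]]] .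
    then show ?thesis using assms by (auto simp: mass_norm_scaleR)
  qed
  ultimately show ?thesis by (simp add: action_density_def)
qed

lemma action_on_affine:
  assumes "\<sigma> = 1 \<or> \<sigma> = -1" and ac: "abs_continuous a b \<gamma>"
    and S: "\<And>t. t \<in> S \<longleftrightarrow> r + \<sigma> * t \<in> {a<..<b}"
  shows "action_on m h (\<lambda>t. \<gamma> (r + \<sigma> * t)) S = action_on m h \<gamma> {a<..<b}"
proof -
  have "action_on m h \<gamma> {a<..<b} = ennreal \<bar>\<sigma>\<bar> *
      (\<integral>\<^sup>+t. action_density m h \<gamma> (r + \<sigma> * t) * indicator {a<..<b} (r + \<sigma> * t) \<partial>lebesgue)"
    unfolding action_on_def using assms(1)
    by (intro nn_integral_real_affine_lebesgue borel_measurable_action_density[OF ac]) auto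
  also have "\<dots> = action_on m h (\<lambda>t. \<gamma> (r + \<sigma> * t)) S"
    unfolding action_on_def action_density_affine[OF assms(1)]
    using assms(1) by (auto intro!: nn_integral_cong simp: indicator_def S)
  finally show ?thesis by simp
qed

lemma absolutely_continuous_affine:
  assumes \<sigma>: "\<sigma> = 1 \<or> \<sigma> = -1" and ac: "abs_continuous a b \<gamma>"
    and ends: "\<And>t. a' \<le> t \<Longrightarrow> t \<le> b' \<Longrightarrow> a \<le> r + \<sigma> * t \<and> r + \<sigma> * t \<le> b"
  shows "abs_continuous a' b' (\<lambda>t. \<gamma> (r + \<sigma> * t))"
  unfolding abs_continuous_iff
proof (intro allI impI)
  fix e :: real assume "e > 0"
  then obtain d where d: "d > 0" "\<And>n u v. interval_family a b n u v \<Longrightarrow> (\<Sum>k<n. v k - u k) < d \<Longrightarrow>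
      family_variation \<gamma> n u v < e"
    using ac unfolding abs_continuous_iff by meson
  have "family_variation (\<lambda>t. \<gamma> (r + \<sigma> * t)) n u v < e"
    if f: "interval_family a' b' n u v" and len: "(\<Sum>k<n. v k - u k) < d" for n u v
  proof -
    define u' where "u' k = (if \<sigma> = 1 then r + u k else r - v k)" for k
    define v' where "v' k = (if \<sigma> = 1 then r + v k else r - u k)" for k
    have uv: "u' k = r + \<sigma> * u k \<and> v' k = r + \<sigma> * v k \<or> u' k = r + \<sigma> * v k \<and> v' k = r + \<sigma> * u k" for k
      using \<sigma> by (auto simp: u'_def v'_def)
    have bnd: "a \<le> u' k \<and> u' k \<le> v' k \<and> v' k \<le> b" if "k < n" for k
      using interval_family_bounds[OF f that] ends[of "u k"] ends[of "v k"] \<sigma> by (auto simp: u'_def v'_def)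
    have "{u' k<..<v' k} \<inter> {u' l<..<v' l} = {}" if "k < n" "l < n" "k \<noteq> l" for k l
    proof -
      have "{u k<..<v k} \<inter> {u l<..<v l} = {}"
        using f that by (auto simp: interval_family_def disjoint_family_on_def)
      moreover have "t \<in> {u' i<..<v' i} \<longleftrightarrow> \<sigma> * (t - r) \<in> {u i<..<v i}" for t i
        using \<sigma> by (auto simp: u'_def v'_def)
      ultimately show ?thesis by blast
    qed
    then have "interval_family a b n u' v'"
      using bnd by (simp add: interval_family_def disjoint_family_on_def)
    moreover have "(\<Sum>k<n. v' k - u' k) < d"
    proof -
      have "(\<Sum>k<n. v' k - u' k) = (\<Sum>k<n. v k - u k)" by (intro sum.cong) (auto simp: u'_def v'_def)
      then show ?thesis using len by simp
    qed
    ultimately have "family_variation \<gamma> n u' v' < e" by (rule d)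
    moreover have "family_variation \<gamma> n u' v' = family_variation (\<lambda>t. \<gamma> (r + \<sigma> * t)) n u v"
      unfolding family_variation_def
    proof (rule sum.cong)
      fix k
      show "norm (\<gamma> (v' k) - \<gamma> (u' k)) = norm (\<gamma> (r + \<sigma> * v k) - \<gamma> (r + \<sigma> * u k))"
        using uv[of k] by (auto simp: norm_minus_commute)
    qed simp
    ultimately show ?thesis by simp
  qed
  then show "\<exists>d>0. \<forall>n u v. interval_family a' b' n u v \<longrightarrow> (\<Sum>k<n. v k - u k) < d \<longrightarrow>
      family_variation (\<lambda>t. \<gamma> (r + \<sigma> * t)) n u v < e"
    using d(1) by (intro exI[of _ d]) simp
qed

lemma absolutely_continuous_subinterval:
  assumes "abs_continuous a b \<gamma>" "a \<le> a'" "b' \<le> b"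
  shows "abs_continuous a' b' \<gamma>"
  unfolding abs_continuous_iff
proof (intro allI impI)
  fix e :: real assume "e > 0"
  then obtain d where d: "d > 0" "\<And>n u v. interval_family a b n u v \<Longrightarrow> (\<Sum>k<n. v k - u k) < d \<Longrightarrow>
      family_variation \<gamma> n u v < e"
    using assms(1) unfolding abs_continuous_iff by meson
  then show "\<exists>d>0. \<forall>n u v. interval_family a' b' n u v \<longrightarrow> (\<Sum>k<n. v k - u k) < d \<longrightarrow> family_variation \<gamma> n u v < e"
    using interval_family_mono[OF _ assms(2,3)] by (intro exI[of _ d]) simp
qed

lemma absolutely_continuous_join:
  assumes 1: "abs_continuous a b \<gamma>1" and 2: "abs_continuous b c \<gamma>2"
    and eq: "\<gamma>1 b = \<gamma>2 b" and "a \<le> b" "b \<le> c"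
  shows "abs_continuous a c (\<lambda>t. if t \<le> b then \<gamma>1 t else \<gamma>2 t)"
  unfolding abs_continuous_iff
proof (intro allI impI)
  fix e :: real assume "e > 0"
  then have e2: "e / 2 > 0" by simp
  obtain d1 where d1: "d1 > 0" "\<And>n u v. interval_family a b n u v \<Longrightarrow> (\<Sum>k<n. v k - u k) < d1 \<Longrightarrow>
      family_variation \<gamma>1 n u v < e / 2"
    using 1 e2 unfolding abs_continuous_iff by meson
  obtain d2 where d2: "d2 > 0" "\<And>n u v. interval_family b c n u v \<Longrightarrow> (\<Sum>k<n. v k - u k) < d2 \<Longrightarrow>
      family_variation \<gamma>2 n u v < e / 2"
    using 2 e2 unfolding abs_continuous_iff by meson
  let ?\<gamma> = "\<lambda>t. if t \<le> b then \<gamma>1 t else \<gamma>2 t"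
  have "family_variation ?\<gamma> n u v < e"
    if f: "interval_family a c n u v" and len: "(\<Sum>k<n. v k - u k) < min d1 d2" for n u v
  proof -
    have fmin: "interval_family a b n (\<lambda>k. min (u k) b) (\<lambda>k. min (v k) b)"
      using interval_family_min[OF f \<open>a \<le> b\<close>] \<open>b \<le> c\<close> by (simp add: min_absorb2)
    have fmax: "interval_family b c n (\<lambda>k. max (u k) b) (\<lambda>k. max (v k) b)"
      using interval_family_max[OF f \<open>b \<le> c\<close>] \<open>a \<le> b\<close> by (simp add: max_absorb2)
    have "(\<Sum>k<n. min (v k) b - min (u k) b) \<le> (\<Sum>k<n. v k - u k)"
      by (intro sum_mono; use interval_family_bounds(2)[OF f] in \<open>fastforce simp: min_def\<close>)
    then have "(\<Sum>k<n. min (v k) b - min (u k) b) < d1" using len by linarith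
    then have "family_variation \<gamma>1 n (\<lambda>k. min (u k) b) (\<lambda>k. min (v k) b) < e / 2"
      by (rule d1(2)[OF fmin])
    moreover have "(\<Sum>k<n. max (v k) b - max (u k) b) \<le> (\<Sum>k<n. v k - u k)"
      by (intro sum_mono; use interval_family_bounds(2)[OF f] in \<open>fastforce simp: max_def\<close>)
    then have "(\<Sum>k<n. max (v k) b - max (u k) b) < d2" using len by linarith
    then have "family_variation \<gamma>2 n (\<lambda>k. max (u k) b) (\<lambda>k. max (v k) b) < e / 2"
      by (rule d2(2)[OF fmax])
    moreover have "family_variation ?\<gamma> n (\<lambda>k. min (u k) b) (\<lambda>k. min (v k) b)
        = family_variation \<gamma>1 n (\<lambda>k. min (u k) b) (\<lambda>k. min (v k) b)"
      by (simp add: family_variation_def)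
    moreover have "?\<gamma> (max t b) = \<gamma>2 (max t b)" for t using eq by (auto simp: max_def)
    then have "family_variation ?\<gamma> n (\<lambda>k. max (u k) b) (\<lambda>k. max (v k) b)
        = family_variation \<gamma>2 n (\<lambda>k. max (u k) b) (\<lambda>k. max (v k) b)"
      unfolding family_variation_def by simp
    ultimately show ?thesis using family_variation_split[of ?\<gamma> n u v b] by linarith
  qed
  then show "\<exists>d>0. \<forall>n u v. interval_family a c n u v \<longrightarrow> (\<Sum>k<n. v k - u k) < d \<longrightarrow> family_variation ?\<gamma> n u v < e"
    using d1(1) d2(1) by (intro exI[of _ "min d1 d2"]) simp
qed

lemma action_on_split:
  fixes \<gamma> :: "real \<Rightarrow> ('e::euclidean_space, 'n::{finite,linorder}) vec"
  assumes ac: "abs_continuous a c \<gamma>" and "a \<le> b" "b \<le> c"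
  shows "action_on m h \<gamma> {a<..<c} = action_on m h \<gamma> {a<..<b} + action_on m h \<gamma> {b<..<c}"
proof -
  have "AE t in lebesgue. t \<notin> {b}" by (intro AE_lebesgue_not_in_negligible) simp
  then have "action_on m h \<gamma> {a<..<c} = (\<integral>\<^sup>+ t. action_density m h \<gamma> t * indicator {a<..<b} t
      + action_density m h \<gamma> t * indicator {b<..<c} t \<partial>lebesgue)"
    unfolding action_on_def using \<open>a \<le> b\<close> \<open>b \<le> c\<close>
    by (intro nn_integral_cong_AE) (auto elim!: eventually_mono split: split_indicator)
  also have "\<dots> = action_on m h \<gamma> {a<..<b} + action_on m h \<gamma> {b<..<c}"
    unfolding action_on_def using absolutely_continuous_subinterval[OF ac] \<open>a \<le> b\<close> \<open>b \<le> c\<close>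
    by (intro nn_integral_add borel_measurable_action_density) auto
  finally show ?thesis .
qed

section \<open>The action potential as a metric\<close>

lemma jm_dist_le_action:
  assumes "a < b" "abs_continuous a b \<gamma>"
  shows "jm_dist m h (\<gamma> a) (\<gamma> b) \<le> action_on m h \<gamma> {a<..<b}"
proof -
  have "action_on m h \<gamma> {a<..<b} = lagrangian_action m h a b \<gamma>"
    using lagrangian_action_eq[OF assms(2)] by simp
  then show ?thesis
    unfolding jacobi_maupertuis_dist_def using assms by (intro Inf_lower) blast
qed

lemma jm_dist_less_curve:
  assumes "jm_dist m h x y < r"
  obtains a b \<gamma> where "a < b" "abs_continuous a b \<gamma>" "\<gamma> a = x" "\<gamma> b = y"
    "action_on m h \<gamma> {a<..<b} < r"
proof -
  obtain A where "A \<in> {lagrangian_action m h a b \<gamma> | a b \<gamma>.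
            a < b \<and> abs_continuous a b \<gamma> \<and> \<gamma> a = x \<and> \<gamma> b = y}" "A < r"
    using assms unfolding jacobi_maupertuis_dist_def Inf_less_iff by blast
  then obtain a b \<gamma> where *: "A = lagrangian_action m h a b \<gamma>" "a < b"
      "abs_continuous a b \<gamma>" "\<gamma> a = x" "\<gamma> b = y" by blast
  with \<open>A < r\<close> show thesis
    by (intro that[of a b \<gamma>]) (simp_all add: lagrangian_action_eq)
qed

lemma le_jm_dist:
  assumes "\<And>a b \<gamma>. a < b \<Longrightarrow> abs_continuous a b \<gamma> \<Longrightarrow> \<gamma> a = x \<Longrightarrow> \<gamma> b = y
    \<Longrightarrow> r \<le> action_on m h \<gamma> {a<..<b}"
  shows "r \<le> jm_dist m h x y"
proof (rule ccontr)
  assume "\<not> r \<le> jm_dist m h x y"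
  then have "jm_dist m h x y < r" by simp
  then obtain a b \<gamma> where "a < b" "abs_continuous a b \<gamma>" "\<gamma> a = x" "\<gamma> b = y"
    "action_on m h \<gamma> {a<..<b} < r" by (rule jm_dist_less_curve)
  with assms[of a b \<gamma>] show False by simp
qed

lemma jm_dist_lower_bound:
  assumes "\<And>i. m i > 0" "h > 0"
  shows "ennreal (sqrt (2 * h) * norm (mass_scaling m (y - x))) \<le> jm_dist m h x y"
proof (rule le_jm_dist)
  fix a b :: real and \<gamma> assume *: "a < b" "abs_continuous a b \<gamma>" "\<gamma> a = x" "\<gamma> b = y"
  show "ennreal (sqrt (2 * h) * norm (mass_scaling m (y - x))) \<le> action_on m h \<gamma> {a<..<b}"
    using action_on_lower_bound[OF *(2) less_imp_le[OF *(1)] assms] *(3,4) by simp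
qed

lemma jm_dist_sym_le: "jm_dist m h y x \<le> jm_dist m h x y"
proof (rule le_jm_dist)
  fix a b :: real and \<gamma> assume *: "a < b" "abs_continuous a b \<gamma>" "\<gamma> a = x" "\<gamma> b = y"
  let ?\<gamma> = "\<lambda>t. \<gamma> (0 + (-1) * t)"
  have "abs_continuous (-b) (-a) ?\<gamma>"
    by (rule absolutely_continuous_affine[OF _ *(2)]) auto
  then have "jm_dist m h (?\<gamma> (-b)) (?\<gamma> (-a)) \<le> action_on m h ?\<gamma> {-b<..<-a}"
    using *(1) by (intro jm_dist_le_action) auto
  also have "\<dots> = action_on m h \<gamma> {a<..<b}"
    by (rule action_on_affine[OF _ *(2)]) auto
  finally show "jm_dist m h y x \<le> action_on m h \<gamma> {a<..<b}" using *(3,4) by simp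
qed

lemma jm_dist_sym: "jm_dist m h y x = jm_dist m h x y"
  by (intro antisym jm_dist_sym_le)

lemma jm_dist_triangle:
  "jm_dist m h x z \<le> jm_dist m h x y + jm_dist m h y z"
proof (rule ennreal_le_epsilon)
  fix e :: real assume "jm_dist m h x y + jm_dist m h y z < top" and "0 < e"
  then have "jm_dist m h x y \<noteq> top" "jm_dist m h y z \<noteq> top"
    by (auto simp: less_top)
  moreover have lt: "s < s + ennreal (e / 2)" if "s \<noteq> top" for s
    using that \<open>0 < e\<close> by (cases s) (auto simp: ennreal_plus[symmetric] ennreal_less_iff simp del: ennreal_plus)
  ultimately have lt1: "jm_dist m h x y < jm_dist m h x y + ennreal (e / 2)"
    and lt2: "jm_dist m h y z < jm_dist m h y z + ennreal (e / 2)" by blast+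
  obtain a b \<gamma>1 where 1: "a < b" "abs_continuous a b \<gamma>1" "\<gamma>1 a = x" "\<gamma>1 b = y"
    "action_on m h \<gamma>1 {a<..<b} < jm_dist m h x y + ennreal (e / 2)"
    using lt1 by (rule jm_dist_less_curve)
  obtain b' c' \<gamma>2 where 2: "b' < c'" "abs_continuous b' c' \<gamma>2" "\<gamma>2 b' = y" "\<gamma>2 c' = z"
    "action_on m h \<gamma>2 {b'<..<c'} < jm_dist m h y z + ennreal (e / 2)"
    using lt2 by (rule jm_dist_less_curve)
  define c where "c = b + (c' - b')"
  let ?\<gamma>2 = "\<lambda>t. \<gamma>2 ((b' - b) + 1 * t)"
  have c: "b < c" using 2(1) by (simp add: c_def)
  have ac2: "abs_continuous b c ?\<gamma>2"
    by (rule absolutely_continuous_affine[OF _ 2(2)]) (auto simp: c_def)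
  define \<gamma> where "\<gamma> t = (if t \<le> b then \<gamma>1 t else ?\<gamma>2 t)" for t
  have ac: "abs_continuous a c \<gamma>"
    unfolding \<gamma>_def using 1 2 c by (intro absolutely_continuous_join ac2) auto
  have "\<gamma> a = x" "\<gamma> c = z" using 1 2 c by (auto simp: \<gamma>_def c_def)
  then have "jm_dist m h x z \<le> action_on m h \<gamma> {a<..<c}"
    using jm_dist_le_action[OF _ ac, of m h] 1(1) c by simp
  also have "\<dots> = action_on m h \<gamma> {a<..<b} + action_on m h \<gamma> {b<..<c}"
    using 1(1) c by (intro action_on_split[OF ac]) auto
  also have "action_on m h \<gamma> {a<..<b} = action_on m h \<gamma>1 {a<..<b}"
    by (rule action_on_cong) (auto simp: \<gamma>_def)
  also have "action_on m h \<gamma> {b<..<c} = action_on m h ?\<gamma>2 {b<..<c}"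
    by (rule action_on_cong) (auto simp: \<gamma>_def)
  also have "\<dots> = action_on m h \<gamma>2 {b'<..<c'}"
    by (rule action_on_affine[OF _ 2(2)]) (auto simp: c_def)
  also have "action_on m h \<gamma>1 {a<..<b} + action_on m h \<gamma>2 {b'<..<c'}
      \<le> (jm_dist m h x y + ennreal (e / 2)) + (jm_dist m h y z + ennreal (e / 2))"
    using 1(5) 2(5) by (intro add_mono) auto
  also have "\<dots> = jm_dist m h x y + jm_dist m h y z + (ennreal (e / 2) + ennreal (e / 2))"
    by (simp add: ac_simps)
  also have "ennreal (e / 2) + ennreal (e / 2) = ennreal e"
    using \<open>0 < e\<close> by (simp add: ennreal_plus[symmetric] del: ennreal_plus)
  finally show "jm_dist m h x z
      \<le> jm_dist m h x y + jm_dist m h y z + ennreal e" .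
qed

text \<open>
  Upper bounds for the action potential are all obtained from explicit curves whose Lagrangian is dominated
  by an elementary function with antiderivative \<open>W\<close>. Differentiability in the open interval and continuity at
  the endpoints suffice, which admits curves starting at a collision.
\<close>

lemma jm_dist_le_integral:
  fixes \<gamma> :: "real \<Rightarrow> ('e::euclidean_space, 'n::{finite,linorder}) vec"
  assumes "a < b" "abs_continuous a b \<gamma>" "0 \<le> h"
    and der: "\<And>t. a < t \<Longrightarrow> t < b \<Longrightarrow> (\<gamma> has_vector_derivative g t) (at t)"
    and kin: "\<And>t. a < t \<Longrightarrow> t < b \<Longrightarrow> 1/2 * (mass_norm m (g t))\<^sup>2 \<le> k t"
    and pot: "\<And>t. a < t \<Longrightarrow> t < b \<Longrightarrow> newton_potential m (\<gamma> t) \<le> ennreal (w t)"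
      "\<And>t. a < t \<Longrightarrow> t < b \<Longrightarrow> 0 \<le> w t"
    and W: "continuous_on {a..b} W"
      "\<And>t. a < t \<Longrightarrow> t < b \<Longrightarrow> (W has_vector_derivative (k t + w t + h)) (at t)"
  shows "jm_dist m h (\<gamma> a) (\<gamma> b) \<le> ennreal (W b - W a)"
proof -
  define F where "F t = (if a < t \<and> t < b then k t + w t + h else 0)" for t
  have k: "0 \<le> k t" if "a < t" "t < b" for t
    using kin[OF that] by (rule order_trans[rotated]) simp
  have F: "0 \<le> F t" for t using k pot(2) \<open>0 \<le> h\<close> by (auto simp: F_def)
  have int: "(F has_integral (W b - W a)) {a..b}"
    using \<open>a < b\<close> W by (intro fundamental_theorem_of_calculus_interior) (auto simp: F_def)
  have "jm_dist m h (\<gamma> a) (\<gamma> b) \<le> action_on m h \<gamma> {a<..<b}"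
    by (rule jm_dist_le_action[OF assms(1,2)])
  also have "\<dots> \<le> (\<integral>\<^sup>+ t. ennreal (F t) * indicator {a..b} t \<partial>lebesgue)"
    unfolding action_on_def
  proof (rule nn_integral_mono)
    fix t
    show "action_density m h \<gamma> t * indicator {a<..<b} t \<le> ennreal (F t) * indicator {a..b} t"
    proof (cases "a < t \<and> t < b")
      case True
      then have t: "a < t" "t < b" by auto
      have "action_density m h \<gamma> t = ennreal (1/2 * (mass_norm m (g t))\<^sup>2) + newton_potential m (\<gamma> t) + ennreal h"
        using der[OF t] vector_derivative_at[OF der[OF t]] differentiableI_vector[OF der[OF t]]
        by (simp add: action_density_def)
      also have "\<dots> \<le> ennreal (k t) + ennreal (w t) + ennreal h"
        using kin[OF t] pot(1)[OF t] by (intro add_mono ennreal_leI) auto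
      also have "\<dots> = ennreal (F t)"
        using t k[OF t] pot(2)[OF t] \<open>0 \<le> h\<close> by (simp add: F_def ennreal_plus)
      finally show ?thesis using t by simp
    qed simp
  qed
  also have "\<dots> = (\<integral>\<^sup>+ t. ennreal (F t) * indicator {a..b} t \<partial>lborel)"
    by (rule nn_integral_completion)
  also have "\<dots> = ennreal (W b - W a)"
    using F by (intro nn_integral_has_integral_lebesgue' int) auto
  finally show ?thesis .
qed

text \<open>
  The bound holds for every curve with square integrable derivative, by the Cauchy-Schwarz inequality, with
  \<open>G\<close> the integral of the squared speed; it implies absolute continuity by the inequality of arithmetic and geometric means.
\<close>

lemma absolutely_continuous_if_energy_bound:
  fixes \<gamma> :: "real \<Rightarrow> 'v::real_normed_vector" and G :: "real \<Rightarrow> real"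
  assumes mono: "\<And>u v. a \<le> u \<Longrightarrow> u \<le> v \<Longrightarrow> v \<le> b \<Longrightarrow> G u \<le> G v" and "a \<le> b"
    and bound: "\<And>u v. a \<le> u \<Longrightarrow> u \<le> v \<Longrightarrow> v \<le> b \<Longrightarrow> (norm (\<gamma> v - \<gamma> u))\<^sup>2 \<le> (v - u) * (G v - G u)"
  shows "abs_continuous a b \<gamma>"
  unfolding abs_continuous_iff
proof (intro allI impI)
  fix e :: real assume "e > 0"
  define E where "E = G b - G a + 1"
  have "E > 0" using mono[of a b] \<open>a \<le> b\<close> by (simp add: E_def)
  \<comment> \<open>The weight of the mean, chosen so that the total increment of \<open>G\<close> contributes at most \<open>e / 2\<close>.\<close>
  define \<eta> where "\<eta> = e / E"
  have "\<eta> > 0" using \<open>e > 0\<close> \<open>E > 0\<close> by (simp add: \<eta>_def)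
  have "family_variation \<gamma> n u v < e"
    if f: "interval_family a b n u v" and len: "(\<Sum>k<n. v k - u k) < \<eta> * e" for n u v
  proof -
    have bnd: "a \<le> u k" "u k \<le> v k" "v k \<le> b" if "k < n" for k
      using interval_family_bounds[OF f that] by auto
    have "norm (\<gamma> (v k) - \<gamma> (u k)) \<le> 1/2 * ((v k - u k) / \<eta> + \<eta> * (G (v k) - G (u k)))" if "k < n" for k
    proof -
      define A where "A = (v k - u k) / \<eta>"
      define B where "B = \<eta> * (G (v k) - G (u k))"
      have AB: "0 \<le> A" "0 \<le> B" using bnd[OF that] mono \<open>\<eta> > 0\<close> by (auto simp: A_def B_def)
      have "(norm (\<gamma> (v k) - \<gamma> (u k)))\<^sup>2 \<le> A * B"
        using bound[OF bnd[OF that]] \<open>\<eta> > 0\<close> by (simp add: A_def B_def)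
      also have "\<dots> \<le> (1/2 * (A + B))\<^sup>2"
        using zero_le_power2[of "A - B"] by (simp add: power2_eq_square algebra_simps)
      finally have "norm (\<gamma> (v k) - \<gamma> (u k)) \<le> 1/2 * (A + B)"
        by (rule power2_le_imp_le) (use AB in simp)
      then show ?thesis by (simp only: A_def B_def)
    qed
    then have "family_variation \<gamma> n u v \<le> (\<Sum>k<n. 1/2 * ((v k - u k) / \<eta> + \<eta> * (G (v k) - G (u k))))"
      unfolding family_variation_def by (intro sum_mono) auto
    also have "\<dots> = 1/2 * ((\<Sum>k<n. v k - u k) / \<eta> + \<eta> * (\<Sum>k<n. G (v k) - G (u k)))"
      by (simp only: sum_distrib_left[symmetric] sum.distrib sum_divide_distrib[symmetric])
    also have "(\<Sum>k<n. G (v k) - G (u k)) \<le> G b - G a"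
    proof (rule interval_family_length)
      have "{G (u k)<..<G (v k)} \<inter> {G (u l)<..<G (v l)} = {}" if kl: "k < n" "l < n" "k \<noteq> l" for k l
      proof (cases "u k < v k \<and> u l < v l")
        case True
        have "{u k<..<v k} \<inter> {u l<..<v l} = {}"
          using f kl by (auto simp: interval_family_def disjoint_family_on_def)
        then have "v k \<le> u l \<or> v l \<le> u k"
          using True by (auto simp: Int_greaterThanLessThan greaterThanLessThan_empty_iff)
        then have "G (v k) \<le> G (u l) \<or> G (v l) \<le> G (u k)"
          using mono[of "v k" "u l"] mono[of "v l" "u k"] bnd[OF kl(1)] bnd[OF kl(2)] by linarith
        then show ?thesis by auto
      next
        case False
        then have "u k = v k \<or> u l = v l" using bnd(2)[OF kl(1)] bnd(2)[OF kl(2)] by linarith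
        then show ?thesis by auto
      qed
      moreover have "G a \<le> G (u k) \<and> G (u k) \<le> G (v k) \<and> G (v k) \<le> G b" if "k < n" for k
        using bnd[OF that] mono[of a "u k"] mono[of "u k" "v k"] mono[of "v k" b] by linarith
      ultimately show "interval_family (G a) (G b) n (\<lambda>k. G (u k)) (\<lambda>k. G (v k))"
        by (simp add: interval_family_def disjoint_family_on_def)
      show "G a \<le> G b" using mono \<open>a \<le> b\<close> by simp
    qed
    also have "(\<Sum>k<n. v k - u k) / \<eta> < e" using len \<open>\<eta> > 0\<close> by (simp add: field_simps)
    also have "\<eta> * (G b - G a) \<le> e"
      using \<open>e > 0\<close> \<open>E > 0\<close> by (simp add: \<eta>_def E_def field_simps)
    finally show ?thesis using \<open>\<eta> > 0\<close> by simp
  qed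
  then show "\<exists>d>0. \<forall>n u v. interval_family a b n u v \<longrightarrow> (\<Sum>k<n. v k - u k) < d \<longrightarrow> family_variation \<gamma> n u v < e"
    using \<open>e > 0\<close> \<open>\<eta> > 0\<close> by (intro exI[of _ "\<eta> * e"]) simp
qed

definition mass_pairs :: "('n::{finite,linorder} \<Rightarrow> real) \<Rightarrow> real" where
  "mass_pairs m = (\<Sum>(i, j) \<in> {(i, j). i < j}. m i * m j)"

lemma mass_pairs_nonneg:
  assumes "\<And>i. m i > 0"
  shows "0 \<le> mass_pairs m"
  unfolding mass_pairs_def split_beta
  by (intro sum_nonneg mult_nonneg_nonneg less_imp_le[OF assms])

lemma newton_potential_le:
  assumes m: "\<And>i. m i > 0" and "0 < q" and sep: "\<And>i j. i < j \<Longrightarrow> q \<le> norm (x $ i - x $ j)"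
  shows "newton_potential m x \<le> ennreal (mass_pairs m / q)"
proof -
  have "newton_potential m x \<le> (\<Sum>(i, j) \<in> {(i, j). i < j}. ennreal (m i * m j / q))"
    unfolding newton_potential_def
  proof (rule sum_mono, clarify)
    fix i j :: 'a assume "i < j"
    have mm: "0 < m i * m j" using m by simp
    have n: "0 < norm (x $ i - x $ j)" using sep[OF \<open>i < j\<close>] \<open>0 < q\<close> by linarith
    have "ennreal (m i * m j) / ennreal (norm (x $ i - x $ j)) = ennreal (m i * m j / norm (x $ i - x $ j))"
      using mm n by (intro divide_ennreal) auto
    also have "\<dots> \<le> ennreal (m i * m j / q)"
      using mm n sep[OF \<open>i < j\<close>] \<open>0 < q\<close> by (intro ennreal_leI divide_left_mono) auto
    finally show "ennreal (m i * m j) / ennreal (norm (x $ i - x $ j)) \<le> ennreal (m i * m j / q)" .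
  qed
  also have "\<dots> = ennreal (\<Sum>(i, j) \<in> {(i, j). i < j}. m i * m j / q)"
    using m \<open>0 < q\<close> unfolding split_beta by (intro sum_ennreal) (simp add: less_imp_le)
  also have "(\<Sum>(i, j) \<in> {(i, j). i < j}. m i * m j / q) = mass_pairs m / q"
    by (simp add: mass_pairs_def sum_divide_distrib split_beta)
  finally show ?thesis .
qed

text \<open>
  The duration \<open>\<tau>\<close> is left free: it is optimised against the potential in the applications. The antiderivative
  \<open>W\<close> refers to the parameter \<open>\<theta> = t / \<tau>\<close>.
\<close>

lemma jm_dist_segment:
  fixes x y :: "('e::euclidean_space, 'n::{finite,linorder}) vec"
  assumes "0 \<le> h" "0 < \<tau>"
    and pot: "\<And>\<theta>. 0 < \<theta> \<Longrightarrow> \<theta> < 1 \<Longrightarrow> newton_potential m (x + \<theta> *\<^sub>R (y - x)) \<le> ennreal (w \<theta>)"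
      "\<And>\<theta>. 0 < \<theta> \<Longrightarrow> \<theta> < 1 \<Longrightarrow> 0 \<le> w \<theta>"
    and W: "continuous_on {0..1} W" "\<And>\<theta>. 0 < \<theta> \<Longrightarrow> \<theta> < 1 \<Longrightarrow> (W has_real_derivative w \<theta>) (at \<theta>)"
  shows "jm_dist m h x y
    \<le> ennreal (1/2 * (mass_norm m (y - x))\<^sup>2 / \<tau> + h * \<tau> + \<tau> * (W 1 - W 0))"
proof -
  let ?\<gamma> = "\<lambda>t. x + (t / \<tau>) *\<^sub>R (y - x)"
  define g where "g = (1 / \<tau>) *\<^sub>R (y - x)"
  define V where "V t = 1/2 * (mass_norm m g)\<^sup>2 * t + \<tau> * W (t / \<tau>) + h * t" for t
  have "abs_continuous 0 \<tau> ?\<gamma>"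
  proof (rule absolutely_continuous_if_energy_bound)
    fix u v :: real assume "u \<le> v"
    then show "(norm g)\<^sup>2 * u \<le> (norm g)\<^sup>2 * v" by (intro mult_left_mono) auto
    have eq: "?\<gamma> v - ?\<gamma> u = (v - u) *\<^sub>R g" by (simp add: g_def algebra_simps diff_divide_distrib)
    have "(norm (?\<gamma> v - ?\<gamma> u))\<^sup>2 = (v - u)\<^sup>2 * (norm g)\<^sup>2"
      unfolding eq by (simp add: power_mult_distrib)
    then show "(norm (?\<gamma> v - ?\<gamma> u))\<^sup>2 \<le> (v - u) * ((norm g)\<^sup>2 * v - (norm g)\<^sup>2 * u)"
      by (simp add: power2_eq_square[of "v - u"] algebra_simps)
  qed (use \<open>0 < \<tau>\<close> in auto)
  then have "jm_dist m h (?\<gamma> 0) (?\<gamma> \<tau>) \<le> ennreal (V \<tau> - V 0)"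
  proof (rule jm_dist_le_integral[OF \<open>0 < \<tau>\<close> _ \<open>0 \<le> h\<close>])
    fix t assume t: "0 < t" "t < \<tau>"
    then have \<theta>: "0 < t / \<tau>" "t / \<tau> < 1" by auto
    show "(?\<gamma> has_vector_derivative g) (at t)"
      unfolding g_def by (auto intro!: derivative_eq_intros simp: divide_inverse)
    show "newton_potential m (?\<gamma> t) \<le> ennreal (w (t / \<tau>))" "0 \<le> w (t / \<tau>)"
      using pot \<theta> by auto
    have "((\<lambda>t. W (t / \<tau>)) has_real_derivative w (t / \<tau>) * (1 / \<tau>)) (at t)"
      by (rule DERIV_chain2[where g = "\<lambda>t. t / \<tau>", OF W(2)[OF \<theta>]])
        (use \<open>0 < \<tau>\<close> in \<open>auto intro!: derivative_eq_intros\<close>)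
    then have "(V has_real_derivative 1/2 * (mass_norm m g)\<^sup>2 + w (t / \<tau>) + h) (at t)"
      unfolding V_def using \<open>0 < \<tau>\<close> by (auto intro!: derivative_eq_intros)
    then show "(V has_vector_derivative 1/2 * (mass_norm m g)\<^sup>2 + w (t / \<tau>) + h) (at t)"
      by (simp add: has_real_derivative_iff_has_vector_derivative)
  next
    show "continuous_on {0..\<tau>} V"
      unfolding V_def using \<open>0 < \<tau>\<close>
      by (intro continuous_intros continuous_on_compose2[OF W(1)]) auto
  qed simp
  moreover have "V \<tau> - V 0 = 1/2 * (mass_norm m (y - x))\<^sup>2 / \<tau> + h * \<tau> + \<tau> * (W 1 - W 0)"
  proof -
    have "(mass_norm m g)\<^sup>2 * \<tau> = (mass_norm m (y - x))\<^sup>2 / \<tau>"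
      using \<open>0 < \<tau>\<close> unfolding g_def mass_norm_scaleR
      by (simp add: power_divide power2_eq_square)
    then show ?thesis using \<open>0 < \<tau>\<close> by (simp add: V_def algebra_simps)
  qed
  ultimately show ?thesis using \<open>0 < \<tau>\<close> by simp
qed

text \<open>
  The curve \<open>x + t powr (2/3) * b\<close>, the profile of a parabolic ejection: the squared speed and, under the
  separation hypothesis, the potential are both bounded by multiples of \<open>t powr (-2/3)\<close>, whose integral up to
  \<open>t = r ^ 3\<close> is \<open>3 * r\<close>. It may start at any collision.
\<close>

lemma jm_dist_cube_root_curve:
  fixes x b :: "('e::euclidean_space, 'n::{finite,linorder}) vec"
  assumes m: "\<And>i. m i > 0" and "0 \<le> h" "0 < r"
    and sep: "\<And>q i j. 0 < q \<Longrightarrow> i < j \<Longrightarrow> q \<le> norm ((x + q *\<^sub>R b) $ i - (x + q *\<^sub>R b) $ j)"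
  shows "jm_dist m h x (x + r\<^sup>2 *\<^sub>R b)
    \<le> ennreal ((2/3 * (mass_norm m b)\<^sup>2 + 3 * mass_pairs m) * r + h * r ^ 3)"
proof -
  let ?\<gamma> = "\<lambda>t. x + (root 3 t)\<^sup>2 *\<^sub>R b"
  define c where "c = 2/9 * (mass_norm m b)\<^sup>2 + mass_pairs m"
  define V where "V t = 3 * c * root 3 t + h * t" for t
  have root_pow: "root 3 t ^ 3 = t" if "0 \<le> t" for t using that by (intro real_root_pow_pos2) auto
  have ac: "abs_continuous 0 (r ^ 3) ?\<gamma>"
  proof (rule absolutely_continuous_if_energy_bound)
    fix u v :: real assume uv: "0 \<le> u" "u \<le> v"
    define A B where "A = root 3 u" and "B = root 3 v"
    have AB: "0 \<le> A" "A \<le> B" "u = A ^ 3" "v = B ^ 3"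
      using uv root_pow by (auto simp: A_def B_def)
    show "4/3 * (norm b)\<^sup>2 * root 3 u \<le> 4/3 * (norm b)\<^sup>2 * root 3 v"
      using uv by (intro mult_left_mono) auto
    \<comment> \<open>The energy bound for the profile, written in \<open>A\<close> and \<open>B\<close>; the antiderivative of the squared
      speed of \<open>t powr (2/3)\<close> is \<open>4/3 * t powr (1/3)\<close>.\<close>
    have "(B + A)\<^sup>2 \<le> 4/3 * (A\<^sup>2 + A * B + B\<^sup>2)"
    proof -
      have "4 * (A\<^sup>2 + A * B + B\<^sup>2) - 3 * (B + A)\<^sup>2 = (A - B)\<^sup>2"
        by (simp add: power2_eq_square algebra_simps)
      then show ?thesis using zero_le_power2[of "A - B"] by linarith
    qed
    then have "(B - A)\<^sup>2 * (B + A)\<^sup>2 \<le> (B - A)\<^sup>2 * (4/3 * (A\<^sup>2 + A * B + B\<^sup>2))"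
      by (intro mult_left_mono) auto
    also have "\<dots> = 4/3 * ((B - A)\<^sup>2 * (A\<^sup>2 + A * B + B\<^sup>2))" by simp
    also have "(B - A)\<^sup>2 * (A\<^sup>2 + A * B + B\<^sup>2) = (B ^ 3 - A ^ 3) * (B - A)"
      by (simp add: power2_eq_square power3_eq_cube algebra_simps)
    finally have "(B\<^sup>2 - A\<^sup>2)\<^sup>2 \<le> 4/3 * ((B ^ 3 - A ^ 3) * (B - A))"
      by (simp add: power2_eq_square algebra_simps)
    then have main: "(norm b)\<^sup>2 * (B\<^sup>2 - A\<^sup>2)\<^sup>2 \<le> (norm b)\<^sup>2 * (4/3 * ((B ^ 3 - A ^ 3) * (B - A)))"
      by (intro mult_left_mono) auto
    have eq: "?\<gamma> v - ?\<gamma> u = (B\<^sup>2 - A\<^sup>2) *\<^sub>R b" by (simp add: A_def B_def algebra_simps)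
    have lhs: "(norm (?\<gamma> v - ?\<gamma> u))\<^sup>2 = (norm b)\<^sup>2 * (B\<^sup>2 - A\<^sup>2)\<^sup>2"
      unfolding eq by (simp add: power_mult_distrib)
    have "v - u = B ^ 3 - A ^ 3" using AB(3,4) by simp
    moreover have "4/3 * (norm b)\<^sup>2 * root 3 v - 4/3 * (norm b)\<^sup>2 * root 3 u = 4/3 * (norm b)\<^sup>2 * (B - A)"
      by (simp add: A_def B_def algebra_simps)
    ultimately have rhs: "(v - u) * (4/3 * (norm b)\<^sup>2 * root 3 v - 4/3 * (norm b)\<^sup>2 * root 3 u)
        = (norm b)\<^sup>2 * (4/3 * ((B ^ 3 - A ^ 3) * (B - A)))"
      by (simp only:) simp
    show "(norm (?\<gamma> v - ?\<gamma> u))\<^sup>2 \<le> (v - u) * (4/3 * (norm b)\<^sup>2 * root 3 v - 4/3 * (norm b)\<^sup>2 * root 3 u)"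
      unfolding lhs rhs by (rule main)
  qed (use \<open>0 < r\<close> in auto)
  have "jm_dist m h (?\<gamma> 0) (?\<gamma> (r ^ 3)) \<le> ennreal (V (r ^ 3) - V 0)"
  proof (rule jm_dist_le_integral[OF _ ac \<open>0 \<le> h\<close>])
    fix t :: real assume t: "0 < t" "t < r ^ 3"
    define A where "A = root 3 t"
    have A: "0 < A" using t by (simp add: A_def)
    have dA: "(root 3 has_real_derivative inverse (3 * A\<^sup>2)) (at t)"
      using DERIV_real_root[of 3 t] t by (simp add: A_def)
    have "((\<lambda>t. (root 3 t)\<^sup>2) has_real_derivative 2 * A * inverse (3 * A\<^sup>2)) (at t)"
      using DERIV_power[OF dA, of 2] by (simp add: A_def ac_simps)
    also have "2 * A * inverse (3 * A\<^sup>2) = 2 / (3 * A)"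
      using A by (simp add: field_simps power2_eq_square)
    finally have dA2: "((\<lambda>t. (root 3 t)\<^sup>2) has_real_derivative 2 / (3 * A)) (at t)" .
    have "(?\<gamma> has_vector_derivative 0 + ((root 3 t)\<^sup>2 *\<^sub>R 0 + (2 / (3 * A)) *\<^sub>R b)) (at t)"
      by (intro has_vector_derivative_add has_vector_derivative_scaleR dA2 has_vector_derivative_const)
    then show "(?\<gamma> has_vector_derivative (2 / (3 * root 3 t)) *\<^sub>R b) (at t)"
      by (simp add: A_def)
    have "newton_potential m (?\<gamma> t) \<le> ennreal (mass_pairs m / A\<^sup>2)"
      unfolding A_def[symmetric] using A by (intro newton_potential_le[where m = m, OF m] sep) auto
    then show "newton_potential m (?\<gamma> t) \<le> ennreal (mass_pairs m / (root 3 t)\<^sup>2)" by (simp add: A_def)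
    show "0 \<le> mass_pairs m / (root 3 t)\<^sup>2" using mass_pairs_nonneg[of m] m by simp
    show "1/2 * (mass_norm m ((2 / (3 * root 3 t)) *\<^sub>R b))\<^sup>2 \<le> 2/9 * (mass_norm m b)\<^sup>2 / (root 3 t)\<^sup>2"
      by (simp add: mass_norm_scaleR power_mult_distrib power_divide)
    have "(V has_real_derivative 3 * c * inverse (3 * A\<^sup>2) + h * 1) (at t)"
      unfolding V_def by (intro DERIV_add DERIV_cmult dA DERIV_ident)
    moreover have "3 * c * inverse (3 * A\<^sup>2) + h * 1 = 2/9 * (mass_norm m b)\<^sup>2 / (root 3 t)\<^sup>2 + mass_pairs m / (root 3 t)\<^sup>2 + h"
      using A by (simp add: c_def A_def[symmetric] field_simps)
    ultimately show "(V has_vector_derivative 2/9 * (mass_norm m b)\<^sup>2 / (root 3 t)\<^sup>2 + mass_pairs m / (root 3 t)\<^sup>2 + h) (at t)"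
      by (simp add: has_real_derivative_iff_has_vector_derivative)
  next
    show "continuous_on {0..r ^ 3} V"
      unfolding V_def by (intro continuous_intros)
  qed (use \<open>0 < r\<close> in auto)
  moreover have "root 3 (r ^ 3) = r" using \<open>0 < r\<close> by (intro real_root_power_cancel) auto
  moreover from this have "V (r ^ 3) - V 0 = (2/3 * (mass_norm m b)\<^sup>2 + 3 * mass_pairs m) * r + h * r ^ 3"
    by (simp add: V_def c_def algebra_simps)
  ultimately show ?thesis by simp
qed

section \<open>Finiteness and continuity of the action potential\<close>

text \<open>
  Sort the bodies lexicographically by \<open>\<xi>\<close>, then by \<open>\<eta>\<close>, then by their index; the rank of a body is the number of
  its predecessors. When \<open>\<eta>\<close> is a small perturbation of \<open>\<xi>\<close>, it can only break ties of \<open>\<xi>\<close>, and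
  the ranking is compatible with both.
\<close>

lemma simultaneous_ranking:
  fixes \<xi> \<eta> :: "'n::{finite,linorder} \<Rightarrow> real"
  assumes compat: "\<And>i j. \<xi> i < \<xi> j \<Longrightarrow> \<eta> i \<le> \<eta> j"
  obtains r :: "'n \<Rightarrow> nat" where "inj r" "\<And>i. r i \<le> CARD('n)"
    "\<And>i j. r i < r j \<Longrightarrow> \<xi> i \<le> \<xi> j \<and> \<eta> i \<le> \<eta> j"
proof -
  define P where "P i j \<longleftrightarrow> \<xi> i < \<xi> j \<or> (\<xi> i = \<xi> j \<and> (\<eta> i < \<eta> j \<or> (\<eta> i = \<eta> j \<and> i < j)))" for i j
  define r where "r i = card {k. P k i}" for i
  have trans: "P i k" if "P i j" "P j k" for i j k using that unfolding P_def by auto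
  have irrefl: "\<not> P i i" for i unfolding P_def by auto
  have total: "P i j \<or> P j i" if "i \<noteq> j" for i j using that unfolding P_def by auto
  have less: "r i < r j" if "P i j" for i j
    unfolding r_def
  proof (rule psubset_card_mono)
    show "{k. P k i} \<subset> {k. P k j}" using trans[OF _ that] that irrefl by blast
  qed simp
  have P: "P i j" if "r i < r j" for i j
    using that less[of j i] total[of i j] by (cases "i = j") auto
  show thesis
  proof
    show "inj r"
    proof (rule injI, rule ccontr)
      fix i j assume "r i = r j" "i \<noteq> j"
      then show False using total[of i j] less[of i j] less[of j i] by auto
    qed
    show "r i \<le> CARD('n)" for i unfolding r_def by (rule card_mono) auto
    show "\<xi> i \<le> \<xi> j \<and> \<eta> i \<le> \<eta> j" if "r i < r j" for i j
      using P[OF that] compat[of i j] unfolding P_def by auto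
  qed
qed

text \<open>
  Moving the bodies along \<open>e\<close> with speeds increasing in the order of their \<open>e\<close>-coordinates never brings two
  of them closer in that coordinate, and the speeds of two bodies differ by at least \<open>1\<close>.
\<close>

lemma ranking_separates:
  fixes x :: "('e::euclidean_space, 'n::{finite,linorder}) vec"
  assumes "e \<in> Basis" "inj r" and ord: "\<And>i j. r i < r j \<Longrightarrow> x $ i \<bullet> e \<le> x $ j \<bullet> e"
    and "0 \<le> q" "i \<noteq> j"
  shows "q \<le> norm ((x + q *\<^sub>R (\<chi> i. real (r i) *\<^sub>R e)) $ i - (x + q *\<^sub>R (\<chi> i. real (r i) *\<^sub>R e)) $ j)"
proof -
  let ?d = "\<lambda>i j. (x + q *\<^sub>R (\<chi> i. real (r i) *\<^sub>R e)) $ i - (x + q *\<^sub>R (\<chi> i. real (r i) *\<^sub>R e)) $ j"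
  have *: "q \<le> norm (?d k l)" if "r l < r k" for k l
  proof -
    have "q * 1 \<le> q * (real (r k) - real (r l))"
      using that \<open>0 \<le> q\<close> by (intro mult_left_mono) auto
    then have "q \<le> (x $ k \<bullet> e - x $ l \<bullet> e) + q * (real (r k) - real (r l))"
      using ord[OF that] by simp
    also have "\<dots> = ?d k l \<bullet> e"
      using \<open>e \<in> Basis\<close> by (simp add: inner_diff_left inner_add_left algebra_simps)
    also have "\<dots> \<le> norm (?d k l)" using Basis_le_norm[OF \<open>e \<in> Basis\<close>] abs_le_D1 by blast
    finally show ?thesis .
  qed
  have "r i \<noteq> r j" using \<open>inj r\<close> \<open>i \<noteq> j\<close> by (auto dest: injD)
  then consider "r j < r i" | "r i < r j" by linarith
  then show ?thesis using *[of j i] *[of i j] by cases (auto simp: norm_minus_commute)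
qed

lemma eventually_order_preserved:
  fixes x :: "('e::euclidean_space, 'n::{finite,linorder}) vec"
  shows "\<forall>\<^sub>F y in nhds x. \<forall>i j. x $ i \<bullet> e < x $ j \<bullet> e \<longrightarrow> y $ i \<bullet> e \<le> y $ j \<bullet> e"
proof (intro eventually_all_finite)
  fix i j
  show "\<forall>\<^sub>F y in nhds x. x $ i \<bullet> e < x $ j \<bullet> e \<longrightarrow> y $ i \<bullet> e \<le> y $ j \<bullet> e"
  proof (cases "x $ i \<bullet> e < x $ j \<bullet> e")
    case True
    have "open {y. y $ i \<bullet> e < y $ j \<bullet> e}"
      by (intro open_Collect_less continuous_intros)
    then have "\<forall>\<^sub>F y in nhds x. y \<in> {y. y $ i \<bullet> e < y $ j \<bullet> e}"
      using True by (intro eventually_nhds_in_open) auto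
    then show ?thesis by eventually_elim auto
  qed simp
qed

text \<open>
  Go from \<open>x\<close> to \<open>x + \<rho>\<^sup>2 * b\<close> by pulling the bodies apart along \<open>e\<close>, then straight to \<open>y + \<rho>\<^sup>2 * b\<close>, then
  back to \<open>y\<close>. The common ranking makes the same \<open>b\<close> serve all three pieces, and all configurations of the
  middle piece keep mutual distances at least \<open>\<rho>\<^sup>2\<close>. Each piece lasts \<open>\<rho> ^ 3\<close>, by the homogeneity of
  the potential, so every term is of order \<open>\<rho>\<close> apart from the energy \<open>h\<close> times the duration.
\<close>

lemma jm_dist_le_small_scale:
  fixes x y :: "('e::euclidean_space, 'n::{finite,linorder}) vec"
  assumes m: "\<And>i. m i > 0" and "0 \<le> h" "0 < \<rho>" and e: "e \<in> Basis"
    and ord: "\<And>i j. x $ i \<bullet> e < x $ j \<bullet> e \<Longrightarrow> y $ i \<bullet> e \<le> y $ j \<bullet> e"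
    and near: "mass_norm m (y - x) \<le> \<rho>\<^sup>2"
  defines "M \<equiv> mass_pairs m" and "B \<equiv> (\<Sum>i\<in>UNIV. m i * (real CARD('n))\<^sup>2)"
  shows "jm_dist m h x y \<le> ennreal ((4/3 * B + 7 * M + 1/2) * \<rho> + 3 * h * \<rho> ^ 3)"
proof -
  obtain r :: "'n \<Rightarrow> nat" where r: "inj r" "\<And>i. r i \<le> CARD('n)"
    "\<And>i j. r i < r j \<Longrightarrow> x $ i \<bullet> e \<le> x $ j \<bullet> e \<and> y $ i \<bullet> e \<le> y $ j \<bullet> e"
    using simultaneous_ranking[of "\<lambda>i. x $ i \<bullet> e" "\<lambda>i. y $ i \<bullet> e"] ord by blast
  define b :: "('e, 'n) vec" where "b = (\<chi> i. real (r i) *\<^sub>R e)"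
  have M: "0 \<le> M" unfolding M_def by (rule mass_pairs_nonneg[OF m])
  have "mass_inner m b b \<le> B"
    unfolding mass_inner_def B_def
  proof (rule sum_mono)
    fix i
    have "(real (r i))\<^sup>2 \<le> (real CARD('n))\<^sup>2" using r(2)[of i] by (intro power_mono) auto
    then show "m i * (b $ i \<bullet> b $ i) \<le> m i * (real CARD('n))\<^sup>2"
      using m[of i] e by (simp add: b_def power2_eq_square inner_Basis)
  qed
  moreover have "0 \<le> mass_inner m b b"
    unfolding mass_inner_def using m by (intro sum_nonneg mult_nonneg_nonneg) (auto intro: less_imp_le)
  ultimately have B: "(mass_norm m b)\<^sup>2 \<le> B" by (simp add: mass_norm_def)
  define P where "P = (2/3 * (mass_norm m b)\<^sup>2 + 3 * M) * \<rho> + h * \<rho> ^ 3"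
  have "0 \<le> P" using M \<open>0 \<le> h\<close> \<open>0 < \<rho>\<close> by (simp add: P_def)
  have sep: "q \<le> norm ((z + q *\<^sub>R b) $ i - (z + q *\<^sub>R b) $ j)"
    if "0 \<le> q" "i \<noteq> j" "\<And>i j. r i < r j \<Longrightarrow> z $ i \<bullet> e \<le> z $ j \<bullet> e" for q z i j
    using ranking_separates[OF e r(1) that(3) that(1,2)] by (simp add: b_def)
  have 1: "jm_dist m h x (x + \<rho>\<^sup>2 *\<^sub>R b) \<le> ennreal P"
    unfolding P_def M_def using r(3) \<open>0 \<le> h\<close> \<open>0 < \<rho>\<close>
    by (intro jm_dist_cube_root_curve[where m = m, OF m] sep) auto
  have 3: "jm_dist m h y (y + \<rho>\<^sup>2 *\<^sub>R b) \<le> ennreal P"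
    unfolding P_def M_def using r(3) \<open>0 \<le> h\<close> \<open>0 < \<rho>\<close>
    by (intro jm_dist_cube_root_curve[where m = m, OF m] sep) auto
  have 2: "jm_dist m h (x + \<rho>\<^sup>2 *\<^sub>R b) (y + \<rho>\<^sup>2 *\<^sub>R b)
      \<le> ennreal ((1/2 + M) * \<rho> + h * \<rho> ^ 3)"
  proof -
    let ?x = "x + \<rho>\<^sup>2 *\<^sub>R b" and ?y = "y + \<rho>\<^sup>2 *\<^sub>R b"
    have "jm_dist m h ?x ?y
        \<le> ennreal (1/2 * (mass_norm m (?y - ?x))\<^sup>2 / \<rho> ^ 3 + h * \<rho> ^ 3
          + \<rho> ^ 3 * ((M / \<rho>\<^sup>2) * 1 - (M / \<rho>\<^sup>2) * 0))"
    proof (rule jm_dist_segment[where w = "\<lambda>_. M / \<rho>\<^sup>2" and W = "\<lambda>t. (M / \<rho>\<^sup>2) * t"])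
      fix \<theta> :: real assume \<theta>: "0 < \<theta>" "\<theta> < 1"
      define z where "z = x + \<theta> *\<^sub>R (y - x)"
      have z: "z $ i \<bullet> e \<le> z $ j \<bullet> e" if "r i < r j" for i j
      proof -
        have "(1 - \<theta>) * (x $ i \<bullet> e) + \<theta> * (y $ i \<bullet> e) \<le> (1 - \<theta>) * (x $ j \<bullet> e) + \<theta> * (y $ j \<bullet> e)"
          using r(3)[OF that] \<theta> by (intro add_mono mult_left_mono) auto
        then show ?thesis by (simp add: z_def inner_add_left inner_diff_left algebra_simps)
      qed
      have "newton_potential m (z + \<rho>\<^sup>2 *\<^sub>R b) \<le> ennreal (M / \<rho>\<^sup>2)"
        unfolding M_def using \<open>0 < \<rho>\<close> z by (intro newton_potential_le[where m = m, OF m] sep) auto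
      then show "newton_potential m (?x + \<theta> *\<^sub>R (?y - ?x)) \<le> ennreal (M / \<rho>\<^sup>2)"
        by (simp add: z_def algebra_simps)
      show "0 \<le> M / \<rho>\<^sup>2" using M by simp
      show "((\<lambda>t. M / \<rho>\<^sup>2 * t) has_real_derivative M / \<rho>\<^sup>2) (at \<theta>)"
        by (rule DERIV_cmult_Id)
    qed (use \<open>0 \<le> h\<close> \<open>0 < \<rho>\<close> M in \<open>auto intro!: continuous_intros\<close>)
    also have "\<dots> \<le> ennreal ((1/2 + M) * \<rho> + h * \<rho> ^ 3)"
    proof (rule ennreal_leI)
      have "(mass_norm m (?y - ?x))\<^sup>2 \<le> (\<rho>\<^sup>2)\<^sup>2"
        using near by (intro power_mono) (auto simp: mass_norm_eq[where m = m, OF m])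
      then have "1/2 * (mass_norm m (?y - ?x))\<^sup>2 / \<rho> ^ 3 \<le> 1/2 * (\<rho>\<^sup>2)\<^sup>2 / \<rho> ^ 3"
        using \<open>0 < \<rho>\<close> by (intro divide_right_mono mult_left_mono) auto
      also have "1/2 * (\<rho>\<^sup>2)\<^sup>2 / \<rho> ^ 3 = 1/2 * \<rho>"
        using \<open>0 < \<rho>\<close> by (simp add: field_simps power2_eq_square power3_eq_cube)
      finally have "1/2 * (mass_norm m (?y - ?x))\<^sup>2 / \<rho> ^ 3 \<le> 1/2 * \<rho>" .
      moreover have "\<rho> ^ 3 * ((M / \<rho>\<^sup>2) * 1 - (M / \<rho>\<^sup>2) * 0) = M * \<rho>"
        using \<open>0 < \<rho>\<close> by (simp add: field_simps power2_eq_square power3_eq_cube)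
      ultimately show "1/2 * (mass_norm m (?y - ?x))\<^sup>2 / \<rho> ^ 3 + h * \<rho> ^ 3
          + \<rho> ^ 3 * ((M / \<rho>\<^sup>2) * 1 - (M / \<rho>\<^sup>2) * 0) \<le> (1/2 + M) * \<rho> + h * \<rho> ^ 3"
        by (simp add: algebra_simps)
    qed
    finally show ?thesis .
  qed
  have "jm_dist m h x y \<le> jm_dist m h x (x + \<rho>\<^sup>2 *\<^sub>R b)
      + (jm_dist m h (x + \<rho>\<^sup>2 *\<^sub>R b) (y + \<rho>\<^sup>2 *\<^sub>R b)
        + jm_dist m h (y + \<rho>\<^sup>2 *\<^sub>R b) y)"
    by (rule order_trans[OF jm_dist_triangle add_left_mono[OF jm_dist_triangle]])
  also have "\<dots> \<le> ennreal P + (ennreal ((1/2 + M) * \<rho> + h * \<rho> ^ 3) + ennreal P)"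
    using 1 2 3 by (intro add_mono) (simp_all add: jm_dist_sym[of m h "y + \<rho>\<^sup>2 *\<^sub>R b" y])
  also have "\<dots> = ennreal (P + (((1/2 + M) * \<rho> + h * \<rho> ^ 3) + P))"
  proof -
    have "0 \<le> (1/2 + M) * \<rho> + h * \<rho> ^ 3" using M \<open>0 \<le> h\<close> \<open>0 < \<rho>\<close> by simp
    with \<open>0 \<le> P\<close> show ?thesis by (simp only: ennreal_plus add_nonneg_nonneg)
  qed
  also have "\<dots> \<le> ennreal ((4/3 * B + 7 * M + 1/2) * \<rho> + 3 * h * \<rho> ^ 3)"
  proof (rule ennreal_leI)
    have "4/3 * (mass_norm m b)\<^sup>2 * \<rho> \<le> 4/3 * B * \<rho>"
      using B \<open>0 < \<rho>\<close> by (intro mult_right_mono mult_left_mono) auto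
    then show "P + (((1/2 + M) * \<rho> + h * \<rho> ^ 3) + P) \<le> (4/3 * B + 7 * M + 1/2) * \<rho> + 3 * h * \<rho> ^ 3"
      by (simp add: P_def algebra_simps)
  qed
  finally show ?thesis .
qed

lemma eventually_jm_dist_le:
  fixes x :: "('e::euclidean_space, 'n::{finite,linorder}) vec"
  assumes m: "\<And>i. m i > 0" and "0 \<le> h" "0 < \<epsilon>"
  shows "\<forall>\<^sub>F y in nhds x. jm_dist m h x y \<le> ennreal \<epsilon>"
proof -
  define K where "K = 4/3 * (\<Sum>i\<in>UNIV. m i * (real CARD('n))\<^sup>2) + 7 * mass_pairs m + 1/2"
  have "((\<lambda>\<rho>. K * \<rho> + 3 * h * \<rho> ^ 3) \<longlongrightarrow> K * 0 + 3 * h * 0 ^ 3) (at_right 0)"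
    by (intro tendsto_intros)
  then have "\<forall>\<^sub>F \<rho> in at_right 0. K * \<rho> + 3 * h * \<rho> ^ 3 < \<epsilon>"
    using \<open>0 < \<epsilon>\<close> by (intro order_tendstoD(2)) auto
  moreover have "\<forall>\<^sub>F \<rho> :: real in at_right 0. 0 < \<rho>" by (rule eventually_at_right_less)
  ultimately have "\<forall>\<^sub>F \<rho> in at_right 0. K * \<rho> + 3 * h * \<rho> ^ 3 < \<epsilon> \<and> 0 < \<rho>" by (rule eventually_conj)
  then obtain \<rho> where \<rho>: "K * \<rho> + 3 * h * \<rho> ^ 3 < \<epsilon>" "0 < \<rho>"
    using eventually_happens trivial_limit_at_right_real by blast
  obtain e :: 'e where e: "e \<in> Basis" using nonempty_Basis by blast
  have "continuous_on UNIV (\<lambda>y. mass_norm m (y - x))"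
    by (intro continuous_on_compose2[OF continuous_on_mass_norm] continuous_intros) auto
  then have "open {y. mass_norm m (y - x) < \<rho>\<^sup>2}"
    by (intro open_Collect_less continuous_on_const)
  moreover have "mass_norm m (x - x) < \<rho>\<^sup>2" using \<rho> by (simp add: mass_norm_def mass_inner_def)
  ultimately have "\<forall>\<^sub>F y in nhds x. y \<in> {y. mass_norm m (y - x) < \<rho>\<^sup>2}"
    by (intro eventually_nhds_in_open) auto
  with eventually_order_preserved[of x e] show ?thesis
  proof eventually_elim
    case (elim y)
    then have "jm_dist m h x y \<le> ennreal (K * \<rho> + 3 * h * \<rho> ^ 3)"
      unfolding K_def using \<rho> \<open>0 \<le> h\<close> e by (intro jm_dist_le_small_scale[where m = m, OF m]) auto
    also have "\<dots> \<le> ennreal \<epsilon>" using \<rho> by (intro ennreal_leI) simp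
    finally show ?case .
  qed
qed

text \<open>
  By continuity at the diagonal, finiteness of the distance from \<open>x\<close> is an open and closed condition on
  the connected space of configurations.
\<close>

lemma jm_dist_finite:
  fixes x y :: "('e::euclidean_space, 'n::{finite,linorder}) vec"
  assumes m: "\<And>i. m i > 0" and "0 \<le> h"
  shows "jm_dist m h x y < \<infinity>"
proof -
  let ?S = "{y. jm_dist m h x y < \<infinity>}"
  have near: "\<forall>\<^sub>F w in nhds z. jm_dist m h z w < \<infinity>" for z :: "('e, 'n) vec"
    using eventually_jm_dist_le[where m = m, OF m \<open>0 \<le> h\<close> zero_less_one, where x = z]
    by (rule eventually_mono) (auto simp: less_top intro: le_less_trans)
  have tri: "jm_dist m h u w < \<infinity>"
    if "jm_dist m h u v < \<infinity>" "jm_dist m h v w < \<infinity>" for u v w :: "('e, 'n) vec"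
    using jm_dist_triangle[of m h u w v] that by (auto intro: le_less_trans)
  have "open ?S"
    unfolding open_subopen[of ?S]
  proof
    fix z assume z: "z \<in> ?S"
    obtain U where "open U" "z \<in> U" "\<forall>w\<in>U. jm_dist m h z w < \<infinity>"
      using near[of z] unfolding eventually_nhds by blast
    then show "\<exists>T. open T \<and> z \<in> T \<and> T \<subseteq> ?S" using z tri[of x z] by (intro exI[of _ U]) auto
  qed
  moreover have "closed ?S"
    unfolding closed_def open_subopen[of "- ?S"]
  proof
    fix z assume z: "z \<in> - ?S"
    obtain U where U: "open U" "z \<in> U" "\<forall>w\<in>U. jm_dist m h z w < \<infinity>"
      using near[of z] unfolding eventually_nhds by blast
    have "w \<in> - ?S" if "w \<in> U" for w
      using tri[of x w z] U(3) that z jm_dist_sym[of m h w z] by auto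
    then show "\<exists>T. open T \<and> z \<in> T \<and> T \<subseteq> - ?S" using U by (intro exI[of _ U]) auto
  qed
  moreover have "x \<in> ?S" using near[of x] by (auto dest: eventually_nhds_x_imp_x)
  ultimately have "?S = UNIV" using clopen[of ?S] by blast
  then show ?thesis by blast
qed

definition jm_real_dist where
  "jm_real_dist m h x y = enn2real (jm_dist m h x y)"

lemma jm_dist_eq_real:
  fixes x y :: "('e::euclidean_space, 'n::{finite,linorder}) vec"
  assumes "\<And>i. m i > 0" "0 \<le> h"
  shows "jm_dist m h x y = ennreal (jm_real_dist m h x y)"
  using jm_dist_finite[where m = m, OF assms, where x = x and y = y] by (simp add: jm_real_dist_def less_top)

lemma jm_real_dist_le:
  assumes "jm_dist m h x y \<le> ennreal r" "0 \<le> r"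
  shows "jm_real_dist m h x y \<le> r"
  using assms unfolding jm_real_dist_def by (intro enn2real_leI)

lemma norm_dominated_metric_jm:
  fixes m :: "'n::{finite,linorder} \<Rightarrow> real"
  assumes m: "\<And>i. m i > 0" and "0 < h"
  shows "norm_dominated_metric (jm_real_dist m h :: ('e::euclidean_space, 'n) vec \<Rightarrow> _)
    (mass_scaling m) (sqrt (2 * h))"
proof (rule norm_dominated_metric.intro)
  note eq = jm_dist_eq_real[where m = m, OF m less_imp_le[OF \<open>0 < h\<close>]]
  have nn: "0 \<le> jm_real_dist m h u v" for u v :: "('e, 'n) vec" by (simp add: jm_real_dist_def)
  have symm: "jm_real_dist m h u v = jm_real_dist m h v u" for u v :: "('e, 'n) vec"
    unfolding jm_real_dist_def by (subst jm_dist_sym) (rule refl)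
  fix x y z :: "('e, 'n) vec"
  show "linear (mass_scaling m :: ('e, 'n) vec \<Rightarrow> _)" by (rule linear_mass_scaling)
  show "inj (mass_scaling m :: ('e, 'n) vec \<Rightarrow> _)" by (rule inj_mass_scaling[OF m])
  show "0 < sqrt (2 * h)" using \<open>0 < h\<close> by simp
  show "sqrt (2 * h) * norm (mass_scaling m (x - y)) \<le> jm_real_dist m h x y"
    using jm_dist_lower_bound[where m = m, OF m \<open>0 < h\<close>, where x = y and y = x] nn[of y x]
    unfolding eq symm[of y x] by simp
  show "jm_real_dist m h x y = jm_real_dist m h y x" by (rule symm)
  show "jm_real_dist m h x z \<le> jm_real_dist m h x y + jm_real_dist m h y z"
    using jm_dist_triangle[of m h x z y] nn by (simp add: eq ennreal_plus[symmetric] del: ennreal_plus)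
  show "((\<lambda>y. jm_real_dist m h x y) \<longlongrightarrow> 0) (nhds x)"
    unfolding tendsto_iff
  proof (intro allI impI)
    fix e :: real assume "0 < e"
    then have "0 < e / 2" by simp
    from eventually_jm_dist_le[where m = m, OF m less_imp_le[OF \<open>0 < h\<close>] this, where x = x]
    show "\<forall>\<^sub>F y in nhds x. dist (jm_real_dist m h x y) 0 < e"
    proof eventually_elim
      case (elim y)
      then have "jm_real_dist m h x y \<le> e / 2" using \<open>0 < e\<close> by (intro jm_real_dist_le) auto
      then show ?case using nn[of x y] \<open>0 < e\<close> by simp
    qed
  qed
qed

text \<open>
  The intermediate point is found on an almost minimising curve by the intermediate value theorem.
\<close>

lemma jm_real_dist_almost_between:
  fixes x y :: "('e::euclidean_space, 'n::{finite,linorder}) vec"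
  assumes m: "\<And>i. m i > 0" and "0 < h" and s: "0 < s" "s < jm_real_dist m h x y" and "0 < e"
  shows "\<exists>z. jm_real_dist m h x z = s \<and> jm_real_dist m h z y \<le> jm_real_dist m h x y - s + e"
proof -
  let ?d = "jm_real_dist m h"
  interpret norm_dominated_metric "?d :: ('e, 'n) vec \<Rightarrow> _" "mass_scaling m" "sqrt (2 * h)"
    by (rule norm_dominated_metric_jm[where m = m, OF m \<open>0 < h\<close>])
  note eq = jm_dist_eq_real[where m = m, OF m less_imp_le[OF \<open>0 < h\<close>]]
  note nn = nonneg
  have "jm_dist m h x y < ennreal (?d x y + e)"
    using \<open>0 < e\<close> nn[of x y] by (simp add: eq ennreal_less_iff)
  then obtain a b \<gamma> where c: "a < b" "abs_continuous a b \<gamma>" "\<gamma> a = x" "\<gamma> b = y"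
    "action_on m h \<gamma> {a<..<b} < ennreal (?d x y + e)" by (rule jm_dist_less_curve)
  have "continuous_on {a..b} (\<lambda>t. ?d x (\<gamma> t))"
    by (intro continuous_on_d continuous_on_const absolutely_continuous_imp_continuous_on[OF c(2)])
  then obtain t where t: "a \<le> t" "t \<le> b" "?d x (\<gamma> t) = s"
    using IVT'[of "\<lambda>t. ?d x (\<gamma> t)" a s b] c s self by auto
  have "t \<noteq> a" "t \<noteq> b" using t(3) c s self by auto
  then have t': "a < t" "t < b" using t by auto
  have "ennreal (s + ?d (\<gamma> t) y) = jm_dist m h x (\<gamma> t) + jm_dist m h (\<gamma> t) y"
    using s nn by (simp add: eq t(3) ennreal_plus)
  also have "\<dots> \<le> action_on m h \<gamma> {a<..<t} + action_on m h \<gamma> {t<..<b}"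
  proof (rule add_mono)
    show "jm_dist m h x (\<gamma> t) \<le> action_on m h \<gamma> {a<..<t}"
      using jm_dist_le_action[OF t'(1) absolutely_continuous_subinterval[OF c(2)], of m h] t' c(3) by simp
    show "jm_dist m h (\<gamma> t) y \<le> action_on m h \<gamma> {t<..<b}"
      using jm_dist_le_action[OF t'(2) absolutely_continuous_subinterval[OF c(2)], of m h] t' c(4) by simp
  qed
  also have "\<dots> = action_on m h \<gamma> {a<..<b}"
    using t' by (intro action_on_split[OF c(2), symmetric]) auto
  also note c(5)
  finally have "s + ?d (\<gamma> t) y < ?d x y + e"
    using s nn[of "\<gamma> t" y] by (subst (asm) ennreal_less_iff) auto
  with t(3) show ?thesis by (intro exI[of _ "\<gamma> t"]) auto
qed

lemma norm_dominated_length_metric_jm: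
  fixes m :: "'n::{finite,linorder} \<Rightarrow> real"
  assumes m: "\<And>i. m i > 0" and "0 < h"
  shows "norm_dominated_length_metric (jm_real_dist m h :: ('e::euclidean_space, 'n) vec \<Rightarrow> _)
    (mass_scaling m) (sqrt (2 * h))"
  by (intro norm_dominated_length_metric.intro norm_dominated_metric_jm[OF assms]
      norm_dominated_length_metric_axioms.intro jm_real_dist_almost_between[OF assms])

section \<open>Upper bound in a cone of configurations\<close>

text \<open>
  On the straight line from \<open>v\<close> to \<open>y \<approx> T * v\<close> the mutual distances are at least
  \<open>\<beta> / 2 * (1 + \<theta> * (T - 1))\<close>, because the deviation of \<open>y\<close> from \<open>T * v\<close> eats up at most half of the
  separation. Bounding \<open>1 / Q\<close> by \<open>1 / sqrt Q\<close> replaces the logarithm in the integral of the potential by a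
  square root, which is weaker and has simpler algebra.
\<close>

lemma jm_real_dist_segment_to_cone:
  fixes v y :: "('e::euclidean_space, 'n::{finite,linorder}) vec"
  assumes m: "\<And>i. m i > 0" and "0 < h" and "0 < \<beta>" and "2 \<le> T"
    and sep: "\<And>i j. i < j \<Longrightarrow> \<beta> \<le> norm (v $ i - v $ j)"
    and w: "\<And>i j. norm ((y - T *\<^sub>R v) $ i - (y - T *\<^sub>R v) $ j) \<le> T * (\<beta> / 2)"
  defines "c \<equiv> sqrt (2 * h)" and "len \<equiv> norm (mass_scaling m (y - v))"
  shows "jm_real_dist m h v y \<le> c * len + c / 2 + (len + 1) * (4 * mass_pairs m / (c * \<beta>)) / sqrt T"
proof -
  define K where "K = 2 * mass_pairs m / \<beta>"
  have K: "0 \<le> K" using mass_pairs_nonneg[of m] m \<open>0 < \<beta>\<close> by (simp add: K_def)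
  have c: "0 < c" "c * c = 2 * h" using \<open>0 < h\<close> by (auto simp: c_def)
  have "0 \<le> len" by (simp add: len_def)
  \<comment> \<open>The duration at speed \<open>c\<close>; the summand \<open>1\<close> keeps it positive for \<open>y = v\<close> and costs the term \<open>c / 2\<close>.\<close>
  define \<tau> where "\<tau> = (len + 1) / c"
  have "0 < \<tau>" using c \<open>0 \<le> len\<close> by (simp add: \<tau>_def)
  define W where "W \<theta> = 2 * K / (T - 1) * sqrt (1 + \<theta> * (T - 1))" for \<theta>
  have "jm_dist m h v y \<le> ennreal (1/2 * (mass_norm m (y - v))\<^sup>2 / \<tau> + h * \<tau> + \<tau> * (W 1 - W 0))"
  proof (rule jm_dist_segment[where w = "\<lambda>\<theta>. K / sqrt (1 + \<theta> * (T - 1))"])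
    fix \<theta> :: real assume \<theta>: "0 < \<theta>" "\<theta> < 1"
    define Q where "Q = 1 + \<theta> * (T - 1)"
    have Q: "1 \<le> Q" using \<theta> \<open>2 \<le> T\<close> by (simp add: Q_def)
    have "newton_potential m (v + \<theta> *\<^sub>R (y - v)) \<le> ennreal (mass_pairs m / (\<beta> / 2 * Q))"
    proof (rule newton_potential_le[where m = m, OF m])
      fix i j :: 'n assume "i < j"
      let ?r = "(y - T *\<^sub>R v) $ i - (y - T *\<^sub>R v) $ j"
      have eq: "(v + \<theta> *\<^sub>R (y - v)) $ i - (v + \<theta> *\<^sub>R (y - v)) $ j = Q *\<^sub>R (v $ i - v $ j) + \<theta> *\<^sub>R ?r"
        by (simp add: Q_def algebra_simps)
      have "norm (Q *\<^sub>R (v $ i - v $ j)) - norm (\<theta> *\<^sub>R ?r) \<le> norm (Q *\<^sub>R (v $ i - v $ j) + \<theta> *\<^sub>R ?r)"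
        by (rule norm_diff_ineq)
      moreover have "Q * \<beta> \<le> norm (Q *\<^sub>R (v $ i - v $ j))"
        using Q sep[OF \<open>i < j\<close>] by (simp add: mult_left_mono)
      moreover have "norm (\<theta> *\<^sub>R ?r) \<le> Q * (\<beta> / 2)"
      proof -
        have "norm (\<theta> *\<^sub>R ?r) \<le> \<theta> * (T * (\<beta> / 2))"
          using \<theta> w[of i j] by (simp add: mult_left_mono)
        also have "\<dots> = (\<theta> * T) * (\<beta> / 2)" by simp
        also have "\<dots> \<le> Q * (\<beta> / 2)"
          using \<theta> \<open>0 < \<beta>\<close> by (intro mult_right_mono) (auto simp: Q_def algebra_simps)
        finally show ?thesis .
      qed
      ultimately show "\<beta> / 2 * Q \<le> norm ((v + \<theta> *\<^sub>R (y - v)) $ i - (v + \<theta> *\<^sub>R (y - v)) $ j)"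
        unfolding eq by (simp only: field_simps)
    qed (use Q \<open>0 < \<beta>\<close> in auto)
    also have "mass_pairs m / (\<beta> / 2 * Q) = K / Q" by (simp add: K_def)
    also have "ennreal (K / Q) \<le> ennreal (K / sqrt Q)"
    proof (intro ennreal_leI divide_left_mono K)
      have "sqrt Q * 1 \<le> sqrt Q * sqrt Q" using Q by (intro mult_left_mono) auto
      then show "sqrt Q \<le> Q" using Q by simp
    qed (use Q in auto)
    finally show "newton_potential m (v + \<theta> *\<^sub>R (y - v)) \<le> ennreal (K / sqrt (1 + \<theta> * (T - 1)))"
      by (simp add: Q_def)
    show "0 \<le> K / sqrt (1 + \<theta> * (T - 1))" using K Q by (simp add: Q_def)
    have "((\<lambda>\<theta>. 1 + \<theta> * (T - 1)) has_real_derivative T - 1) (at \<theta>)"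
      by (auto intro!: derivative_eq_intros)
    from DERIV_chain2[OF DERIV_real_sqrt this] Q
    have "((\<lambda>\<theta>. sqrt (1 + \<theta> * (T - 1))) has_real_derivative inverse (sqrt Q) / 2 * (T - 1)) (at \<theta>)"
      by (simp add: Q_def)
    from DERIV_cmult[OF this, of "2 * K / (T - 1)"]
    have "(W has_real_derivative 2 * K / (T - 1) * (inverse (sqrt Q) / 2 * (T - 1))) (at \<theta>)"
      by (simp only: W_def[abs_def])
    also have "2 * K / (T - 1) * (inverse (sqrt Q) / 2 * (T - 1)) = K / sqrt Q"
    proof -
      have "2 * K / X * (inverse R / 2 * X) = K / R" if "X \<noteq> 0" "R \<noteq> 0" for X R
        using that by (simp add: field_simps)
      moreover have "T - 1 \<noteq> 0" "sqrt Q \<noteq> 0" using \<open>2 \<le> T\<close> Q by auto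
      ultimately show ?thesis by blast
    qed
    finally show "(W has_real_derivative K / sqrt (1 + \<theta> * (T - 1))) (at \<theta>)"
      by (simp only: Q_def)
  next
    show "continuous_on {0..1} W" unfolding W_def by (intro continuous_intros)
  qed (use \<open>0 < h\<close> \<open>0 < \<tau>\<close> in auto)
  moreover have "1/2 * (mass_norm m (y - v))\<^sup>2 / \<tau> + h * \<tau> + \<tau> * (W 1 - W 0)
      \<le> c * len + c / 2 + (len + 1) * (4 * mass_pairs m / (c * \<beta>)) / sqrt T" (is "?A \<le> ?B")
  proof -
    have 1: "1/2 * (mass_norm m (y - v))\<^sup>2 / \<tau> \<le> 1/2 * c * len"
    proof -
      have "1/2 * (mass_norm m (y - v))\<^sup>2 / \<tau> = 1/2 * c * (len\<^sup>2 / (len + 1))"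
        by (simp add: mass_norm_eq[where m = m, OF m] len_def \<tau>_def)
      also have "len\<^sup>2 / (len + 1) \<le> len"
        using \<open>0 \<le> len\<close> by (simp add: power2_eq_square pos_divide_le_eq algebra_simps)
      finally show ?thesis using c by (simp add: mult_left_mono)
    qed
    have h: "h = c * c / 2" using c by simp
    have "h * \<tau> = (c * c / 2) * ((len + 1) / c)" unfolding \<tau>_def h[symmetric] ..
    also have "\<dots> = 1/2 * c * (len + 1)" using c(1) by simp
    finally have 2: "h * \<tau> = 1/2 * c * (len + 1)" .
    have "W 1 - W 0 = 2 * K / (T - 1) * (sqrt T - 1)"
      by (simp add: W_def right_diff_distrib)
    also have "T - 1 = (sqrt T - 1) * (sqrt T + 1)" using \<open>2 \<le> T\<close> by (simp add: algebra_simps)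
    also have "2 * K / ((sqrt T - 1) * (sqrt T + 1)) * (sqrt T - 1) = 2 * K / (sqrt T + 1)"
    proof -
      have "sqrt T - 1 \<noteq> 0" using \<open>2 \<le> T\<close> by simp
      then show ?thesis by simp
    qed
    also have "\<dots> \<le> 2 * K / sqrt T"
      using K \<open>2 \<le> T\<close> by (intro divide_left_mono mult_pos_pos add_nonneg_pos) auto
    finally have "\<tau> * (W 1 - W 0) \<le> \<tau> * (2 * K / sqrt T)"
      using \<open>0 < \<tau>\<close> by (intro mult_left_mono) auto
    also have "\<dots> = (len + 1) * (4 * mass_pairs m / (c * \<beta>)) / sqrt T"
      by (simp add: \<tau>_def K_def)
    finally have 3: "\<tau> * (W 1 - W 0) \<le> (len + 1) * (4 * mass_pairs m / (c * \<beta>)) / sqrt T" .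
    have "1/2 * c * len + 1/2 * c * (len + 1) = c * len + c / 2" by (simp add: field_simps)
    with 1 2 3 show ?thesis by linarith
  qed
  moreover have "0 \<le> ?B"
    using c \<open>0 \<le> len\<close> mass_pairs_nonneg[of m] m \<open>0 < \<beta>\<close> \<open>2 \<le> T\<close>
    by (intro add_nonneg_nonneg divide_nonneg_nonneg mult_nonneg_nonneg) auto
  ultimately show ?thesis
    by (intro jm_real_dist_le) (auto intro: order_trans ennreal_leI)
qed

text \<open>
  The line starts at \<open>v\<close> instead of \<open>p\<close>, which may be a collision; the detour from \<open>p\<close> to \<open>v\<close> costs a
  constant. The scale \<open>T\<close> is independent of \<open>d p y\<close>, so that the bound can be applied to the points
  \<open>p + T * v\<close> before their distance from \<open>p\<close> is known.
\<close>

lemma jm_real_dist_cone: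
  fixes v p :: "('e::euclidean_space, 'n::{finite,linorder}) vec"
  assumes m: "\<And>i. m i > 0" and "0 < h" and "0 < \<beta>"
    and sep: "\<And>i j. i < j \<Longrightarrow> \<beta> \<le> norm (v $ i - v $ j)"
  obtains C \<epsilon> s0 where "0 \<le> C" "0 < \<epsilon>"
    "\<And>T y. s0 \<le> T \<Longrightarrow> norm (mass_scaling m ((1 / T) *\<^sub>R (y - p) - v)) \<le> \<epsilon> \<Longrightarrow>
      jm_real_dist m h p y \<le> sqrt (2 * h) * norm (mass_scaling m (y - p)) + C * sqrt T"
proof -
  let ?d = "jm_real_dist m h" and ?L = "mass_scaling m"
  interpret norm_dominated_length_metric "?d :: ('e, 'n) vec \<Rightarrow> _" ?L "sqrt (2 * h)"
    by (rule norm_dominated_length_metric_jm[where m = m, OF m \<open>0 < h\<close>])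
  define c where "c = sqrt (2 * h)"
  have "0 < c" using \<open>0 < h\<close> by (simp add: c_def)
  obtain B where B: "0 < B" "\<And>x :: ('e, 'n) vec. norm x \<le> B * norm (?L x)" using L_bounded_below by metis
  \<comment> \<open>The error of direction and the displacement by \<open>p\<close> each change mutual distances by at most
    \<open>T * \<beta> / 4\<close>.\<close>
  define \<epsilon> where "\<epsilon> = \<beta> / (8 * B)"
  have "0 < \<epsilon>" using B \<open>0 < \<beta>\<close> by (simp add: \<epsilon>_def)
  define s0 where "s0 = max 2 (8 * norm p / \<beta>)"
  define D where "D = norm (?L (p - v))"
  define K where "K = 4 * mass_pairs m / (c * \<beta>)"
  have K: "0 \<le> K" using mass_pairs_nonneg[of m] m \<open>0 < \<beta>\<close> \<open>0 < c\<close> by (simp add: K_def)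
  define A where "A = norm (?L v) + \<epsilon> + D + 1"
  define C where "C = ?d p v + c * D + c / 2 + A * K"
  have "0 \<le> D" by (simp add: D_def)
  have "0 \<le> A" using \<open>0 < \<epsilon>\<close> \<open>0 \<le> D\<close> by (simp add: A_def)
  have "0 \<le> C" using nonneg[of p v] \<open>0 < c\<close> \<open>0 \<le> D\<close> \<open>0 \<le> A\<close> K by (simp add: C_def)
  have main: "?d p y \<le> c * norm (?L (y - p)) + C * sqrt T"
    if T: "s0 \<le> T" and err: "norm (?L ((1 / T) *\<^sub>R (y - p) - v)) \<le> \<epsilon>" for T y
  proof -
    have T2: "2 \<le> T" "8 * norm p \<le> \<beta> * T"
      using T \<open>0 < \<beta>\<close> by (auto simp: s0_def field_simps)
    define w where "w = (1 / T) *\<^sub>R (y - p) - v"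
    have yw: "y = p + T *\<^sub>R v + T *\<^sub>R w" using T2 by (simp add: w_def algebra_simps)
    have "norm w \<le> B * \<epsilon>"
      using B(2)[of w] err B(1) by (simp add: w_def) (meson mult_left_mono less_imp_le order_trans)
    then have nw: "norm w \<le> \<beta> / 8" using B(1) by (simp add: \<epsilon>_def)
    have "norm ((y - T *\<^sub>R v) $ i - (y - T *\<^sub>R v) $ j) \<le> T * (\<beta> / 2)" for i j
    proof -
      have "(y - T *\<^sub>R v) = p + T *\<^sub>R w" using yw by simp
      then have "norm ((y - T *\<^sub>R v) $ i - (y - T *\<^sub>R v) $ j) \<le> norm ((p + T *\<^sub>R w) $ i) + norm ((p + T *\<^sub>R w) $ j)"
        by (simp only: norm_triangle_ineq4)
      also have "\<dots> \<le> norm (p + T *\<^sub>R w) + norm (p + T *\<^sub>R w)"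
        by (intro add_mono Finite_Cartesian_Product.norm_nth_le)
      also have "norm (p + T *\<^sub>R w) \<le> norm p + T * norm w"
        using norm_triangle_ineq[of p "T *\<^sub>R w"] T2 by simp
      also have "\<dots> \<le> \<beta> * T / 8 + T * (\<beta> / 8)"
        using T2 nw by (intro add_mono mult_left_mono) auto
      finally show ?thesis by (simp add: algebra_simps)
    qed
    then have vy: "?d v y \<le> c * norm (?L (y - v)) + c / 2 + (norm (?L (y - v)) + 1) * K / sqrt T"
      using jm_real_dist_segment_to_cone[where m = m, OF m \<open>0 < h\<close> \<open>0 < \<beta>\<close> T2(1) sep] by (simp add: c_def K_def)
    have "?L (y - v) = ?L (y - p) + ?L (p - v)" by (simp add: linear_add[OF lin, symmetric])
    then have l1: "norm (?L (y - v)) \<le> norm (?L (y - p)) + D"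
      unfolding D_def by (metis norm_triangle_ineq)
    have "?L (y - p) = T *\<^sub>R (?L v + ?L w)"
      by (simp add: yw linear_add[OF lin, symmetric] linear_scale[OF lin, symmetric] scaleR_right_distrib)
    then have "norm (?L (y - p)) \<le> T * (norm (?L v) + \<epsilon>)"
      using T2 norm_triangle_ineq[of "?L v" "?L w"] err by (simp add: w_def[symmetric])
    moreover have "D + 1 \<le> T * (D + 1)" using T2 \<open>0 \<le> D\<close> mult_right_mono[of 1 T "D + 1"] by simp
    ultimately have l2: "norm (?L (y - v)) + 1 \<le> T * A"
      using l1 by (simp add: A_def algebra_simps)
    have "(norm (?L (y - v)) + 1) * K / sqrt T \<le> T * A * K / sqrt T"
      using l2 K T2 by (intro divide_right_mono mult_right_mono) auto
    also have "\<dots> = A * K * (T / sqrt T)" by simp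
    also have "T / sqrt T = sqrt T" using T2 by (simp add: real_div_sqrt)
    finally have pot: "(norm (?L (y - v)) + 1) * K / sqrt T \<le> A * K * sqrt T" .
    have cl: "c * norm (?L (y - v)) \<le> c * (norm (?L (y - p)) + D)"
      using l1 \<open>0 < c\<close> by (intro mult_left_mono) auto
    have "?d p y \<le> ?d p v + ?d v y" by (rule tri)
    also have "\<dots> \<le> ?d p v + (c * (norm (?L (y - p)) + D) + c / 2 + A * K * sqrt T)"
      using vy pot cl by linarith
    also have "\<dots> = c * norm (?L (y - p)) + (?d p v + c * D + c / 2) * 1 + A * K * sqrt T"
      by (simp add: algebra_simps)
    also have "\<dots> \<le> c * norm (?L (y - p)) + (?d p v + c * D + c / 2) * sqrt T + A * K * sqrt T"
      using nonneg[of p v] \<open>0 < c\<close> \<open>0 \<le> D\<close> \<open>0 \<le> A\<close> K T2 by (intro add_mono mult_left_mono mult_nonneg_nonneg) auto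
    also have "\<dots> = c * norm (?L (y - p)) + C * sqrt T" by (simp add: C_def algebra_simps)
    finally show ?thesis .
  qed
  show thesis
    by (rule that[OF \<open>0 \<le> C\<close> \<open>0 < \<epsilon>\<close>]) (use main in \<open>simp add: c_def\<close>)
qed

text \<open>
  The points \<open>p + T * v\<close> have distance between \<open>T\<close> and \<open>T + C * sqrt T\<close> from \<open>p\<close>, so their error is
  \<open>O (1 / sqrt T)\<close>.
\<close>

lemma jm_real_dist_far_points:
  fixes v p :: "('e::euclidean_space, 'n::{finite,linorder}) vec"
  assumes m: "\<And>i. m i > 0" and "0 < h" and unit: "sqrt (2 * h) * norm (mass_scaling m v) = 1"
    and C: "0 \<le> C" "\<And>T. s0 \<le> T \<Longrightarrow> jm_real_dist m h p (p + T *\<^sub>R v) \<le> T + C * sqrt T"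
    and "0 < \<eta>"
  shows "\<exists>y. S \<le> jm_real_dist m h p y \<and>
    norm (mass_scaling m ((1 / jm_real_dist m h p y) *\<^sub>R (y - p) - v)) \<le> \<eta>"
proof -
  let ?d = "jm_real_dist m h" and ?L = "mass_scaling m"
  interpret norm_dominated_length_metric "?d :: ('e, 'n) vec \<Rightarrow> _" ?L "sqrt (2 * h)"
    by (rule norm_dominated_length_metric_jm[where m = m, OF m \<open>0 < h\<close>])
  define N where "N = norm (?L v)"
  have N: "0 \<le> N" by (simp add: N_def)
  define T where "T = max (max 1 S) (max s0 ((C * N / \<eta>)\<^sup>2))"
  have T: "1 \<le> T" "S \<le> T" "s0 \<le> T" "(C * N / \<eta>)\<^sup>2 \<le> T" by (auto simp: T_def)
  define y where "y = p + T *\<^sub>R v"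
  have "sqrt (2 * h) * norm (?L (y - p)) = T * (sqrt (2 * h) * norm (?L v))"
    using T by (simp add: y_def linear_scale[OF lin])
  then have low: "T \<le> ?d p y" using norm_le[of y p] sym[of p y] unit by simp
  have up: "?d p y \<le> T + C * sqrt T" unfolding y_def using T by (intro C) simp
  have "C * N / \<eta> \<le> sqrt T" using T(4) by (rule real_le_rsqrt)
  then have CN: "C * N \<le> \<eta> * sqrt T" using \<open>0 < \<eta>\<close> by (simp add: field_simps)
  have "(1 / ?d p y) *\<^sub>R (y - p) - v = (T / ?d p y - 1) *\<^sub>R v"
    by (simp add: y_def algebra_simps)
  then have "norm (?L ((1 / ?d p y) *\<^sub>R (y - p) - v)) = \<bar>T / ?d p y - 1\<bar> * N"
    by (simp add: linear_scale[OF lin] N_def)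
  also have "\<bar>T / ?d p y - 1\<bar> = (?d p y - T) / ?d p y"
    using low T by (simp add: abs_if field_simps)
  also have "\<dots> \<le> (C * sqrt T) / T"
    using low up T by (intro frac_le) auto
  finally have "norm (?L ((1 / ?d p y) *\<^sub>R (y - p) - v)) \<le> (C * sqrt T) / T * N"
    using N by (simp add: mult_right_mono)
  also have "\<dots> = (C * N) * sqrt T / T" by simp
  also have "\<dots> \<le> (\<eta> * sqrt T) * sqrt T / T"
    using CN T by (intro divide_right_mono mult_right_mono) auto
  also have "\<dots> = \<eta>" using T by (simp add: mult.assoc)
  finally show ?thesis using low T by (intro exI[of _ y]) auto
qed

section \<open>Geodesic rays with prescribed asymptotic direction\<close>

theorem theorem1p6:
  fixes m :: "'n::{finite,linorder} \<Rightarrow> real"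
    and h :: real
    and p a :: "('e::euclidean_space, 'n) vec"
  assumes "DIM('e) \<ge> 2"
    and "CARD('n) \<ge> 2"
    and "\<And>i. m i > 0"
    and "h > 0"
    and "a \<in> collision_free m"
  shows "\<exists>\<gamma>. jm_geodesic_ray m h p \<gamma> \<and> has_asymptotic_direction m \<gamma> a"
proof -
  note m = \<open>\<And>i. m i > 0\<close>
  let ?d = "jm_real_dist m h" and ?L = "mass_scaling m"
  interpret norm_dominated_length_metric "?d :: ('e, 'n) vec \<Rightarrow> _" ?L "sqrt (2 * h)"
    by (rule norm_dominated_length_metric_jm[where m = m, OF m \<open>h > 0\<close>])
  have noncol: "a $ i \<noteq> a $ j" if "i < j" for i j
    using \<open>a \<in> collision_free m\<close> newton_potential_eq_top_iff[of m a] m that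
    by (auto simp: collision_free_def)
  have "a \<noteq> 0"
  proof
    assume "a = 0"
    have "\<exists>i j :: 'n. i \<noteq> j"
    proof (rule ccontr)
      assume "\<nexists>i j :: 'n. i \<noteq> j"
      then have "(UNIV :: 'n set) = {undefined}" by auto
      then have "CARD('n) = 1" by (metis card_1_singleton_iff One_nat_def)
      then show False using \<open>CARD('n) \<ge> 2\<close> by simp
    qed
    then obtain i j :: 'n where "i \<noteq> j" by blast
    then have "i < j \<or> j < i" by auto
    then show False using noncol[of i j] noncol[of j i] \<open>a = 0\<close> by auto
  qed
  define l where "l = 1 / (sqrt (2 * h) * norm (?L a))"
  have "?L a \<noteq> ?L 0" using \<open>a \<noteq> 0\<close> injD[OF inj] by blast
  then have "0 < norm (?L a)" by (simp add: linear_0[OF lin])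
  then have l: "0 < l" using \<open>h > 0\<close> by (simp add: l_def)
  define v where "v = l *\<^sub>R a"
  have unit: "sqrt (2 * h) * norm (?L v) = 1"
    using \<open>0 < norm (?L a)\<close> \<open>h > 0\<close> l by (simp add: v_def linear_scale[OF lin] l_def)
  define \<beta> where "\<beta> = Min (insert 1 ((\<lambda>(i, j). norm (v $ i - v $ j)) ` {(i, j). i < j}))"
  have "0 < \<beta>"
    unfolding \<beta>_def using noncol l by (auto simp: v_def scaleR_right_diff_distrib[symmetric])
  have sep: "\<beta> \<le> norm (v $ i - v $ j)" if "i < j" for i j
    unfolding \<beta>_def using that by (intro Min_le) auto
  obtain C \<epsilon> s0 where C: "0 \<le> C" "0 < \<epsilon>"
    "\<And>T y. s0 \<le> T \<Longrightarrow> norm (?L ((1 / T) *\<^sub>R (y - p) - v)) \<le> \<epsilon> \<Longrightarrow>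
      ?d p y \<le> sqrt (2 * h) * norm (?L (y - p)) + C * sqrt T"
    using jm_real_dist_cone[where m = m, OF m \<open>h > 0\<close> \<open>0 < \<beta>\<close> sep, where p = p] by blast
  have axis: "?d p (p + T *\<^sub>R v) \<le> T + C * sqrt T" if "max s0 1 \<le> T" for T
  proof -
    have "?d p (p + T *\<^sub>R v) \<le> sqrt (2 * h) * norm (?L ((p + T *\<^sub>R v) - p)) + C * sqrt T"
      using that C(2) by (intro C(3)) (auto simp: linear_0[OF lin])
    also have "sqrt (2 * h) * norm (?L ((p + T *\<^sub>R v) - p)) = T * (sqrt (2 * h) * norm (?L v))"
      using that by (simp add: linear_scale[OF lin])
    finally show ?thesis using unit by simp
  qed
  obtain \<gamma> K s1 where \<gamma>: "\<gamma> 0 = p" "\<And>s t. 0 \<le> s \<Longrightarrow> 0 \<le> t \<Longrightarrow> ?d (\<gamma> s) (\<gamma> t) = \<bar>s - t\<bar>"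
    "0 < s1" "\<And>s. s1 \<le> s \<Longrightarrow> norm (?L (\<gamma> s - p - s *\<^sub>R v)) \<le> s * (K * (1 / sqrt (sqrt s)))"
  proof (rule exists_ray_with_direction[OF C(1,2), of s0 p v])
    show "?d p y \<le> sqrt (2 * h) * norm (?L (y - p)) + C * sqrt (?d p y)"
      if "s0 \<le> ?d p y" "direction_error p v y \<le> \<epsilon>" for y
      using that by (intro C(3)) (auto simp: direction_error_def)
    show "\<exists>y. S \<le> ?d p y \<and> direction_error p v y \<le> \<eta>" if "0 < \<eta>" for S \<eta>
      unfolding direction_error_def
      by (rule jm_real_dist_far_points[where m = m, OF m \<open>h > 0\<close> unit C(1) axis that])
  qed blast
  have "continuous_on {0..} \<gamma>"
  proof -
    obtain B where B: "0 < B" "\<And>x :: ('e, 'n) vec. norm x \<le> B * norm (?L x)" using L_bounded_below by metis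
    have lip: "dist (\<gamma> s) (\<gamma> t) \<le> B / sqrt (2 * h) * dist s t" if "0 \<le> s" "0 \<le> t" for s t
    proof -
      have "sqrt (2 * h) * norm (?L (\<gamma> s - \<gamma> t)) \<le> dist s t"
        using norm_le[of "\<gamma> s" "\<gamma> t"] \<gamma>(2)[OF that] by (simp add: dist_real_def)
      then have "norm (?L (\<gamma> s - \<gamma> t)) \<le> dist s t / sqrt (2 * h)"
        using c_pos by (simp add: field_simps)
      then have "B * norm (?L (\<gamma> s - \<gamma> t)) \<le> B * (dist s t / sqrt (2 * h))"
        using B(1) by (intro mult_left_mono) auto
      with B(2)[of "\<gamma> s - \<gamma> t"] show ?thesis by (simp add: dist_norm)
    qed
    have "(B / sqrt (2 * h))-lipschitz_on {0..} \<gamma>"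
      using lip B(1) c_pos by (intro lipschitz_onI) auto
    then show ?thesis by (rule lipschitz_on_continuous_on)
  qed
  moreover have "jm_dist m h (\<gamma> s) (\<gamma> t) = ennreal \<bar>t - s\<bar>" if "0 \<le> s" "0 \<le> t" for s t
    using \<gamma>(2)[OF that] jm_dist_eq_real[where m = m, OF m less_imp_le[OF \<open>h > 0\<close>], where x = "\<gamma> s" and y = "\<gamma> t"]
    by (simp add: abs_minus_commute)
  ultimately have "jm_geodesic_ray m h p \<gamma>"
    using \<gamma>(1) by (simp add: jm_geodesic_ray_def)
  moreover have "has_asymptotic_direction m \<gamma> a"
    unfolding has_asymptotic_direction_def
  proof (intro exI conjI)
    show "0 < l" by (rule l)
    show "(\<lambda>s. mass_norm m (\<gamma> s - (l * s) *\<^sub>R a)) \<in> o(\<lambda>s. s)"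
    proof (rule smalloI_tendsto)
      show "\<forall>\<^sub>F s :: real in at_top. s \<noteq> 0" using eventually_gt_at_top[of 0] by eventually_elim simp
      have lim: "((\<lambda>s. K * (1 / sqrt (sqrt s)) + norm (?L p) / s) \<longlongrightarrow> K * 0 + 0) at_top"
        by (intro tendsto_add tendsto_mult tendsto_const tendsto_divide_0[OF tendsto_const]
            filterlim_at_top_imp_at_infinity filterlim_compose[OF sqrt_at_top sqrt_at_top] filterlim_ident)
      have "\<forall>\<^sub>F s in at_top. norm (mass_norm m (\<gamma> s - (l * s) *\<^sub>R a) / s)
          \<le> K * (1 / sqrt (sqrt s)) + norm (?L p) / s"
        using eventually_ge_at_top[of s1]
      proof eventually_elim
        case (elim s)
        then have "0 < s" using \<gamma>(3) by simp
        have "\<gamma> s - (l * s) *\<^sub>R a = (\<gamma> s - p - s *\<^sub>R v) + p" by (simp add: v_def)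
        then have "mass_norm m (\<gamma> s - (l * s) *\<^sub>R a) = norm (?L (\<gamma> s - p - s *\<^sub>R v) + ?L p)"
          by (simp only: mass_norm_eq[where m = m, OF m] linear_add[OF lin])
        also have "\<dots> \<le> s * (K * (1 / sqrt (sqrt s))) + norm (?L p)"
          using \<gamma>(4)[OF elim] norm_triangle_ineq[of "?L (\<gamma> s - p - s *\<^sub>R v)" "?L p"] by linarith
        finally have "mass_norm m (\<gamma> s - (l * s) *\<^sub>R a) / s \<le> (s * (K * (1 / sqrt (sqrt s))) + norm (?L p)) / s"
          using \<open>0 < s\<close> by (intro divide_right_mono) auto
        also have "\<dots> = K * (1 / sqrt (sqrt s)) + norm (?L p) / s"
          using \<open>0 < s\<close> by (simp add: add_divide_distrib)
        finally show ?case using \<open>0 < s\<close> by (simp add: mass_norm_eq[where m = m, OF m])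
      qed
      then show "((\<lambda>s. mass_norm m (\<gamma> s - (l * s) *\<^sub>R a) / s) \<longlongrightarrow> 0) at_top"
        by (rule Lim_null_comparison) (use lim in simp)
    qed
  qed
  ultimately show ?thesis by blast
qed

end
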